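(* Let $K$ be a field, $n\ge 1$, $S=K[x_1,\ldots,x_n]$, $T=K[x_1,\ldots,x_{n-1}]$, and let $\varphi\colon S\to T$ be the $K$-algebra homomorphism with $x_i\mapsto x_i$ for $i=1,\ldots,n-1$ and $x_n\mapsto 1$. Let $I\subset S$ be a monomial ideal. (1) If $I$ is clean, then $\varphi(I)\subset T$ is clean. (2) If $I$ is pretty clean, then $\varphi(I)\subset T$ is pretty clean. (3) In particular, if $I$ is pretty clean, then $\varphi(I)\subset T$ is a Stanley ideal, i.e. $\operatorname{sdepth} T/\varphi(I)\ge\operatorname{depth} T/\varphi(I)$.
   Context: The following definitions are given for $S$ and apply equally to $T$. A monomial prime ideal is a prime ideal generated by a (possibly empty) subset of the variables. For a monomial ideal $I\subset S$, a prime filtration of $S/I$ is a chain of monomial ideals $\mathcal P: I=I_0\subset I_1\subset\cdots\subset I_r=S$ such that for each $j=1,\ldots,r$ there is an isomorphism of $\mathbb Z^n$-graded $S$-modules $I_j/I_{j-1}\cong(S/P_j)(-a_j)$ with $P_j$ a monomial prime ideal and $a_j\in\mathbb Z^n$; its support is $\operatorname{Supp}(\mathcal P)=\{P_1,\ldots,P_r\}$. The filtration $\mathcal P$ is clean if $\operatorname{Supp}(\mathcal P)=\operatorname{Min}(S/I)$, the set of minimal prime ideals of $I$. It is pretty clean if for all $i<j$ the inclusion $P_i\subset P_j$ implies $P_i=P_j$. The ideal $I$ is called clean (resp. pretty clean) if $S/I$ has a clean (resp. pretty clean) filtration. Let $I^c\subset S$ be the $K$-linear span of all monomials not in $I$.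 For a monomial $u\in S$ and $Z\subset\{x_1,\ldots,x_n\}$, the $K$-subspace $uK[Z]$ with basis all monomials $uv$, $v$ a monomial of $K[Z]$, is called a Stanley space of dimension $|Z|$. A Stanley decomposition $\mathcal D$ of $S/I$ is a decomposition of $I^c$ as a finite direct sum of Stanley spaces; $\operatorname{sdepth}\mathcal D$ is the minimal dimension of a Stanley space in $\mathcal D$, and $\operatorname{sdepth} S/I$ is the maximum of $\operatorname{sdepth}\mathcal D$ over all Stanley decompositions $\mathcal D$ of $S/I$. The ideal $I$ is a Stanley ideal if $\operatorname{sdepth} S/I\ge\operatorname{depth} S/I$, where $\operatorname{depth}$ is the depth with respect to the graded maximal ideal generated by the variables. Convention: for the zero module (when the ideal is the whole ring) both $\operatorname{sdepth}$ and $\operatorname{depth}$ are $+\infty$. *)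

theory Defs
  imports "HOL-Algebra.QuotRing" "HOL-Algebra.Module" "HOL-Library.Poly_Mapping"
    "HOL-Library.Extended_Nat" "HOL-Library.FuncSet"
begin

text \<open>
  A polynomial is a finitely supported map from exponent vectors to coefficients, an exponent
  vector a finitely supported map from indices to naturals.  \<open>poly_ring n\<close> is
  \<open>K[x_1, ..., x_n]\<close>, carved out of \<open>K[x_0, x_1, x_2, ...]\<close>; thus \<open>T\<close> is \<open>poly_ring (n - 1)\<close>,
  and it is literally a subset of \<open>S = poly_ring n\<close>.
\<close>

type_synonym 'a mpol = "(nat \<Rightarrow>\<^sub>0 nat) \<Rightarrow>\<^sub>0 'a"

definition exps :: "nat set \<Rightarrow> (nat \<Rightarrow>\<^sub>0 nat) set" where
  "exps Z = {m. Poly_Mapping.keys m \<subseteq> Z}"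

definition mon :: "(nat \<Rightarrow>\<^sub>0 nat) \<Rightarrow> 'a::field mpol" where
  "mon m = Poly_Mapping.single m 1"

definition const :: "'a \<Rightarrow> 'a::field mpol" where
  "const c = Poly_Mapping.single 0 c"

definition var :: "nat \<Rightarrow> 'a::field mpol" where
  "var i = mon (Poly_Mapping.single i 1)"

definition poly_ring :: "nat \<Rightarrow> 'a::field mpol ring" where
  "poly_ring n = \<lparr>carrier = {p. Poly_Mapping.keys p \<subseteq> exps {1..n}}, mult = (*), one = 1, zero = 0, add = (+)\<rparr>"

definition algebra_hom :: "nat \<Rightarrow> nat \<Rightarrow> ('a::field mpol \<Rightarrow> 'a mpol) \<Rightarrow> bool" where
  "algebra_hom n m h \<longleftrightarrow>
     h \<in> ring_hom (poly_ring n) (poly_ring m) \<and> (\<forall>c. h (const c) = const c)"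

global_interpretation mpol: vector_space "\<lambda>c (p :: 'a::field mpol). const c * p"
  by unfold_locales
    (simp_all add: const_def algebra_simps single_add mult_single flip: single_one mult.assoc)


subsection \<open>Monomial ideals and prime ideals\<close>

definition monomial_ideal :: "nat \<Rightarrow> 'a::field mpol set \<Rightarrow> bool" where
  "monomial_ideal n I \<longleftrightarrow> (\<exists>A \<subseteq> exps {1..n}. I = Idl\<^bsub>poly_ring n\<^esub> (mon ` A))"

definition monomial_prime :: "nat \<Rightarrow> 'a::field mpol set \<Rightarrow> bool" where
  "monomial_prime n P \<longleftrightarrow>
     primeideal P (poly_ring n) \<and> (\<exists>Z \<subseteq> {1..n}. P = Idl\<^bsub>poly_ring n\<^esub> (var ` Z))"

definition minimal_primes :: "('r, 'm) ring_scheme \<Rightarrow> 'r set \<Rightarrow> 'r set set" where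
  "minimal_primes R I = {P. primeideal P R \<and> I \<subseteq> P \<and>
     (\<forall>Q. primeideal Q R \<and> I \<subseteq> Q \<and> Q \<subseteq> P \<longrightarrow> Q = P)}"


subsection \<open>Graded modules\<close>

text \<open>
  The \<open>R\<close>-module \<open>J / I\<close> for ideals \<open>I \<subseteq> J\<close>.  The fields \<open>mult\<close> and \<open>one\<close> are only there because
  module records extend ring records; they carry no meaning for modules.
\<close>

definition quot_module :: "('r, 'm) ring_scheme \<Rightarrow> 'r set \<Rightarrow> 'r set \<Rightarrow> ('r, 'r set) module" where
  "quot_module R J I =
     \<lparr>carrier = (\<lambda>x. I +>\<^bsub>R\<^esub> x) ` J,
      mult = rcoset_mult R I, one = I +>\<^bsub>R\<^esub> \<one>\<^bsub>R\<^esub>,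
      zero = I, add = set_add R,
      smult = (\<lambda>r X. \<Union>x\<in>X. I +>\<^bsub>R\<^esub> (r \<otimes>\<^bsub>R\<^esub> x))\<rparr>"

type_synonym degree = "nat \<Rightarrow>\<^sub>0 int"

definition degrees :: "nat \<Rightarrow> degree set" where
  "degrees n = {d. Poly_Mapping.keys d \<subseteq> {1..n}}"

text \<open>Homogeneous components of \<open>S\<close>; the component is \<open>{0}\<close> if \<open>d\<close> has a negative entry.\<close>

definition component :: "nat \<Rightarrow> degree \<Rightarrow> 'a::field mpol set" where
  "component n d =
     {p \<in> carrier (poly_ring n). \<forall>m\<in>Poly_Mapping.keys p. \<forall>i. int (Poly_Mapping.lookup m i) = Poly_Mapping.lookup d i}"

definition quot_component ::
    "nat \<Rightarrow> 'a::field mpol set \<Rightarrow> 'a mpol set \<Rightarrow> degree \<Rightarrow> 'a mpol set set" where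
  "quot_component n J I d = (\<lambda>p. I +>\<^bsub>poly_ring n\<^esub> p) ` (J \<inter> component n d)"

text \<open>
  Graded modules are given as a module together with its family of homogeneous components;
  isomorphisms are the module isomorphisms that preserve degrees.
\<close>

definition graded_iso ::
    "nat \<Rightarrow> ('r, 'm) ring_scheme \<Rightarrow> ('r, 'u) module \<Rightarrow> (degree \<Rightarrow> 'u set)
       \<Rightarrow> ('r, 'v) module \<Rightarrow> (degree \<Rightarrow> 'v set) \<Rightarrow> bool" where
  "graded_iso n R M Mdeg N Ndeg \<longleftrightarrow>
     (\<exists>h \<in> iso (add_monoid M) (add_monoid N).
        (\<forall>r\<in>carrier R. \<forall>x\<in>carrier M. h (r \<odot>\<^bsub>M\<^esub> x) = r \<odot>\<^bsub>N\<^esub> h x) \<and>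
        (\<forall>d\<in>degrees n. h ` Mdeg d = Ndeg d))"

text \<open>\<open>M(-a)\<close> has \<open>M_{d-a}\<close> as its component of degree \<open>d\<close>.\<close>

definition shift :: "degree \<Rightarrow> (degree \<Rightarrow> 'u set) \<Rightarrow> degree \<Rightarrow> 'u set" where
  "shift a Mdeg = (\<lambda>d. Mdeg (d - a))"


subsection \<open>Prime filtrations\<close>

text \<open>
  The chain is \<open>F 0, ..., F r\<close>, and \<open>P j\<close> belongs to the factor \<open>F j / F (j - 1)\<close>.  The values of
  \<open>F\<close> beyond \<open>r\<close> and of \<open>P\<close> outside \<open>{1..r}\<close> are irrelevant.  The inclusions are automatically
  strict because the factors are non-zero.  For \<open>I = S\<close> the filtration has length \<open>0\<close>.
\<close>

definition prime_filtration ::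
    "nat \<Rightarrow> 'a::field mpol set \<Rightarrow> nat \<Rightarrow> (nat \<Rightarrow> 'a mpol set) \<Rightarrow> (nat \<Rightarrow> 'a mpol set) \<Rightarrow> bool" where
  "prime_filtration n I r F P \<longleftrightarrow>
     F 0 = I \<and> F r = carrier (poly_ring n) \<and> (\<forall>j\<le>r. monomial_ideal n (F j)) \<and>
     (\<forall>j\<in>{1..r}. F (j - 1) \<subseteq> F j \<and> monomial_prime n (P j) \<and>
        (\<exists>a\<in>degrees n.
           graded_iso n (poly_ring n)
             (quot_module (poly_ring n) (F j) (F (j - 1)))
             (quot_component n (F j) (F (j - 1)))
             (quot_module (poly_ring n) (carrier (poly_ring n)) (P j))
             (shift a (quot_component n (carrier (poly_ring n)) (P j)))))"

definition clean :: "nat \<Rightarrow> 'a::field mpol set \<Rightarrow> bool" where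
  "clean n I \<longleftrightarrow>
     (\<exists>r F P. prime_filtration n I r F P \<and> P ` {1..r} = minimal_primes (poly_ring n) I)"

definition pretty_clean :: "nat \<Rightarrow> 'a::field mpol set \<Rightarrow> bool" where
  "pretty_clean n I \<longleftrightarrow>
     (\<exists>r F P. prime_filtration n I r F P \<and>
        (\<forall>i\<in>{1..r}. \<forall>j\<in>{1..r}. i < j \<longrightarrow> P i \<subseteq> P j \<longrightarrow> P i = P j))"


subsection \<open>Stanley depth\<close>

definition stanley_space :: "(nat \<Rightarrow>\<^sub>0 nat) \<Rightarrow> nat set \<Rightarrow> 'a::field mpol set" where
  "stanley_space u Z = mpol.span {mon u * mon v | v. v \<in> exps Z}"

definition monomial_complement :: "nat \<Rightarrow> 'a::field mpol set \<Rightarrow> 'a mpol set" where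
  "monomial_complement n I = mpol.span {mon m | m. m \<in> exps {1..n} \<and> mon m \<notin> I}"

text \<open>
  The subspace \<open>W\<close> is the internal direct sum of the \<open>V d\<close>: summation is a bijection from the
  external direct sum (families with \<open>f d \<in> V d\<close>) onto \<open>W\<close>.
\<close>

definition direct_sum_decomp :: "'i set \<Rightarrow> ('i \<Rightarrow> 'v::comm_monoid_add set) \<Rightarrow> 'v set \<Rightarrow> bool" where
  "direct_sum_decomp D V W \<longleftrightarrow>
     finite D \<and> bij_betw (\<lambda>f. \<Sum>d\<in>D. f d) (\<Pi>\<^sub>E d\<in>D. V d) W"

text \<open>
  A pair \<open>(u, Z)\<close> stands for the Stanley space \<open>uK[Z]\<close>.  A set of pairs loses nothing against a
  family: Stanley spaces are non-zero, so none is repeated in a direct sum.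
\<close>

definition stanley_decomp ::
    "nat \<Rightarrow> 'a::field mpol set \<Rightarrow> ((nat \<Rightarrow>\<^sub>0 nat) \<times> nat set) set \<Rightarrow> bool" where
  "stanley_decomp n I D \<longleftrightarrow>
     (\<forall>(u, Z)\<in>D. u \<in> exps {1..n} \<and> Z \<subseteq> {1..n}) \<and>
     direct_sum_decomp D (\<lambda>(u, Z). stanley_space u Z :: 'a mpol set) (monomial_complement n I)"

definition sdepth_decomp :: "((nat \<Rightarrow>\<^sub>0 nat) \<times> nat set) set \<Rightarrow> enat" where
  "sdepth_decomp D = (INF (u, Z)\<in>D. enat (card Z))"

text \<open>
  For \<open>I \<noteq> S\<close> the supremum is a maximum, as all values are at most \<open>n\<close>; for \<open>I = S\<close> the
  only decomposition is the empty one, and the value is \<open>\<infinity>\<close>.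
\<close>

definition sdepth :: "nat \<Rightarrow> 'a::field mpol set \<Rightarrow> enat" where
  "sdepth n I = (SUP D\<in>{D. stanley_decomp n I D}. sdepth_decomp D)"


subsection \<open>Depth\<close>

text \<open>The submodule \<open>A M\<close> generated by all \<open>a z\<close> with \<open>a \<in> A\<close>, \<open>z \<in> M\<close>.\<close>

definition times_module ::
    "('r, 'm) ring_scheme \<Rightarrow> ('r, 'u, 'k) module_scheme \<Rightarrow> 'r set \<Rightarrow> 'u set" where
  "times_module R M A =
     \<Inter>{N. submodule N R M \<and> {a \<odot>\<^bsub>M\<^esub> z | a z. a \<in> A \<and> z \<in> carrier M} \<subseteq> N}"

text \<open>
  Each \<open>xs ! i\<close> is a non-zero-divisor on \<open>M / (xs ! 0, ..., xs ! (i - 1)) M\<close>, and \<open>M / (xs) M\<close>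
  is non-zero.
\<close>

definition regular_sequence ::
    "('r, 'm) ring_scheme \<Rightarrow> ('r, 'u, 'k) module_scheme \<Rightarrow> 'r list \<Rightarrow> bool" where
  "regular_sequence R M xs \<longleftrightarrow>
     set xs \<subseteq> carrier R \<and>
     (\<forall>i<length xs. \<forall>z\<in>carrier M.
        xs ! i \<odot>\<^bsub>M\<^esub> z \<in> times_module R M (set (take i xs)) \<longrightarrow>
        z \<in> times_module R M (set (take i xs))) \<and>
     times_module R M (set xs) \<noteq> carrier M"

definition module_depth ::
    "('r, 'm) ring_scheme \<Rightarrow> 'r set \<Rightarrow> ('r, 'u, 'k) module_scheme \<Rightarrow> enat" where
  "module_depth R J M =
     (if carrier M = {\<zero>\<^bsub>M\<^esub>} then \<infinity>
      else (SUP xs\<in>{xs. set xs \<subseteq> J \<and> regular_sequence R M xs}. enat (length xs)))"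

definition quot_depth :: "nat \<Rightarrow> 'a::field mpol set \<Rightarrow> enat" where
  "quot_depth n I =
     module_depth (poly_ring n) (Idl\<^bsub>poly_ring n\<^esub> (var ` {1..n}))
       (quot_module (poly_ring n) (carrier (poly_ring n)) I)"

definition stanley_ideal :: "nat \<Rightarrow> 'a::field mpol set \<Rightarrow> bool" where
  "stanley_ideal n I \<longleftrightarrow> monomial_ideal n I \<and> sdepth n I \<ge> quot_depth n I"

end

(*
  A monomial ideal is an up-closed set of exponent vectors.  Comparing graded components, a prime
  filtration with factors (S/P_j)(-a_j) is a chain V_0 <= ... <= V_r of up-closed sets whose
  differences are cells m_j + N^(Z_j), where P_j is generated by the variables outside Z_j.

  Setting x_n = 1 maps V_j to its projection along x_n.  A cell with n in Z_j projects to the cell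
  with directions Z_j - {n}; a cell with n not in Z_j does not change the projected set, and that
  step is dropped.  Hence the new support consists of contractions of old primes, and pretty
  cleanness is inherited.  So is cleanness: every prime over the ideal contains some P_j and every
  P_j contains the ideal, so clean means that the support is an antichain.

  For (3), the cells form a Stanley decomposition, so sdepth is at least min |Z_j|.  In a pretty
  clean filtration every P_j is the annihilator of a monomial w modulo the ideal.  The products of
  powers of a regular sequence are linearly independent on w (Krull's intersection theorem in the
  local ring), while modulo P_j more than |Z_j| polynomials are algebraically dependent, so a
  regular sequence has length at most |Z_j|.
*)

theory Submission
  imports Defs
begin


text \<open>The definition of depth admits arbitrary polynomials without constant term, not only
  homogeneous ones. An element that such a polynomial divides indefinitely is only known to vanish
  after multiplication by some 1 + y with y in the maximal ideal. This is why the torsion statements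
  are about \<open>loc\<close> and not about the ideal itself. Nothing is lost for a monomial w
  outside the ideal: multiplied by 1 + y it keeps its own exponent with coefficient 1.

  Primes enter in two ways. Inclusions among the P_j are reversed inclusions among the sets Z_j,
  hence combinatorial. Primality is supplied by the given filtration and descends to T by
  contraction, since T is a subring of S and every surviving Z_j contains n.\<close>

text \<open>Prevents the simplifier from rewriting \<open>{1..n}\<close> to \<open>{Suc 0..n}\<close>.\<close>

declare One_nat_def [simp del]

section \<open>Polynomials supported on a set of exponents\<close>

abbreviation polys :: "nat \<Rightarrow> 'a::field mpol set" where
  "polys n \<equiv> carrier (poly_ring n)"

text \<open>Polynomial rings, monomial ideals and Stanley spaces all have this form. Inclusion and
  equality of such spaces then become statements about sets of exponents, by
  \<open>supp_in_subset_iff\<close>.\<close>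

definition supp_in :: "(nat \<Rightarrow>\<^sub>0 nat) set \<Rightarrow> 'a::field mpol set" where
  "supp_in X = {p. Poly_Mapping.keys p \<subseteq> X}"

lemma poly_ring_simps [simp]:
  "carrier (poly_ring n) = supp_in (exps {1..n})"
  "x \<otimes>\<^bsub>poly_ring n\<^esub> y = x * y" "\<one>\<^bsub>poly_ring n\<^esub> = 1"
  "\<zero>\<^bsub>poly_ring n\<^esub> = 0" "x \<oplus>\<^bsub>poly_ring n\<^esub> y = x + y"
  by (simp_all add: poly_ring_def supp_in_def)

lemma zero_in_exps [simp]: "0 \<in> exps Z"
  by (simp add: exps_def)

lemma plus_in_exps_iff [simp]: "a + b \<in> exps Z \<longleftrightarrow> a \<in> exps Z \<and> b \<in> exps Z"
  by (auto simp: exps_def subset_iff in_keys_iff lookup_add)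

lemma single_in_exps_iff [simp]: "Poly_Mapping.single i k \<in> exps Z \<longleftrightarrow> k = 0 \<or> i \<in> Z"
  by (simp add: exps_def)

lemma zero_in_supp_in [simp]: "0 \<in> supp_in X"
  by (simp add: supp_in_def)

lemma add_in_supp_in: "p \<in> supp_in X \<Longrightarrow> q \<in> supp_in X \<Longrightarrow> p + q \<in> supp_in X"
  using keys_add[of p q] by (auto simp: supp_in_def)

lemma uminus_in_supp_in [simp]: "- p \<in> supp_in X \<longleftrightarrow> p \<in> supp_in X"
  by (auto simp: supp_in_def in_keys_iff)

lemma diff_in_supp_in: "p \<in> supp_in X \<Longrightarrow> q \<in> supp_in X \<Longrightarrow> p - q \<in> supp_in X"
  using add_in_supp_in[of p X "- q"] by simp

lemma mult_in_supp_in: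
  assumes "p \<in> supp_in X" "q \<in> supp_in Y" "\<And>a b. a \<in> X \<Longrightarrow> b \<in> Y \<Longrightarrow> a + b \<in> V"
  shows "p * q \<in> supp_in V"
  using keys_mult[of p q] assms by (force simp: supp_in_def)

lemma mult_in_polys: "p \<in> polys n \<Longrightarrow> q \<in> polys n \<Longrightarrow> p * q \<in> polys n"
  by (auto elim: mult_in_supp_in)

lemma one_in_supp_in [simp]: "1 \<in> supp_in X \<longleftrightarrow> 0 \<in> X"
  by (simp add: supp_in_def)

lemma mon_in_supp_in [simp]: "mon m \<in> supp_in X \<longleftrightarrow> m \<in> X"
  by (simp add: supp_in_def mon_def)

lemma const_in_supp_in: "0 \<in> X \<Longrightarrow> const c \<in> supp_in X"
  by (simp add: supp_in_def const_def)

lemma sum_in_supp_in: "(\<And>i. i \<in> A \<Longrightarrow> f i \<in> supp_in X) \<Longrightarrow> sum f A \<in> supp_in X"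
  by (induction A rule: infinite_finite_induct) (auto intro: add_in_supp_in)

lemma supp_in_mono: "X \<subseteq> Y \<Longrightarrow> supp_in X \<subseteq> supp_in Y"
  by (auto simp: supp_in_def)

lemma supp_in_subset_iff: "(supp_in X :: 'a::field mpol set) \<subseteq> supp_in Y \<longleftrightarrow> X \<subseteq> Y"
proof
  assume *: "(supp_in X :: 'a mpol set) \<subseteq> supp_in Y"
  show "X \<subseteq> Y"
  proof
    fix m assume "m \<in> X"
    then have "(mon m :: 'a mpol) \<in> supp_in X" by simp
    then have "(mon m :: 'a mpol) \<in> supp_in Y" using * by blast
    then show "m \<in> Y" by simp
  qed
qed (rule supp_in_mono)

lemma supp_in_inject: "(supp_in X :: 'a::field mpol set) = supp_in Y \<longleftrightarrow> X = Y"
  by (metis supp_in_subset_iff subset_antisym order_refl)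

lemma mon_0 [simp]: "mon 0 = 1"
  by (simp add: mon_def)

lemma mon_add: "mon (a + b) = mon a * mon b"
  by (simp add: mon_def mult_single)

lemma const_mon: "const c * mon m = Poly_Mapping.single m c"
  by (simp add: const_def mon_def mult_single)

lemma const_simps [simp]: "const 0 = 0" "const 1 = 1"
  by (simp_all add: const_def)

lemma const_mult: "const (a * b) = const a * const b"
  by (simp add: const_def mult_single)

lemma mpol_eq_sum: "p = (\<Sum>m\<in>Poly_Mapping.keys p. const (Poly_Mapping.lookup p m) * mon m)"
proof (rule poly_mapping_eqI)
  fix k
  have "Poly_Mapping.lookup (\<Sum>m\<in>Poly_Mapping.keys p. const (Poly_Mapping.lookup p m) * mon m) k
      = (\<Sum>m\<in>Poly_Mapping.keys p. if m = k then Poly_Mapping.lookup p m else 0)"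
    by (simp add: const_mon lookup_sum lookup_single when_def)
  also have "\<dots> = Poly_Mapping.lookup p k"
    by (auto simp: sum.delta in_keys_iff)
  finally show "Poly_Mapping.lookup p k
      = Poly_Mapping.lookup (\<Sum>m\<in>Poly_Mapping.keys p. const (Poly_Mapping.lookup p m) * mon m) k" ..
qed

lemma lookup_mon_mult_add [simp]:
  "Poly_Mapping.lookup (mon a * p) (a + b) = Poly_Mapping.lookup p b"
proof -
  have "mon a * p = (\<Sum>m\<in>Poly_Mapping.keys p. const (Poly_Mapping.lookup p m) * mon (a + m))"
    by (subst mpol_eq_sum[of p]) (simp add: sum_distrib_left mon_add mult_ac)
  then have "Poly_Mapping.lookup (mon a * p) (a + b)
      = (\<Sum>m\<in>Poly_Mapping.keys p. if m = b then Poly_Mapping.lookup p m else 0)"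
    by (simp add: const_mon lookup_sum lookup_single when_def)
  then show ?thesis by (auto simp: sum.delta in_keys_iff)
qed

lemma keys_mon_mult: "Poly_Mapping.keys (mon a * p) = (+) a ` Poly_Mapping.keys p"
proof
  show "Poly_Mapping.keys (mon a * p) \<subseteq> (+) a ` Poly_Mapping.keys p"
    using keys_mult[of "mon a" p] by (auto simp: mon_def)
  show "(+) a ` Poly_Mapping.keys p \<subseteq> Poly_Mapping.keys (mon a * p)"
    by (auto simp: in_keys_iff)
qed

lemma mon_mult_in_supp_in_iff: "mon a * p \<in> supp_in X \<longleftrightarrow> (\<forall>m\<in>Poly_Mapping.keys p. a + m \<in> X)"
  by (auto simp: supp_in_def keys_mon_mult)

lemma lookup_const_mult [simp]: "Poly_Mapping.lookup (const c * p) m = c * Poly_Mapping.lookup p m"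
proof -
  have "const c * p = Poly_Mapping.map ((*) c) p"
    by (simp add: const_def mult_map_scale_conv_mult)
  then show ?thesis by (simp add: Poly_Mapping.map.rep_eq when_def)
qed


subsection \<open>Ideals of the polynomial ring\<close>

lemma cring_poly_ring: "cring (poly_ring n)" (is "cring ?R")
proof (rule cringI)
  show "abelian_group ?R"
  proof (rule abelian_groupI)
    fix x assume x: "x \<in> carrier ?R"
    then show "\<exists>y\<in>carrier ?R. y \<oplus>\<^bsub>?R\<^esub> x = \<zero>\<^bsub>?R\<^esub>"
      by (intro bexI[of _ "- x"]) auto
  qed (auto intro: add_in_supp_in simp: add_ac)
  show "comm_monoid ?R"
    by (rule comm_monoidI) (auto simp: mult_ac intro: mult_in_polys[simplified])
qed (simp add: algebra_simps)

lemma ring_poly_ring: "ring (poly_ring n)"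
  using cring_poly_ring cring.axioms(1) by blast

lemma const_mult_in_supp_in [simp, intro]: "p \<in> supp_in X \<Longrightarrow> const c * p \<in> supp_in X"
  by (auto simp: supp_in_def in_keys_iff)

lemma const_neg_one_mult: "const (- 1) * p = - p"
  by (rule poly_mapping_eqI) simp

text \<open>Negation is multiplication by the constant -1, which reduces the subgroup condition to
  closure under sums.\<close>

lemma ideal_iff:
  "ideal I (poly_ring n) \<longleftrightarrow> I \<subseteq> polys n \<and> 0 \<in> I \<and> (\<forall>x\<in>I. \<forall>y\<in>I. x + y \<in> I) \<and>
     (\<forall>r\<in>polys n. \<forall>x\<in>I. r * x \<in> I)" (is "?L \<longleftrightarrow> ?R")
proof
  assume ?L
  then interpret ideal I "poly_ring n" .
  show ?R
    using a_subset I_l_closed additive_subgroup.zero_closed[OF is_additive_subgroup]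
      additive_subgroup.a_closed[OF is_additive_subgroup]
    by simp
next
  assume R: ?R
  have neg: "- x \<in> I" if "x \<in> I" for x
    using R that const_neg_one_mult[of x] const_in_supp_in[of "exps {1..n}" "- 1"]
    by (metis poly_ring_simps(1) zero_in_exps)
  have "subgroup I (add_monoid (poly_ring n))"
  proof (rule group.subgroupI)
    show "group (add_monoid (poly_ring n))"
      using abelian_group.a_group[OF ring.is_abelian_group[OF ring_poly_ring]] .
    show "inv\<^bsub>add_monoid (poly_ring n)\<^esub> x \<in> I" if x: "x \<in> I" for x
    proof -
      have "\<ominus>\<^bsub>poly_ring n\<^esub> x = - x"
        by (rule abelian_group.minus_equality[OF ring.is_abelian_group[OF ring_poly_ring]])
          (use x R neg[OF x] in auto)
      then show ?thesis using neg[OF x] by (simp add: a_inv_def)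
    qed
  qed (use R in auto)
  moreover have "x * a \<in> I" "a * x \<in> I" if "a \<in> I" "x \<in> polys n" for a x
    using R that by (auto simp: mult.commute[of a x])
  ultimately show ?L
    by (intro idealI[OF ring_poly_ring]) auto
qed

lemma ideal_uminus:
  assumes "ideal I (poly_ring n)" "x \<in> I"
  shows "- x \<in> I"
  using assms const_neg_one_mult[of x] const_in_supp_in[of "exps {1..n}" "- 1"]
  unfolding ideal_iff by (metis poly_ring_simps(1) zero_in_exps)

lemma ideal_add: "ideal I (poly_ring n) \<Longrightarrow> x \<in> I \<Longrightarrow> y \<in> I \<Longrightarrow> x + y \<in> I"
  by (simp add: ideal_iff)

lemma ideal_mult: "ideal I (poly_ring n) \<Longrightarrow> r \<in> polys n \<Longrightarrow> x \<in> I \<Longrightarrow> r * x \<in> I"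
  by (simp add: ideal_iff)

lemma ideal_diff: "ideal I (poly_ring n) \<Longrightarrow> x \<in> I \<Longrightarrow> y \<in> I \<Longrightarrow> x - y \<in> I"
  using ideal_add[of I n x "- y"] ideal_uminus by fastforce

lemma ideal_zero: "ideal I (poly_ring n) \<Longrightarrow> 0 \<in> I"
  by (simp add: ideal_iff)

lemma ideal_subset: "ideal I (poly_ring n) \<Longrightarrow> I \<subseteq> polys n"
  by (simp add: ideal_iff)

lemma ideal_sum: "ideal I (poly_ring n) \<Longrightarrow> (\<And>i. i \<in> A \<Longrightarrow> f i \<in> I) \<Longrightarrow> sum f A \<in> I"
  by (induction A rule: infinite_finite_induct) (auto intro: ideal_add ideal_zero)

section \<open>Monomial ideals as up-closed sets of exponents\<close>

definition upset :: "nat \<Rightarrow> (nat \<Rightarrow>\<^sub>0 nat) set \<Rightarrow> bool" where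
  "upset n U \<longleftrightarrow> U \<subseteq> exps {1..n} \<and> (\<forall>u\<in>U. \<forall>v\<in>exps {1..n}. u + v \<in> U)"

lemma ideal_supp_in:
  assumes "upset n U"
  shows "ideal (supp_in U) (poly_ring n)"
proof -
  have "r * x \<in> supp_in U" if "r \<in> supp_in (exps {1..n})" "x \<in> supp_in U" for r x :: "'a mpol"
  proof (rule mult_in_supp_in[OF that])
    fix a b assume "a \<in> exps {1..n}" "b \<in> U"
    then have "b + a \<in> U" using assms by (simp add: upset_def)
    then show "a + b \<in> U" by (simp add: add.commute)
  qed
  then show ?thesis
    using assms by (auto simp: ideal_iff upset_def intro: add_in_supp_in supp_in_mono[THEN subsetD])
qed

lemma upset_multiples:
  assumes "A \<subseteq> exps {1..n}"
  shows "upset n {a + v |a v. a \<in> A \<and> v \<in> exps {1..n}}"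
  unfolding upset_def
proof (intro conjI ballI)
  show "{a + v |a v. a \<in> A \<and> v \<in> exps {1..n}} \<subseteq> exps {1..n}"
    using assms by auto
  fix u v assume "u \<in> {a + v |a v. a \<in> A \<and> v \<in> exps {1..n}}" and v: "v \<in> exps {1..n}"
  then obtain a w where "u + v = a + (w + v)" "a \<in> A" "w \<in> exps {1..n}"
    by (auto simp: add.assoc)
  then show "u + v \<in> {a + v |a v. a \<in> A \<and> v \<in> exps {1..n}}"
    using v by (metis (mono_tags, lifting) CollectI plus_in_exps_iff)
qed

lemma genideal_mon:
  assumes "A \<subseteq> exps {1..n}"
  shows "Idl\<^bsub>poly_ring n\<^esub> (mon ` A) = (supp_in {a + v |a v. a \<in> A \<and> v \<in> exps {1..n}} :: 'a::field mpol set)"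
    (is "?I = supp_in ?U")
proof
  have sub: "(mon ` A :: 'a mpol set) \<subseteq> polys n"
    using assms by auto
  have I: "ideal ?I (poly_ring n)"
    using ring.genideal_ideal[OF ring_poly_ring sub] .
  have AI: "mon ` A \<subseteq> ?I"
    using ring.genideal_self[OF ring_poly_ring sub] .
  have "mon ` A \<subseteq> (supp_in ?U :: 'a mpol set)"
  proof
    fix p :: "'a mpol" assume "p \<in> mon ` A"
    then obtain a where "p = mon a" "a \<in> A" by blast
    then show "p \<in> supp_in ?U" by simp (metis add_0_right zero_in_exps)
  qed
  then show "?I \<subseteq> supp_in ?U"
    by (rule ring.genideal_minimal[OF ring_poly_ring ideal_supp_in[OF upset_multiples[OF assms]]])
  show "supp_in ?U \<subseteq> ?I"
  proof
    fix p :: "'a mpol" assume p: "p \<in> supp_in ?U"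
    have "const (Poly_Mapping.lookup p m) * mon m \<in> ?I" if m: "m \<in> Poly_Mapping.keys p" for m
    proof -
      obtain a v where av: "m = a + v" "a \<in> A" "v \<in> exps {1..n}"
        using p m by (auto simp: supp_in_def)
      have "(const (Poly_Mapping.lookup p m) * mon v) * mon a \<in> ?I"
        using AI av by (intro ideal_mult[OF I]) auto
      then show ?thesis by (simp add: av mon_add mult_ac)
    qed
    then show "p \<in> ?I"
      by (subst mpol_eq_sum) (rule ideal_sum[OF I])
  qed
qed

text \<open>In the converse direction an up-closed set serves as its own set of generators.\<close>

lemma monomial_ideal_iff: "monomial_ideal n I \<longleftrightarrow> (\<exists>U. upset n U \<and> I = supp_in U)"
proof
  assume "monomial_ideal n I"
  then obtain A where A: "A \<subseteq> exps {1..n}" "I = Idl\<^bsub>poly_ring n\<^esub> (mon ` A)"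
    by (auto simp: monomial_ideal_def)
  moreover note upset_multiples[OF A(1)]
  ultimately show "\<exists>U. upset n U \<and> I = supp_in U"
    using genideal_mon[OF A(1)] by blast
next
  assume "\<exists>U. upset n U \<and> I = supp_in U"
  then obtain U where U: "upset n U" "I = supp_in U" by blast
  moreover have "{a + v |a v. a \<in> U \<and> v \<in> exps {1..n}} = U"
  proof
    show "U \<subseteq> {a + v |a v. a \<in> U \<and> v \<in> exps {1..n}}"
      by clarify (metis add_0_right zero_in_exps)
  qed (use U(1) in \<open>auto simp: upset_def\<close>)
  ultimately show "monomial_ideal n I"
    unfolding monomial_ideal_def upset_def
    by (intro exI[of _ U]) (simp add: genideal_mon)
qed

text \<open>The prime ideal generated by the variables with index outside \<open>Z\<close>.\<close>

definition coprime_ideal :: "nat \<Rightarrow> nat set \<Rightarrow> 'a::field mpol set" where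
  "coprime_ideal n Z = supp_in (exps {1..n} - exps Z)"

lemma upset_Diff_exps: "upset n (exps {1..n} - exps Z)"
  by (auto simp: upset_def)

text \<open>An exponent not supported outside \<open>W\<close> has a positive entry at some index in
  \<open>W\<close>, so that variable can be split off.\<close>

lemma genideal_var:
  assumes "W \<subseteq> {1..n}"
  shows "Idl\<^bsub>poly_ring n\<^esub> (var ` W) = (coprime_ideal n ({1..n} - W) :: 'a::field mpol set)"
proof -
  let ?A = "(\<lambda>i. Poly_Mapping.single i 1) ` W"
  have "{a + v |a v. a \<in> ?A \<and> v \<in> exps {1..n}} = exps {1..n} - exps ({1..n} - W)" (is "?X = ?Y")
  proof
    show "?X \<subseteq> ?Y" using assms by auto
    show "?Y \<subseteq> ?X"
    proof
      fix m assume m: "m \<in> ?Y"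
      then obtain i where "i \<in> Poly_Mapping.keys m" and "i \<in> W"
        by (auto simp: exps_def)
      then have i: "i \<in> W" "Poly_Mapping.lookup m i > 0"
        by (auto simp: in_keys_iff)
      \<comment> \<open>Subtraction of exponents is truncated; the positive entry at
        \<open>i\<close> makes it exact.\<close>
      have eq: "m = Poly_Mapping.single i 1 + (m - Poly_Mapping.single i 1)"
        by (rule poly_mapping_eqI) (use i in \<open>auto simp: lookup_add lookup_minus lookup_single when_def\<close>)
      moreover from this m have "m - Poly_Mapping.single i 1 \<in> exps {1..n}"
        by (metis DiffD1 plus_in_exps_iff)
      ultimately show "m \<in> ?X" using i by blast
    qed
  qed
  moreover have "(var ` W :: 'a mpol set) = mon ` ?A"
    by (simp add: var_def image_image)
  moreover have "?A \<subseteq> exps {1..n}" using assms by auto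
  ultimately show ?thesis
    using genideal_mon[of ?A n] by (simp add: coprime_ideal_def)
qed

text \<open>Enlarging \<open>Z\<close> removes generators, hence the reversal. Conditions on
  inclusions of primes turn into conditions on the sets \<open>Z\<close>.\<close>

lemma coprime_ideal_subset_iff:
  assumes "Z \<subseteq> {1..n}" "Z' \<subseteq> {1..n}"
  shows "(coprime_ideal n Z :: 'a::field mpol set) \<subseteq> coprime_ideal n Z' \<longleftrightarrow> Z' \<subseteq> Z"
proof -
  have "exps Z' \<subseteq> exps Z \<longleftrightarrow> Z' \<subseteq> Z"
  proof
    assume *: "exps Z' \<subseteq> exps Z"
    show "Z' \<subseteq> Z"
    proof
      fix i assume "i \<in> Z'"
      then have "Poly_Mapping.single i 1 \<in> exps Z'" by simp
      with * have "Poly_Mapping.single i (1::nat) \<in> exps Z" by blast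
      then show "i \<in> Z" by simp
    qed
  qed (auto simp: exps_def)
  moreover have "exps Z' \<subseteq> exps {1..n}"
    using assms by (auto simp: exps_def)
  ultimately show ?thesis
    unfolding coprime_ideal_def supp_in_subset_iff by blast
qed

lemma monomial_prime_iff:
  "monomial_prime n P \<longleftrightarrow> primeideal P (poly_ring n) \<and> (\<exists>Z \<subseteq> {1..n}. P = coprime_ideal n Z)"
proof -
  have "(\<exists>W \<subseteq> {1..n}. P = Idl\<^bsub>poly_ring n\<^esub> (var ` W)) \<longleftrightarrow> (\<exists>Z \<subseteq> {1..n}. P = coprime_ideal n Z)"
    (is "?L \<longleftrightarrow> ?R")
  proof
    assume ?L
    then show ?R using genideal_var by (metis Diff_subset)
  next
    assume ?R
    then obtain Z where Z: "Z \<subseteq> {1..n}" "P = coprime_ideal n Z" by blast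
    then have "P = Idl\<^bsub>poly_ring n\<^esub> (var ` ({1..n} - Z))"
      by (subst genideal_var) (auto simp: double_diff)
    then show ?L by blast
  qed
  then show ?thesis by (simp add: monomial_prime_def)
qed


subsection \<open>Factors of monomial ideals\<close>

lemma exps_mono: "Z \<subseteq> Z' \<Longrightarrow> exps Z \<subseteq> exps Z'"
  by (auto simp: exps_def)

lemma coset_mem_iff: "z \<in> I +>\<^bsub>poly_ring n\<^esub> x \<longleftrightarrow> z - x \<in> I"
  by (auto simp: a_r_coset_def' algebra_simps) (metis diff_add_cancel)

lemma coset_eq_iff:
  assumes "ideal I (poly_ring n)"
  shows "I +>\<^bsub>poly_ring n\<^esub> x = I +>\<^bsub>poly_ring n\<^esub> y \<longleftrightarrow> x - y \<in> I" (is "?X = ?Y \<longleftrightarrow> _")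
proof
  assume "?X = ?Y"
  moreover have "x \<in> ?X" using ideal_zero[OF assms] by (simp add: coset_mem_iff)
  ultimately show "x - y \<in> I" by (simp add: coset_mem_iff)
next
  assume xy: "x - y \<in> I"
  have "z - x \<in> I \<longleftrightarrow> z - y \<in> I" for z
    using ideal_add[OF assms, of "z - x" "x - y"] ideal_diff[OF assms, of "z - y" "x - y"] xy
    by auto
  then show "?X = ?Y" by (auto simp: coset_mem_iff)
qed

lemma coset_zero: "I +>\<^bsub>poly_ring n\<^esub> 0 = I"
  by (auto simp: coset_mem_iff)

lemma coset_add:
  assumes "ideal I (poly_ring n)"
  shows "(I +>\<^bsub>poly_ring n\<^esub> x) <+>\<^bsub>poly_ring n\<^esub> (I +>\<^bsub>poly_ring n\<^esub> y) = I +>\<^bsub>poly_ring n\<^esub> (x + y)"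
    (is "?L = ?R")
proof
  show "?L \<subseteq> ?R"
  proof
    fix z assume "z \<in> ?L"
    then obtain a b where ab: "z = a + b" "a - x \<in> I" "b - y \<in> I"
      by (auto simp: set_add_def set_mult_def coset_mem_iff)
    have "z - (x + y) = (a - x) + (b - y)" by (simp add: ab)
    then show "z \<in> ?R" using ideal_add[OF assms ab(2,3)] unfolding coset_mem_iff by metis
  qed
  show "?R \<subseteq> ?L"
  proof
    fix z assume "z \<in> ?R"
    then have "z - y \<in> I +>\<^bsub>poly_ring n\<^esub> x" by (simp add: coset_mem_iff diff_diff_eq add.commute)
    moreover have "y \<in> I +>\<^bsub>poly_ring n\<^esub> y"
      using ideal_zero[OF assms] by (simp add: coset_mem_iff)
    moreover have "z = (z - y) + y" by simp
    ultimately show "z \<in> ?L" unfolding set_add_def set_mult_def by (simp, metis)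
  qed
qed

text \<open>The cosets in the union are all equal, because \<open>r * (z - x)\<close> lies in
  \<open>I\<close>.\<close>

lemma coset_smult:
  assumes "ideal I (poly_ring n)" "r \<in> polys n"
  shows "(\<Union>z\<in>I +>\<^bsub>poly_ring n\<^esub> x. I +>\<^bsub>poly_ring n\<^esub> (r * z)) = I +>\<^bsub>poly_ring n\<^esub> (r * x)"
proof -
  have "I +>\<^bsub>poly_ring n\<^esub> (r * z) = I +>\<^bsub>poly_ring n\<^esub> (r * x)" if "z \<in> I +>\<^bsub>poly_ring n\<^esub> x" for z
    using ideal_mult[OF assms, of "z - x"] that
    by (simp add: coset_eq_iff[OF assms(1)] coset_mem_iff right_diff_distrib)
  moreover have "x \<in> I +>\<^bsub>poly_ring n\<^esub> x"
    using ideal_zero[OF assms(1)] by (simp add: coset_mem_iff)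
  ultimately show ?thesis by blast
qed

lemma quot_module_simps [simp]:
  "carrier (quot_module R J I) = (\<lambda>x. I +>\<^bsub>R\<^esub> x) ` J"
  "\<zero>\<^bsub>quot_module R J I\<^esub> = I"
  "X \<oplus>\<^bsub>quot_module R J I\<^esub> Y = X <+>\<^bsub>R\<^esub> Y"
  "r \<odot>\<^bsub>quot_module R J I\<^esub> X = (\<Union>x\<in>X. I +>\<^bsub>R\<^esub> (r \<otimes>\<^bsub>R\<^esub> x))"
  by (simp_all add: quot_module_def)

definition int_exp :: "(nat \<Rightarrow>\<^sub>0 nat) \<Rightarrow> degree" where
  "int_exp m = Poly_Mapping.map int m"

lemma lookup_int_exp [simp]: "Poly_Mapping.lookup (int_exp m) i = int (Poly_Mapping.lookup m i)"
  by (simp add: int_exp_def Poly_Mapping.map.rep_eq when_def)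

lemma int_exp_eq_iff [simp]: "int_exp m = int_exp m' \<longleftrightarrow> m = m'"
  by (auto simp: poly_mapping_eq_iff fun_eq_iff)

lemma int_exp_add: "int_exp (m + m') = int_exp m + int_exp m'"
  by (rule poly_mapping_eqI) (simp add: lookup_add)

lemma int_exp_0 [simp]: "int_exp 0 = 0"
  by (rule poly_mapping_eqI) simp

lemma int_exp_in_degrees: "m \<in> exps {1..n} \<Longrightarrow> int_exp m \<in> degrees n"
  by (auto simp: degrees_def exps_def in_keys_iff subset_iff)

lemma component_eq: "component n d = {p \<in> polys n. \<forall>m\<in>Poly_Mapping.keys p. int_exp m = d}"
  by (auto simp: component_def poly_mapping_eq_iff fun_eq_iff)

text \<open>A component always contains the zero coset, so its vanishing can be phrased as being a
  singleton, a property that every bijection preserves.\<close>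

lemma quot_component_singleton_iff:
  fixes U V :: "(nat \<Rightarrow>\<^sub>0 nat) set"
  assumes U: "upset n U" and V: "upset n V"
  shows "(\<exists>c. quot_component n (supp_in V) (supp_in U :: 'a::field mpol set) d = {c})
    \<longleftrightarrow> \<not> (\<exists>m\<in>V - U. int_exp m = d)"
proof -
  let ?I = "supp_in U :: 'a mpol set"
  let ?C = "quot_component n (supp_in V) ?I d"
  note I = ideal_supp_in[OF U]
  have 0: "?I \<in> ?C"
    unfolding quot_component_def by (rule image_eqI[of _ _ 0]) (auto simp: coset_zero component_eq)
  show ?thesis
  proof (cases "\<exists>m\<in>V - U. int_exp m = d")
    case True
    then obtain m where m: "m \<in> V" "m \<notin> U" "int_exp m = d" by blast
    have "?I +>\<^bsub>poly_ring n\<^esub> mon m \<in> ?C"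
      unfolding quot_component_def using m V
      by (intro imageI) (auto simp: component_eq upset_def mon_def[of m] supp_in_def)
    moreover have "?I +>\<^bsub>poly_ring n\<^esub> mon m \<noteq> ?I"
      using coset_eq_iff[OF I, of "mon m" 0] m by (simp add: coset_zero)
    ultimately show ?thesis using 0 True by (metis singletonD)
  next
    case False
    have "?C \<subseteq> {?I}"
    proof
      fix X assume "X \<in> ?C"
      then obtain p where p: "X = ?I +>\<^bsub>poly_ring n\<^esub> p" "p \<in> supp_in V" "p \<in> component n d"
        by (auto simp: quot_component_def)
      then have "p \<in> ?I" using False by (auto simp: component_eq supp_in_def)
      then show "X \<in> {?I}"
        using coset_eq_iff[OF I, of p 0] p by (simp add: coset_zero)
    qed
    with 0 False show ?thesis by blast
  qed
qed

text \<open>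
  Only the bijectivity and the degrees of the isomorphism are used: a graded isomorphism matches
  the non-zero components.
\<close>

lemma graded_iso_imp_cell:
  fixes U V :: "(nat \<Rightarrow>\<^sub>0 nat) set"
  assumes U: "upset n U" and V: "upset n V" and Z: "Z \<subseteq> {1..n}" and a: "a \<in> degrees n"
    and iso: "graded_iso n (poly_ring n)
       (quot_module (poly_ring n) (supp_in V) (supp_in U :: 'a::field mpol set))
       (quot_component n (supp_in V) (supp_in U :: 'a mpol set))
       (quot_module (poly_ring n) (polys n) (coprime_ideal n Z :: 'a mpol set))
       (shift a (quot_component n (polys n) (coprime_ideal n Z :: 'a mpol set)))"
  shows "\<exists>m\<in>exps {1..n}. V - U = (+) m ` exps Z"
proof -
  let ?M = "quot_module (poly_ring n) (supp_in V) (supp_in U :: 'a mpol set)"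
  let ?Md = "quot_component n (supp_in V) (supp_in U :: 'a mpol set)"
  let ?Nd = "quot_component n (polys n) (coprime_ideal n Z :: 'a mpol set)"
  obtain h where h: "h \<in> iso (add_monoid ?M) (add_monoid (quot_module (poly_ring n) (polys n) (coprime_ideal n Z :: 'a mpol set)))"
      and "\<forall>d\<in>degrees n. h ` ?Md d = ?Nd (d - a)"
    using iso unfolding graded_iso_def shift_def by (elim bexE conjE) (rule that)
  then have hd: "h ` ?Md d = ?Nd (d - a)" if "d \<in> degrees n" for d
    using that by (rule_tac bspec)
  have inj: "inj_on h (carrier ?M)"
    using h by (simp add: Group.iso_def bij_betw_def)
  have sub: "?Md d \<subseteq> carrier ?M" for d
    by (auto simp: quot_component_def)
  have Zn: "exps {1..n} - (exps {1..n} - exps Z) = exps Z"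
    using Z by (auto simp: exps_def)
  have up: "upset n (exps {1..n})" by (auto simp: upset_def)
  \<comment> \<open>Both sides say that a component is non-zero, and \<open>h\<close> matches the
    two components. On the right, the monomials in the variables of \<open>Z\<close> form a basis of
    S/P.\<close>
  have key: "(\<exists>m\<in>V - U. int_exp m = d) \<longleftrightarrow> (\<exists>m\<in>exps Z. int_exp m = d - a)"
    if d: "d \<in> degrees n" for d
  proof -
    have "(\<exists>c. ?Md d = {c}) \<longleftrightarrow> (\<exists>c. h ` ?Md d = {c})"
    proof
      assume "\<exists>c. h ` ?Md d = {c}"
      then obtain c where c: "h ` ?Md d = {c}" by blast
      then obtain x where x: "x \<in> ?Md d" by blast
      have "y = x" if "y \<in> ?Md d" for y
      proof (rule inj_onD[OF inj])
        have "h y \<in> {c}" "h x \<in> {c}" using that x unfolding c[symmetric] by blast+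
        then show "h y = h x" by simp
      qed (use that x sub in blast)+
      with x show "\<exists>c. ?Md d = {c}" by blast
    qed auto
    then show ?thesis
      unfolding hd[OF d] quot_component_singleton_iff[OF U V] coprime_ideal_def poly_ring_simps(1)
        quot_component_singleton_iff[OF upset_Diff_exps up] Zn
      by (simp only: simp_thms)
  qed
  \<comment> \<open>Degree \<open>a\<close> corresponds to degree 0 of S/P, where 1 survives. Hence
    \<open>a\<close> is the exponent of a monomial and has no negative entry.\<close>
  have "\<exists>m\<in>V - U. int_exp m = a"
    using key[OF a] by (auto intro: bexI[of _ 0])
  then obtain m where m: "m \<in> V - U" "int_exp m = a" by blast
  have mn: "m \<in> exps {1..n}" using m V by (auto simp: upset_def)
  have "V - U = (+) m ` exps Z"
  proof
    show "V - U \<subseteq> (+) m ` exps Z"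
    proof
      fix k assume k: "k \<in> V - U"
      then have "int_exp k \<in> degrees n"
        using V by (intro int_exp_in_degrees) (auto simp: upset_def)
      from key[OF this] k obtain v where v: "v \<in> exps Z" "int_exp v = int_exp k - a" by blast
      then have "int_exp k = int_exp (m + v)"
        using m by (simp add: int_exp_add)
      then show "k \<in> (+) m ` exps Z" using v by auto
    qed
    show "(+) m ` exps Z \<subseteq> V - U"
    proof
      fix k assume "k \<in> (+) m ` exps Z"
      then obtain v where v: "k = m + v" "v \<in> exps Z" by blast
      then have "k \<in> exps {1..n}" using mn exps_mono[OF Z] by auto
      note key[OF int_exp_in_degrees[OF this]]
      moreover have "int_exp k - a = int_exp v"
        using m v by (simp add: int_exp_add)
      ultimately have "\<exists>k'\<in>V - U. int_exp k' = int_exp k" using v(2) by metis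
      then show "k \<in> V - U" by simp
    qed
  qed
  with mn show ?thesis by blast
qed

text \<open>The linear projection onto a span of monomials. It serves as normal form modulo a
  monomial ideal, as reduction modulo a monomial prime, and as component in a direct sum.\<close>

definition restr :: "(nat \<Rightarrow>\<^sub>0 nat) set \<Rightarrow> 'a::field mpol \<Rightarrow> 'a mpol" where
  "restr X p = (\<Sum>k\<in>Poly_Mapping.keys p \<inter> X. const (Poly_Mapping.lookup p k) * mon k)"

lemma lookup_restr [simp]:
  "Poly_Mapping.lookup (restr X p) k = (if k \<in> X then Poly_Mapping.lookup p k else 0)"
proof -
  have "Poly_Mapping.lookup (restr X p) k
      = (\<Sum>m\<in>Poly_Mapping.keys p \<inter> X. if m = k then Poly_Mapping.lookup p m else 0)"
    by (simp add: restr_def const_mon lookup_sum lookup_single when_def)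
  then show ?thesis by (auto simp: sum.delta in_keys_iff)
qed

lemma keys_restr: "Poly_Mapping.keys (restr X p) = Poly_Mapping.keys p \<inter> X"
  by (auto simp: in_keys_iff split: if_splits)

lemma restr_in_supp_in: "restr X p \<in> supp_in X"
  by (auto simp: supp_in_def keys_restr)

text \<open>Multiplication by \<open>mon m\<close> induces an isomorphism from S/P to J/I. The map
  \<open>h\<close> is its inverse, because \<open>graded_iso\<close> asks for a map that starts at
  J/I.\<close>

lemma graded_iso_cell:
  fixes U V :: "(nat \<Rightarrow>\<^sub>0 nat) set"
  assumes U: "upset n U" and V: "upset n V" and UV: "U \<subseteq> V" and Z: "Z \<subseteq> {1..n}"
    and cell: "V - U = (+) m ` exps Z"
  shows "graded_iso n (poly_ring n)
       (quot_module (poly_ring n) (supp_in V) (supp_in U :: 'a::field mpol set))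
       (quot_component n (supp_in V) (supp_in U :: 'a mpol set))
       (quot_module (poly_ring n) (polys n) (coprime_ideal n Z :: 'a mpol set))
       (shift (int_exp m) (quot_component n (polys n) (coprime_ideal n Z :: 'a mpol set)))"
proof -
  let ?R = "poly_ring n :: 'a mpol ring"
  let ?I = "supp_in U :: 'a mpol set" and ?J = "supp_in V :: 'a mpol set"
  let ?P = "coprime_ideal n Z :: 'a mpol set"
  note I = ideal_supp_in[OF U, where ?'a='a]
  have P: "ideal ?P ?R"
    unfolding coprime_ideal_def by (rule ideal_supp_in[OF upset_Diff_exps])
  have "m \<in> V - U" unfolding cell by (rule image_eqI[of _ _ 0]) auto
  then have m: "m \<in> V" "m \<in> exps {1..n}" using V by (auto simp: upset_def)
  have mV: "m + e \<in> V" if "e \<in> exps {1..n}" for e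
    using m V that by (auto simp: upset_def)
  have mU: "m + e \<in> U \<longleftrightarrow> e \<notin> exps Z" if "e \<in> exps {1..n}" for e
  proof -
    have "m + e \<in> V - U \<longleftrightarrow> e \<in> exps Z" unfolding cell by auto
    then show ?thesis using mV[OF that] by blast
  qed
  \<comment> \<open>The two directions give injectivity and well-definedness of multiplication by
    \<open>mon m\<close> from S/P to J/I.\<close>
  have multI: "mon m * p \<in> ?I \<longleftrightarrow> p \<in> ?P" if "p \<in> supp_in (exps {1..n})" for p :: "'a mpol"
    using that mU unfolding mon_mult_in_supp_in_iff by (auto simp: coprime_ideal_def supp_in_def)
  have multJ: "mon m * p \<in> ?J" if "p \<in> supp_in (exps {1..n})" for p :: "'a mpol"
    using that mV unfolding mon_mult_in_supp_in_iff by (auto simp: supp_in_def)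
  \<comment> \<open>Surjectivity: the terms of \<open>x\<close> in I are dropped and the others
    divided by \<open>mon m\<close>. The condition on keys makes the quotient of a homogeneous
    \<open>x\<close> homogeneous.\<close>
  have divide: "\<exists>p\<in>polys n. x - mon m * p \<in> ?I \<and> (\<forall>e\<in>Poly_Mapping.keys p. m + e \<in> Poly_Mapping.keys x)"
    if x: "x \<in> ?J" for x
  proof -
    define p where "p = (\<Sum>k\<in>Poly_Mapping.keys x \<inter> - U. const (Poly_Mapping.lookup x k) * mon (k - m))"
    have km: "m + (k - m) = k \<and> k - m \<in> exps Z" if "k \<in> Poly_Mapping.keys x \<inter> - U" for k
    proof -
      have "k \<in> V - U" using that x by (auto simp: supp_in_def)
      then obtain v where "k = m + v" "v \<in> exps Z" unfolding cell by blast
      then show ?thesis by simp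
    qed
    have "mon m * p = restr (- U) x"
      unfolding p_def restr_def sum_distrib_left
    proof (rule sum.cong[OF refl])
      fix k assume k: "k \<in> Poly_Mapping.keys x \<inter> - U"
      then have "mon k = (mon m * mon (k - m) :: 'a mpol)"
        using km[OF k] by (metis mon_add)
      then show "mon m * (const (Poly_Mapping.lookup x k) * mon (k - m)) = const (Poly_Mapping.lookup x k) * mon k"
        by (simp add: mult_ac)
    qed
    moreover from this have "m + e \<in> Poly_Mapping.keys x" if "e \<in> Poly_Mapping.keys p" for e
      using keys_mon_mult[of m p] that by (auto simp: keys_restr)
    moreover have "x - restr (- U) x = restr U x"
      by (rule poly_mapping_eqI) (simp add: lookup_minus)
    moreover have "exps Z \<subseteq> exps {1..n}" using Z by (auto simp: exps_def)
    then have "p \<in> polys n"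
      unfolding p_def poly_ring_simps
      by (intro sum_in_supp_in const_mult_in_supp_in) (use km in auto)
    ultimately show ?thesis using restr_in_supp_in[of U x] by (intro bexI[of _ p]) auto
  qed
  \<comment> \<open>Any two admissible \<open>p\<close> differ by an element of P, so the choice
    does not affect the coset.\<close>
  define h where "h X = ?P +>\<^bsub>?R\<^esub> (SOME p. p \<in> polys n \<and> X = ?I +>\<^bsub>?R\<^esub> (mon m * p))" for X
  have h: "h (?I +>\<^bsub>?R\<^esub> (mon m * p)) = ?P +>\<^bsub>?R\<^esub> p" if p: "p \<in> polys n" for p
  proof -
    define q where "q = (SOME q. q \<in> polys n \<and> ?I +>\<^bsub>?R\<^esub> (mon m * p) = ?I +>\<^bsub>?R\<^esub> (mon m * q))"
    have q: "q \<in> polys n \<and> ?I +>\<^bsub>?R\<^esub> (mon m * p) = ?I +>\<^bsub>?R\<^esub> (mon m * q)"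
      unfolding q_def by (rule someI[of _ p]) (use p in simp)
    then have "mon m * (q - p) \<in> ?I"
      using coset_eq_iff[OF I, of "mon m * q" "mon m * p"] by (simp add: right_diff_distrib)
    then have "q - p \<in> ?P" using multI[of "q - p"] p q by (simp add: diff_in_supp_in)
    then have "?P +>\<^bsub>?R\<^esub> q = ?P +>\<^bsub>?R\<^esub> p" by (simp add: coset_eq_iff[OF P])
    then show ?thesis unfolding h_def q_def .
  qed
  let ?M = "quot_module ?R ?J ?I" and ?N = "quot_module ?R (polys n) ?P"
  have M: "carrier ?M = (\<lambda>p. ?I +>\<^bsub>?R\<^esub> (mon m * p)) ` polys n"
  proof
    show "carrier ?M \<subseteq> (\<lambda>p. ?I +>\<^bsub>?R\<^esub> (mon m * p)) ` polys n"
    proof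
      fix X assume "X \<in> carrier ?M"
      then obtain x where x: "X = ?I +>\<^bsub>?R\<^esub> x" "x \<in> ?J" by auto
      with divide obtain p where "p \<in> polys n" "x - mon m * p \<in> ?I" by blast
      then show "X \<in> (\<lambda>p. ?I +>\<^bsub>?R\<^esub> (mon m * p)) ` polys n"
        using x coset_eq_iff[OF I] by blast
    qed
  qed (use multJ in auto)
  have "h \<in> iso (add_monoid ?M) (add_monoid ?N)"
  proof (rule isoI)
    show "h \<in> hom (add_monoid ?M) (add_monoid ?N)"
    proof (rule homI)
      fix X Y assume "X \<in> carrier (add_monoid ?M)" "Y \<in> carrier (add_monoid ?M)"
      then obtain p q where pq: "p \<in> polys n" "q \<in> polys n"
          "X = ?I +>\<^bsub>?R\<^esub> (mon m * p)" "Y = ?I +>\<^bsub>?R\<^esub> (mon m * q)"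
        unfolding monoid.simps partial_object.simps M by auto
      have "p + q \<in> polys n" using pq by (simp add: add_in_supp_in)
      then show "h (X \<otimes>\<^bsub>add_monoid ?M\<^esub> Y) = h X \<otimes>\<^bsub>add_monoid ?N\<^esub> h Y"
        using pq h[of p] h[of q] h[of "p + q"]
        by (simp add: coset_add[OF I] coset_add[OF P] distrib_left)
    qed (use M h in auto)
    show "bij_betw h (carrier (add_monoid ?M)) (carrier (add_monoid ?N))"
      unfolding bij_betw_def monoid.simps partial_object.simps M
    proof
      show "inj_on h ((\<lambda>p. ?I +>\<^bsub>?R\<^esub> (mon m * p)) ` polys n)"
      proof (rule inj_onI)
        fix X Y assume "X \<in> (\<lambda>p. ?I +>\<^bsub>?R\<^esub> (mon m * p)) ` polys n"
            "Y \<in> (\<lambda>p. ?I +>\<^bsub>?R\<^esub> (mon m * p)) ` polys n" and eq: "h X = h Y"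
        then obtain p q where pq: "p \<in> polys n" "q \<in> polys n"
          "X = ?I +>\<^bsub>?R\<^esub> (mon m * p)" "Y = ?I +>\<^bsub>?R\<^esub> (mon m * q)" by auto
        then have "p - q \<in> ?P" using eq h coset_eq_iff[OF P] by auto
        then have "mon m * (p - q) \<in> ?I" using multI[of "p - q"] pq by (simp add: diff_in_supp_in)
        then show "X = Y" using pq coset_eq_iff[OF I] by (simp add: right_diff_distrib)
      qed
      show "h ` (\<lambda>p. ?I +>\<^bsub>?R\<^esub> (mon m * p)) ` polys n = carrier ?N"
        using h by (auto simp: image_image)
    qed
  qed
  moreover have "h (r \<odot>\<^bsub>?M\<^esub> X) = r \<odot>\<^bsub>?N\<^esub> h X" if r: "r \<in> polys n" and X: "X \<in> carrier ?M" for r X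
  proof -
    obtain p where p: "p \<in> polys n" "X = ?I +>\<^bsub>?R\<^esub> (mon m * p)" using X M by auto
    have "r * p \<in> polys n" using r p(1) by (rule mult_in_polys)
    then show ?thesis
      using p r h[of p] h[of "r * p"] coset_smult[OF I r] coset_smult[OF P r]
      by (simp add: mult.left_commute)
  qed
  moreover have "h ` quot_component n ?J ?I d = quot_component n (polys n) ?P (d - int_exp m)" for d
  proof
    show "h ` quot_component n ?J ?I d \<subseteq> quot_component n (polys n) ?P (d - int_exp m)"
    proof
      fix Y assume "Y \<in> h ` quot_component n ?J ?I d"
      then obtain x where x: "Y = h (?I +>\<^bsub>?R\<^esub> x)" "x \<in> ?J" "x \<in> component n d"
        by (auto simp: quot_component_def)
      with divide obtain p where p: "p \<in> polys n" "x - mon m * p \<in> ?I"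
          "\<And>e. e \<in> Poly_Mapping.keys p \<Longrightarrow> m + e \<in> Poly_Mapping.keys x" by blast
      have "int_exp e = d - int_exp m" if "e \<in> Poly_Mapping.keys p" for e
        using p(3)[OF that] x(3) by (auto simp: component_eq int_exp_add)
      then have "p \<in> component n (d - int_exp m)" using p by (simp add: component_eq)
      moreover have "Y = ?P +>\<^bsub>?R\<^esub> p" using x p h coset_eq_iff[OF I] by metis
      ultimately show "Y \<in> quot_component n (polys n) ?P (d - int_exp m)"
        using p by (auto simp: quot_component_def)
    qed
    show "quot_component n (polys n) ?P (d - int_exp m) \<subseteq> h ` quot_component n ?J ?I d"
    proof
      fix Y assume "Y \<in> quot_component n (polys n) ?P (d - int_exp m)"
      then obtain p where p: "Y = ?P +>\<^bsub>?R\<^esub> p" "p \<in> polys n" "p \<in> component n (d - int_exp m)"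
        by (auto simp: quot_component_def)
      then have "mon m * p \<in> component n d"
        using m by (auto simp: component_eq keys_mon_mult int_exp_add mon_mult_in_supp_in_iff supp_in_def)
      moreover have "mon m * p \<in> ?J" using multJ p by simp
      ultimately show "Y \<in> h ` quot_component n ?J ?I d"
        using p h[of p] by (auto simp: quot_component_def intro!: rev_image_eqI)
    qed
  qed
  ultimately show ?thesis
    unfolding graded_iso_def shift_def by (intro bexI[of _ h] conjI ballI)
qed


subsection \<open>Prime filtrations as chains of exponent sets\<close>

text \<open>The field does not occur here: primality of the ideals
  \<open>coprime_ideal n (Z j)\<close> is stated separately wherever chains and filtrations are
  exchanged.\<close>

definition cell_chain ::
    "nat \<Rightarrow> nat \<Rightarrow> (nat \<Rightarrow> (nat \<Rightarrow>\<^sub>0 nat) set) \<Rightarrow> (nat \<Rightarrow> (nat \<Rightarrow>\<^sub>0 nat)) \<Rightarrow> (nat \<Rightarrow> nat set) \<Rightarrow> bool" where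
  "cell_chain n r V m Z \<longleftrightarrow> (\<forall>j\<le>r. upset n (V j)) \<and> V r = exps {1..n} \<and>
     (\<forall>j\<in>{1..r}. V (j - 1) \<subseteq> V j \<and> Z j \<subseteq> {1..n} \<and> m j \<in> exps {1..n} \<and>
        V j - V (j - 1) = (+) (m j) ` exps (Z j))"

lemma cell_chainD:
  assumes "cell_chain n r V m Z"
  shows "j \<le> r \<Longrightarrow> upset n (V j)" "V r = exps {1..n}"
    "j \<in> {1..r} \<Longrightarrow> V (j - 1) \<subseteq> V j" "j \<in> {1..r} \<Longrightarrow> Z j \<subseteq> {1..n}"
    "j \<in> {1..r} \<Longrightarrow> m j \<in> exps {1..n}"
    "j \<in> {1..r} \<Longrightarrow> V j - V (j - 1) = (+) (m j) ` exps (Z j)"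
  using assms unfolding cell_chain_def by blast+

lemma cell_chain_mono:
  assumes "cell_chain n r V m Z" "i \<le> j" "j \<le> r"
  shows "V i \<subseteq> V j"
  using assms(2,3)
proof (induction j rule: dec_induct)
  case (step k)
  then show ?case using cell_chainD(3)[OF assms(1), of "Suc k"] by auto
qed simp

lemma cell_chain_cell:
  assumes "cell_chain n r V m Z" "j \<in> {1..r}" "v \<in> exps (Z j)"
  shows "m j + v \<in> V j" "m j + v \<notin> V (j - 1)"
  using cell_chainD(6)[OF assms(1,2)] assms(3) by blast+

lemma prime_filtrationD:
  fixes I :: "'a::field mpol set"
  assumes "prime_filtration n I r F P"
  shows "\<exists>V m Z. cell_chain n r V m Z \<and> (\<forall>j\<le>r. F j = supp_in (V j)) \<and>
    (\<forall>j\<in>{1..r}. P j = coprime_ideal n (Z j) \<and> primeideal (coprime_ideal n (Z j) :: 'a mpol set) (poly_ring n))"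
proof -
  \<comment> \<open>As \<open>supp_in\<close> is injective, the exponent set can only consist of the
    monomials in \<open>F j\<close>.\<close>
  define V where "V j = {k. mon k \<in> F j}" for j
  have V: "upset n (V j) \<and> F j = supp_in (V j)" if "j \<le> r" for j
  proof -
    obtain U where "upset n U" "F j = supp_in U"
      using assms \<open>j \<le> r\<close> by (auto simp: prime_filtration_def monomial_ideal_iff)
    then show ?thesis by (simp add: V_def)
  qed
  have "V r = exps {1..n}"
    using V[of r] assms by (simp add: prime_filtration_def supp_in_inject)
  have step: "\<exists>m Z. V (j - 1) \<subseteq> V j \<and> Z \<subseteq> {1..n} \<and> m \<in> exps {1..n} \<and>
      V j - V (j - 1) = (+) m ` exps Z \<and> P j = coprime_ideal n Z \<and>
      primeideal (coprime_ideal n Z :: 'a mpol set) (poly_ring n)"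
    if j: "j \<in> {1..r}" for j
  proof -
    have Vj: "upset n (V (j - 1))" "F (j - 1) = supp_in (V (j - 1))" "upset n (V j)" "F j = supp_in (V j)"
      using V[of j] V[of "j - 1"] j by auto
    have sub: "F (j - 1) \<subseteq> F j" and prime: "monomial_prime n (P j)"
      using assms j by (auto simp: prime_filtration_def)
    have "\<exists>a\<in>degrees n. graded_iso n (poly_ring n)
             (quot_module (poly_ring n) (F j) (F (j - 1)))
             (quot_component n (F j) (F (j - 1)))
             (quot_module (poly_ring n) (carrier (poly_ring n)) (P j))
             (shift a (quot_component n (carrier (poly_ring n)) (P j)))"
      using assms j unfolding prime_filtration_def by (elim conjE) (drule (1) bspec, elim conjE)
    then obtain a where a: "a \<in> degrees n" "graded_iso n (poly_ring n)
             (quot_module (poly_ring n) (F j) (F (j - 1)))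
             (quot_component n (F j) (F (j - 1)))
             (quot_module (poly_ring n) (carrier (poly_ring n)) (P j))
             (shift a (quot_component n (carrier (poly_ring n)) (P j)))" by (elim bexE)
    obtain Z where Z: "Z \<subseteq> {1..n}" "P j = coprime_ideal n Z" "primeideal (P j) (poly_ring n)"
      using prime by (auto simp: monomial_prime_iff)
    obtain m where "m \<in> exps {1..n}" "V j - V (j - 1) = (+) m ` exps Z"
      using graded_iso_imp_cell[OF Vj(1,3) Z(1) a(1) a(2)[unfolded Vj(2,4) Z(2)]] by blast
    moreover have "V (j - 1) \<subseteq> V j"
      using sub unfolding Vj(2,4) supp_in_subset_iff .
    ultimately show ?thesis
      using Z by (intro exI[of _ m] exI[of _ Z] conjI) simp_all
  qed
  then obtain m Z where mZ: "\<And>j. j \<in> {1..r} \<Longrightarrow> V (j - 1) \<subseteq> V j \<and> Z j \<subseteq> {1..n} \<and> m j \<in> exps {1..n} \<and>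
      V j - V (j - 1) = (+) (m j) ` exps (Z j) \<and> P j = coprime_ideal n (Z j) \<and>
      primeideal (coprime_ideal n (Z j) :: 'a mpol set) (poly_ring n)"
    by metis
  have "cell_chain n r V m Z"
    unfolding cell_chain_def using V \<open>V r = exps {1..n}\<close> mZ by blast
  with V mZ show ?thesis by blast
qed

lemma prime_filtrationI:
  assumes chain: "cell_chain n r V m Z"
    and prime: "\<And>j. j \<in> {1..r} \<Longrightarrow> primeideal (coprime_ideal n (Z j) :: 'a::field mpol set) (poly_ring n)"
  shows "prime_filtration n (supp_in (V 0) :: 'a mpol set) r (\<lambda>j. supp_in (V j)) (\<lambda>j. coprime_ideal n (Z j))"
  unfolding prime_filtration_def
proof (intro conjI ballI allI impI)
  show "(supp_in (V r) :: 'a mpol set) = carrier (poly_ring n)"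
    using cell_chainD(2)[OF chain] by simp
next
  fix j assume "j \<le> r"
  then show "monomial_ideal n (supp_in (V j) :: 'a mpol set)"
    using cell_chainD(1)[OF chain] by (auto simp: monomial_ideal_iff)
next
  fix j assume j: "j \<in> {1..r}"
  show "(supp_in (V (j - 1)) :: 'a mpol set) \<subseteq> supp_in (V j)"
    by (rule supp_in_mono[OF cell_chainD(3)[OF chain j]])
  show "monomial_prime n (coprime_ideal n (Z j) :: 'a mpol set)"
    unfolding monomial_prime_iff using prime[OF j] cell_chainD(4)[OF chain j] by blast
  have "upset n (V (j - 1))" "upset n (V j)"
    using j by (auto intro: cell_chainD(1)[OF chain])
  from graded_iso_cell[OF this cell_chainD(3)[OF chain j] cell_chainD(4)[OF chain j] cell_chainD(6)[OF chain j]]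
  show "\<exists>a\<in>degrees n. graded_iso n (poly_ring n)
             (quot_module (poly_ring n) (supp_in (V j)) (supp_in (V (j - 1)) :: 'a mpol set))
             (quot_component n (supp_in (V j)) (supp_in (V (j - 1))))
             (quot_module (poly_ring n) (carrier (poly_ring n)) (coprime_ideal n (Z j)))
             (shift a (quot_component n (carrier (poly_ring n)) (coprime_ideal n (Z j))))"
    by (rule bexI[OF _ int_exp_in_degrees[OF cell_chainD(5)[OF chain j]]])
qed simp

text \<open>A monomial of the ideal with exponent in \<open>exps (Z j)\<close> would move
  \<open>m j\<close> within its cell. But the product lies in \<open>V 0\<close>, hence in
  \<open>V (j - 1)\<close>, which the cell avoids.\<close>

lemma cell_chain_ideal_subset_prime:
  assumes chain: "cell_chain n r V m Z" and j: "j \<in> {1..r}"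
  shows "(supp_in (V 0) :: 'a::field mpol set) \<subseteq> coprime_ideal n (Z j)"
proof -
  have "u \<notin> exps (Z j)" if u: "u \<in> V 0" for u
  proof
    assume "u \<in> exps (Z j)"
    then have "m j + u \<notin> V (j - 1)" by (rule cell_chain_cell[OF chain j])
    moreover have "u + m j \<in> V 0"
      using u cell_chainD(1)[OF chain, of 0] cell_chainD(5)[OF chain j] by (simp add: upset_def)
    moreover have "V 0 \<subseteq> V (j - 1)"
      by (rule cell_chain_mono[OF chain]) (use j in auto)
    ultimately show False by (auto simp: add.commute)
  qed
  moreover have "V 0 \<subseteq> exps {1..n}"
    using cell_chainD(1)[OF chain, of 0] by (simp add: upset_def)
  ultimately show ?thesis
    unfolding coprime_ideal_def by (intro supp_in_mono) blast
qed

text \<open>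
  At the first step whose ideal is no longer contained in \<open>Q\<close>, the prime of this step annihilates
  the new generator modulo \<open>Q\<close>.
\<close>

lemma cell_chain_prime_below:
  fixes Q :: "'a::field mpol set"
  assumes chain: "cell_chain n r V m Z" and Q: "primeideal Q (poly_ring n)"
    and sub: "supp_in (V 0) \<subseteq> Q"
  shows "\<exists>j\<in>{1..r}. coprime_ideal n (Z j) \<subseteq> Q"
proof -
  note I = primeideal.axioms(1)[OF Q]
  \<comment> \<open>\<open>Q\<close> is proper and the chain ends in the whole ring, so the
    inclusion in \<open>Q\<close> is lost at some step.\<close>
  have "\<exists>j\<in>{1..r}. supp_in (V (j - 1)) \<subseteq> Q \<and> \<not> supp_in (V j) \<subseteq> Q"
  proof (rule ccontr)
    assume no: "\<not> ?thesis"
    have "supp_in (V j) \<subseteq> Q" if "j \<le> r" for j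
      using that
    proof (induction j)
      case (Suc j)
      then show ?case using no by (metis Suc_le_D Suc_le_eq atLeastAtMost_iff diff_Suc_1 le_add1 less_imp_le plus_1_eq_Suc)
    qed (rule sub)
    then have "carrier (poly_ring n) \<subseteq> Q"
      using cell_chainD(2)[OF chain] by (metis order_refl poly_ring_simps(1))
    then show False
      using primeideal.I_notcarr[OF Q] ideal_subset[OF I] by blast
  qed
  then obtain j where j: "j \<in> {1..r}" "supp_in (V (j - 1)) \<subseteq> Q" "\<not> supp_in (V j) \<subseteq> Q" by blast
  note mj = cell_chainD(5)[OF chain j(1)] and cell = cell_chainD(6)[OF chain j(1)]
  have up: "upset n (V j)" using j by (auto intro: cell_chainD(1)[OF chain])
  \<comment> \<open>Otherwise \<open>Q\<close> would contain the whole cell and thus, together with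
    \<open>V (j - 1)\<close>, all of \<open>V j\<close>.\<close>
  have "mon (m j) \<notin> Q"
  proof
    assume mQ: "mon (m j) \<in> Q"
    have monQ: "mon k \<in> Q" if k: "k \<in> V j" for k
    proof (cases "k \<in> V (j - 1)")
      case True
      then have "mon k \<in> supp_in (V (j - 1))" by simp
      with j(2) show ?thesis by blast
    next
      case False
      with k cell obtain v where v: "k = m j + v" "v \<in> exps (Z j)" by blast
      then have "mon v \<in> polys n" using exps_mono[OF cell_chainD(4)[OF chain j(1)]] by auto
      from ideal_mult[OF I this mQ] show ?thesis by (simp add: v mon_add mult.commute)
    qed
    have "p \<in> Q" if "p \<in> supp_in (V j)" for p
      by (subst mpol_eq_sum)
        (use that monQ in \<open>auto intro!: ideal_sum[OF I] ideal_mult[OF I] simp: supp_in_def const_def\<close>)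
    with j(3) show False by blast
  qed
  have "p \<in> Q" if p: "p \<in> coprime_ideal n (Z j)" for p
  proof -
    have "m j + e \<in> V (j - 1)" if e: "e \<in> Poly_Mapping.keys p" for e
    proof -
      have e': "e \<in> exps {1..n}" "e \<notin> exps (Z j)"
        using p e by (auto simp: coprime_ideal_def supp_in_def)
      have "m j + 0 \<in> V j" by (rule cell_chain_cell[OF chain j(1)]) simp
      then have "m j + e \<in> V j" using up e' by (simp add: upset_def)
      moreover have "m j + e \<notin> V j - V (j - 1)" unfolding cell using e' by auto
      ultimately show ?thesis by blast
    qed
    then have "mon (m j) * p \<in> Q"
      using j(2) mon_mult_in_supp_in_iff by blast
    moreover have "mon (m j) \<in> polys n" "p \<in> polys n"
      using p mj by (simp, auto simp: coprime_ideal_def supp_in_def)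
    ultimately show ?thesis
      using primeideal.I_prime[OF Q, of "mon (m j)" p] \<open>mon (m j) \<notin> Q\<close> by simp
  qed
  with j show ?thesis by blast
qed

lemma coprime_ideal_inject:
  assumes "Z \<subseteq> {1..n}" "Z' \<subseteq> {1..n}"
  shows "(coprime_ideal n Z :: 'a::field mpol set) = coprime_ideal n Z' \<longleftrightarrow> Z = Z'"
  by (metis assms coprime_ideal_subset_iff subset_antisym order_refl)

text \<open>
  The support of a prime filtration lies between the minimal primes and all primes over the ideal,
  so it consists of the minimal primes iff it is an antichain.
\<close>

lemma clean_iff:
  fixes I :: "'a::field mpol set"
  shows "clean n I \<longleftrightarrow> (\<exists>r V m Z. cell_chain n r V m Z \<and> I = supp_in (V 0) \<and>
    (\<forall>j\<in>{1..r}. primeideal (coprime_ideal n (Z j) :: 'a mpol set) (poly_ring n)) \<and>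
    (\<forall>i\<in>{1..r}. \<forall>j\<in>{1..r}. Z j \<subseteq> Z i \<longrightarrow> Z i = Z j))" (is "_ \<longleftrightarrow> ?R")
proof
  assume "clean n I"
  then obtain r F P where F: "prime_filtration n I r F P" "P ` {1..r} = minimal_primes (poly_ring n) I"
    by (auto simp: clean_def)
  obtain V m Z where chain: "cell_chain n r V m Z" and FV: "\<forall>j\<le>r. F j = supp_in (V j)"
    and P: "\<forall>j\<in>{1..r}. P j = coprime_ideal n (Z j) \<and> primeideal (coprime_ideal n (Z j) :: 'a mpol set) (poly_ring n)"
    using prime_filtrationD[OF F(1)] by blast
  have "I = supp_in (V 0)" using F(1) FV by (simp add: prime_filtration_def)
  moreover have "Z i = Z j" if ij: "i \<in> {1..r}" "j \<in> {1..r}" "Z j \<subseteq> Z i" for i j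
  proof -
    have "P i \<subseteq> P j"
      using P ij coprime_ideal_subset_iff cell_chainD(4)[OF chain] by metis
    moreover have "P i \<in> minimal_primes (poly_ring n) I" "P j \<in> minimal_primes (poly_ring n) I"
      using F(2) ij by blast+
    ultimately have "P i = P j" unfolding minimal_primes_def by blast
    then show ?thesis
      using P ij coprime_ideal_inject cell_chainD(4)[OF chain] by metis
  qed
  ultimately show ?R
    using chain P by (intro exI[of _ r] exI[of _ V] exI[of _ m] exI[of _ Z] conjI ballI impI) simp_all
next
  assume ?R
  then obtain r V m Z where chain: "cell_chain n r V m Z" and I: "I = supp_in (V 0)"
    and prime: "\<And>j. j \<in> {1..r} \<Longrightarrow> primeideal (coprime_ideal n (Z j) :: 'a mpol set) (poly_ring n)"
    and anti: "\<And>i j. i \<in> {1..r} \<Longrightarrow> j \<in> {1..r} \<Longrightarrow> Z j \<subseteq> Z i \<Longrightarrow> Z i = Z j"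
    by blast
  let ?P = "\<lambda>j. coprime_ideal n (Z j) :: 'a mpol set"
  have anti': "?P i = ?P j" if "i \<in> {1..r}" "j \<in> {1..r}" "?P i \<subseteq> ?P j" for i j
    using that anti coprime_ideal_subset_iff cell_chainD(4)[OF chain] by metis
  have "?P ` {1..r} = minimal_primes (poly_ring n) I"
  proof
    show "?P ` {1..r} \<subseteq> minimal_primes (poly_ring n) I"
    proof
      fix Q assume "Q \<in> ?P ` {1..r}"
      then obtain j where j: "j \<in> {1..r}" "Q = ?P j" by blast
      have "Q' = ?P j" if Q': "primeideal Q' (poly_ring n)" "I \<subseteq> Q'" "Q' \<subseteq> ?P j" for Q'
      proof -
        obtain i where i: "i \<in> {1..r}" "?P i \<subseteq> Q'"
          using cell_chain_prime_below[OF chain Q'(1)] Q'(2) I by blast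
        then have "?P i = ?P j" using anti'[OF i(1) j(1)] Q'(3) by blast
        with i Q' show ?thesis by blast
      qed
      then show "Q \<in> minimal_primes (poly_ring n) I"
        unfolding minimal_primes_def
        using j prime[OF j(1)] cell_chain_ideal_subset_prime[OF chain j(1)] I by blast
    qed
    show "minimal_primes (poly_ring n) I \<subseteq> ?P ` {1..r}"
    proof
      fix Q assume "Q \<in> minimal_primes (poly_ring n) I"
      then have Q: "primeideal Q (poly_ring n)" "I \<subseteq> Q"
        and min: "\<And>Q'. primeideal Q' (poly_ring n) \<Longrightarrow> I \<subseteq> Q' \<Longrightarrow> Q' \<subseteq> Q \<Longrightarrow> Q' = Q"
        unfolding minimal_primes_def by blast+
      obtain i where i: "i \<in> {1..r}" "?P i \<subseteq> Q"
        using cell_chain_prime_below[OF chain Q(1)] Q(2) I by blast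
      with min[OF prime[OF i(1)]] cell_chain_ideal_subset_prime[OF chain i(1)] I
      show "Q \<in> ?P ` {1..r}" by blast
    qed
  qed
  then show "clean n I"
    unfolding clean_def using prime_filtrationI[OF chain prime] I by blast
qed

lemma pretty_clean_iff:
  fixes I :: "'a::field mpol set"
  shows "pretty_clean n I \<longleftrightarrow> (\<exists>r V m Z. cell_chain n r V m Z \<and> I = supp_in (V 0) \<and>
    (\<forall>j\<in>{1..r}. primeideal (coprime_ideal n (Z j) :: 'a mpol set) (poly_ring n)) \<and>
    (\<forall>i\<in>{1..r}. \<forall>j\<in>{1..r}. i < j \<longrightarrow> Z j \<subseteq> Z i \<longrightarrow> Z i = Z j))" (is "_ \<longleftrightarrow> ?R")
proof
  assume "pretty_clean n I"
  then obtain r F P where F: "prime_filtration n I r F P"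
    and pc: "\<And>i j. i \<in> {1..r} \<Longrightarrow> j \<in> {1..r} \<Longrightarrow> i < j \<Longrightarrow> P i \<subseteq> P j \<Longrightarrow> P i = P j"
    unfolding pretty_clean_def by blast
  obtain V m Z where chain: "cell_chain n r V m Z" and FV: "\<forall>j\<le>r. F j = supp_in (V j)"
    and P: "\<forall>j\<in>{1..r}. P j = coprime_ideal n (Z j) \<and> primeideal (coprime_ideal n (Z j) :: 'a mpol set) (poly_ring n)"
    using prime_filtrationD[OF F(1)] by blast
  have "I = supp_in (V 0)" using F(1) FV by (simp add: prime_filtration_def)
  moreover have "Z i = Z j" if ij: "i \<in> {1..r}" "j \<in> {1..r}" "i < j" "Z j \<subseteq> Z i" for i j
  proof -
    have "P i \<subseteq> P j"
      using P ij coprime_ideal_subset_iff cell_chainD(4)[OF chain] by metis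
    then have "P i = P j" by (rule pc[OF ij(1-3)])
    then show ?thesis
      using P ij coprime_ideal_inject cell_chainD(4)[OF chain] by metis
  qed
  ultimately show ?R
    using chain P by (intro exI[of _ r] exI[of _ V] exI[of _ m] exI[of _ Z] conjI ballI impI) simp_all
next
  assume ?R
  then obtain r V m Z where chain: "cell_chain n r V m Z" and I: "I = supp_in (V 0)"
    and prime': "\<forall>j\<in>{1..r}. primeideal (coprime_ideal n (Z j) :: 'a mpol set) (poly_ring n)"
    and pc': "\<forall>i\<in>{1..r}. \<forall>j\<in>{1..r}. i < j \<longrightarrow> Z j \<subseteq> Z i \<longrightarrow> Z i = Z j"
    by (elim exE conjE) (rule that)
  have prime: "primeideal (coprime_ideal n (Z j) :: 'a mpol set) (poly_ring n)" if "j \<in> {1..r}" for j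
    using prime' that by blast
  have pc: "Z i = Z j" if "i \<in> {1..r}" "j \<in> {1..r}" "i < j" "Z j \<subseteq> Z i" for i j
    using pc' that by blast
  have "(coprime_ideal n (Z i) :: 'a mpol set) = coprime_ideal n (Z j)"
    if "i \<in> {1..r}" "j \<in> {1..r}" "i < j" "(coprime_ideal n (Z i) :: 'a mpol set) \<subseteq> coprime_ideal n (Z j)" for i j
    using that pc coprime_ideal_subset_iff cell_chainD(4)[OF chain] by metis
  then show "pretty_clean n I"
    unfolding pretty_clean_def using prime_filtrationI[OF chain prime] I by blast
qed


subsection \<open>Setting the last variable to one\<close>

text \<open>The effect on exponents of setting the variable with index \<open>n\<close> to 1, see
  \<open>hom_mon\<close>.\<close>

definition cut :: "nat \<Rightarrow> (nat \<Rightarrow>\<^sub>0 nat) \<Rightarrow> (nat \<Rightarrow>\<^sub>0 nat)" where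
  "cut n m = m - Poly_Mapping.single n (Poly_Mapping.lookup m n)"

lemma lookup_cut [simp]: "Poly_Mapping.lookup (cut n m) i = (if i = n then 0 else Poly_Mapping.lookup m i)"
  by (simp add: cut_def lookup_minus lookup_single when_def)

lemma cut_add_single: "cut n m + Poly_Mapping.single n (Poly_Mapping.lookup m n) = m"
  by (rule poly_mapping_eqI) (simp add: lookup_add lookup_single when_def)

lemma cut_in_exps_iff: "cut n m \<in> exps Z \<longleftrightarrow> m \<in> exps (insert n Z)"
  by (auto simp: exps_def subset_iff in_keys_iff split: if_splits)

lemma cut_idem: "n \<notin> Z \<Longrightarrow> m \<in> exps Z \<Longrightarrow> cut n m = m"
  by (rule poly_mapping_eqI) (auto simp: exps_def subset_iff in_keys_iff)

lemma cut_add: "cut n (a + b) = cut n a + cut n b"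
  by (rule poly_mapping_eqI) (simp add: lookup_add)

lemma cut_single_same [simp]: "cut n (Poly_Mapping.single n k) = 0"
  by (rule poly_mapping_eqI) (simp add: lookup_single when_def)

lemma insert_last: "n \<ge> 1 \<Longrightarrow> insert n {1..n - 1} = {1..n::nat}"
  by auto

text \<open>For up-closed \<open>V\<close> this is the image under \<open>cut n\<close>. Naming a
  lift explicitly lets its last exponent be raised by \<open>dehomog_add_single\<close>.\<close>

definition dehomog :: "nat \<Rightarrow> (nat \<Rightarrow>\<^sub>0 nat) set \<Rightarrow> (nat \<Rightarrow>\<^sub>0 nat) set" where
  "dehomog n V = {m \<in> exps {1..n - 1}. \<exists>k. m + Poly_Mapping.single n k \<in> V}"

lemma dehomog_add_single:
  assumes V: "upset n V" and n: "n \<ge> 1" and k: "m + Poly_Mapping.single n k \<in> V" "k \<le> l"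
  shows "m + Poly_Mapping.single n l \<in> V"
proof -
  have "(m + Poly_Mapping.single n k) + Poly_Mapping.single n (l - k) \<in> V"
    using V k n by (simp add: upset_def)
  then show ?thesis using k(2) by (simp add: add.assoc flip: single_add)
qed

lemma upset_dehomog:
  assumes V: "upset n V" and n: "n \<ge> 1"
  shows "upset (n - 1) (dehomog n V)"
  unfolding upset_def
proof (intro conjI ballI)
  fix u v assume u: "u \<in> dehomog n V" and v: "v \<in> exps {1..n - 1}"
  then obtain k where k: "u + Poly_Mapping.single n k \<in> V" by (auto simp: dehomog_def)
  have "v \<in> exps {1..n}" using exps_mono[of "{1..n - 1}" "{1..n}"] v by auto
  then have "(u + Poly_Mapping.single n k) + v \<in> V" using V k by (simp add: upset_def)
  then have "(u + v) + Poly_Mapping.single n k \<in> V" by (simp add: ac_simps)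
  then show "u + v \<in> dehomog n V" using u v by (auto simp: dehomog_def)
qed (auto simp: dehomog_def)

lemma dehomog_exps:
  assumes "n \<ge> 1"
  shows "dehomog n (exps {1..n}) = exps {1..n - 1}"
proof -
  have "exps {1..n - 1} \<subseteq> exps {1..n}" by (rule exps_mono) auto
  then show ?thesis using assms by (auto simp: dehomog_def)
qed

lemma dehomog_mono: "U \<subseteq> V \<Longrightarrow> dehomog n U \<subseteq> dehomog n V"
  by (auto simp: dehomog_def)

text \<open>Since \<open>n\<close> is a free direction, all sufficiently high lifts of a projected
  cell point remain in the cell. A lift in \<open>U\<close> could be raised to such a height and
  would still be in \<open>U\<close>, so there is none.\<close>

lemma dehomog_step_free:
  assumes n: "n \<ge> 1" and U: "upset n U" and V: "upset n V" and m: "m \<in> exps {1..n}"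
    and Z: "Z \<subseteq> {1..n}" "n \<in> Z" and cell: "V - U = (+) m ` exps Z"
  shows "dehomog n V - dehomog n U = (+) (cut n m) ` exps (Z - {n})"
proof
  show "dehomog n V - dehomog n U \<subseteq> (+) (cut n m) ` exps (Z - {n})"
  proof
    fix u assume "u \<in> dehomog n V - dehomog n U"
    then obtain k where k: "u \<in> exps {1..n - 1}" "u + Poly_Mapping.single n k \<in> V - U"
      by (auto simp: dehomog_def)
    then obtain v where v: "v \<in> exps Z" "u + Poly_Mapping.single n k = m + v"
      unfolding cell by auto
    have "cut n u = cut n m + cut n v"
      using arg_cong[OF v(2), of "cut n"] by (simp add: cut_add)
    moreover have "cut n u = u" by (rule cut_idem[OF _ k(1)]) (use n in auto)
    moreover have "cut n v \<in> exps (Z - {n})"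
      using v Z by (simp add: cut_in_exps_iff insert_absorb)
    ultimately show "u \<in> (+) (cut n m) ` exps (Z - {n})" by auto
  qed
  show "(+) (cut n m) ` exps (Z - {n}) \<subseteq> dehomog n V - dehomog n U"
  proof
    fix u assume "u \<in> (+) (cut n m) ` exps (Z - {n})"
    then obtain v where v: "u = cut n m + v" "v \<in> exps (Z - {n})" by blast
    have vn: "v \<in> exps {1..n - 1}"
      by (rule subsetD[OF exps_mono v(2)]) (use Z n in force)
    then have un: "u \<in> exps {1..n - 1}"
      using m n by (simp add: v cut_in_exps_iff insert_last)
    \<comment> \<open>The surplus of \<open>l\<close> over the entry of \<open>m\<close> at
      \<open>n\<close> is absorbed by the free direction \<open>n\<close>.\<close>
    have *: "u + Poly_Mapping.single n l \<in> V - U" if l: "Poly_Mapping.lookup m n \<le> l" for l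
    proof -
      let ?k = "Poly_Mapping.lookup m n"
      have "u + Poly_Mapping.single n l
          = (cut n m + Poly_Mapping.single n ?k) + (v + Poly_Mapping.single n (l - ?k))"
        using l by (simp add: v ac_simps flip: single_add)
      also have "\<dots> = m + (v + Poly_Mapping.single n (l - ?k))"
        by (simp only: cut_add_single)
      finally show ?thesis
        unfolding cell using v(2) Z(2) exps_mono[of "Z - {n}" Z] by auto
    qed
    have "u \<notin> dehomog n U"
    proof
      assume "u \<in> dehomog n U"
      then obtain k where "u + Poly_Mapping.single n k \<in> U" by (auto simp: dehomog_def)
      from dehomog_add_single[OF U n this, of "max k (Poly_Mapping.lookup m n)"]
      show False using *[of "max k (Poly_Mapping.lookup m n)"] by simp
    qed
    then show "u \<in> dehomog n V - dehomog n U"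
      using *[OF order_refl] un by (auto simp: dehomog_def)
  qed
qed

text \<open>All points of the cell have the same entry at \<open>n\<close>. A lift raised above it
  stays in \<open>V\<close> but leaves the cell, so it is in \<open>U\<close>.\<close>

lemma dehomog_step_bound:
  assumes n: "n \<ge> 1" and V: "upset n V" and UV: "U \<subseteq> V"
    and Z: "n \<notin> Z" and cell: "V - U = (+) m ` exps Z"
  shows "dehomog n V = dehomog n U"
proof (rule antisym[OF subsetI dehomog_mono[OF UV]])
  fix u assume "u \<in> dehomog n V"
  then obtain k where k: "u \<in> exps {1..n - 1}" "u + Poly_Mapping.single n k \<in> V"
    by (auto simp: dehomog_def)
  \<comment> \<open>At least \<open>k\<close>, so that up-closure keeps the lift in
    \<open>V\<close>, and larger than the entry at \<open>n\<close> shared by the whole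
    cell.\<close>
  define l where "l = max k (Suc (Poly_Mapping.lookup m n))"
  have "u + Poly_Mapping.single n l \<in> V"
    by (rule dehomog_add_single[OF V n k(2)]) (simp add: l_def)
  moreover have "u + Poly_Mapping.single n l \<notin> V - U"
  proof
    assume "u + Poly_Mapping.single n l \<in> V - U"
    then obtain v where v: "v \<in> exps Z" "u + Poly_Mapping.single n l = m + v"
      unfolding cell by auto
    then have "Poly_Mapping.lookup v n = 0"
      using Z by (auto simp: exps_def in_keys_iff)
    moreover have "l \<le> Poly_Mapping.lookup (u + Poly_Mapping.single n l) n"
      by (simp add: lookup_add)
    ultimately show False unfolding v by (simp add: lookup_add l_def)
  qed
  ultimately show "u \<in> dehomog n U" using k(1) by (auto simp: dehomog_def)
qed

text \<open>\<open>W\<close> is the chain \<open>V\<close> with only the steps in \<open>G\<close> kept; \<open>g\<close> enumerates the kept steps.\<close>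

definition compressed ::
    "nat \<Rightarrow> (nat \<Rightarrow> bool) \<Rightarrow> (nat \<Rightarrow> 'b) \<Rightarrow> nat \<Rightarrow> (nat \<Rightarrow> nat) \<Rightarrow> (nat \<Rightarrow> 'b) \<Rightarrow> bool" where
  "compressed r G V s g W \<longleftrightarrow> W 0 = V 0 \<and> W s = V r \<and>
    (\<forall>i\<in>{1..s}. g i \<in> {1..r} \<and> G (g i) \<and> W (i - 1) = V (g i - 1) \<and> W i = V (g i)) \<and>
    (\<forall>i\<in>{1..s}. \<forall>j\<in>{1..s}. i < j \<longrightarrow> g i < g j)"

text \<open>Steps outside \<open>G\<close> are constant, so deleting them preserves both ends and
  the differences at the remaining steps.\<close>

lemma ex_compressed:
  assumes "\<forall>j\<in>{1..r}. \<not> G j \<longrightarrow> V j = V (j - 1)"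
  shows "\<exists>s g W. compressed r G V s g W"
  using assms
proof (induction r)
  case 0
  have "compressed 0 G V 0 (\<lambda>_. 0) V" by (simp add: compressed_def)
  then show ?case by blast
next
  case (Suc r)
  have "\<forall>j\<in>{1..r}. \<not> G j \<longrightarrow> V j = V (j - 1)"
    using Suc.prems by (meson atLeastAtMost_iff le_SucI)
  from Suc.IH[OF this] obtain r' g V' where IH: "compressed r G V r' g V'"
    by blast
  from IH have V': "V' 0 = V 0" "V' r' = V r"
    and g: "\<forall>i\<in>{1..r'}. g i \<in> {1..r} \<and> G (g i) \<and> V' (i - 1) = V (g i - 1) \<and> V' i = V (g i)"
    and mono: "\<forall>i\<in>{1..r'}. \<forall>j\<in>{1..r'}. i < j \<longrightarrow> g i < g j"
    unfolding compressed_def by simp_all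
  show ?case
  proof (cases "G (Suc r)")
    case True
    have "compressed (Suc r) G V (Suc r') (g(Suc r' := Suc r)) (V'(Suc r' := V (Suc r)))"
      unfolding compressed_def
    proof (rule conjI[OF _ conjI[OF _ conjI]]; (intro ballI impI)?)
      fix i assume i: "i \<in> {1..Suc r'}"
      show "(g(Suc r' := Suc r)) i \<in> {1..Suc r} \<and> G ((g(Suc r' := Suc r)) i) \<and>
          (V'(Suc r' := V (Suc r))) (i - 1) = V ((g(Suc r' := Suc r)) i - 1) \<and>
          (V'(Suc r' := V (Suc r))) i = V ((g(Suc r' := Suc r)) i)"
      proof (cases "i = Suc r'")
        case False
        with i have "i \<in> {1..r'}" by auto
        with bspec[OF g this] show ?thesis by auto
      qed (use True V' in simp)
    next
      fix i j assume ij: "i \<in> {1..Suc r'}" "j \<in> {1..Suc r'}" "i < j"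
      then have i: "i \<in> {1..r'}" by simp
      show "(g(Suc r' := Suc r)) i < (g(Suc r' := Suc r)) j"
      proof (cases "j = Suc r'")
        case True
        with bspec[OF g i] ij show ?thesis by auto
      next
        case False
        with ij have "j \<in> {1..r'}" by auto
        with i ij mono False show ?thesis by simp
      qed
    qed (use V' in simp_all)
    then show ?thesis by blast
  next
    case False
    then have "V (Suc r) = V r" using bspec[OF Suc.prems, of "Suc r"] by simp
    moreover have "\<forall>i\<in>{1..r'}. g i \<in> {1..Suc r} \<and> G (g i) \<and> V' (i - 1) = V (g i - 1) \<and> V' i = V (g i)"
      using g by auto
    ultimately have "compressed (Suc r) G V r' g V'"
      using V' mono by (simp add: compressed_def)
    then show ?thesis by blast
  qed
qed

text \<open>The order of the kept steps is recorded in \<open>g\<close> because pretty cleanness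
  compares primes by their position.\<close>

lemma cell_chain_dehomog:
  assumes chain: "cell_chain n r V m Z" and n: "n \<ge> 1"
  shows "\<exists>r' g V'. cell_chain (n - 1) r' V' (\<lambda>i. cut n (m (g i))) (\<lambda>i. Z (g i) - {n}) \<and>
    V' 0 = dehomog n (V 0) \<and> (\<forall>i\<in>{1..r'}. g i \<in> {1..r} \<and> n \<in> Z (g i)) \<and>
    (\<forall>i\<in>{1..r'}. \<forall>j\<in>{1..r'}. i < j \<longrightarrow> g i < g j)"
proof -
  have up: "upset n (V (j - 1))" "upset n (V j)" if "j \<in> {1..r}" for j
    using that by (auto intro: cell_chainD(1)[OF chain])
  have "\<forall>j\<in>{1..r}. \<not> n \<in> Z j \<longrightarrow> dehomog n (V j) = dehomog n (V (j - 1))"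
    using dehomog_step_bound[OF n up(2) cell_chainD(3)[OF chain] _ cell_chainD(6)[OF chain]] by blast
  from ex_compressed[OF this] obtain r' g V'
    where c: "compressed r (\<lambda>j. n \<in> Z j) (\<lambda>j. dehomog n (V j)) r' g V'" by blast
  from c have V': "V' 0 = dehomog n (V 0)" "V' r' = dehomog n (V r)"
    and g: "\<forall>i\<in>{1..r'}. g i \<in> {1..r} \<and> n \<in> Z (g i) \<and>
      V' (i - 1) = dehomog n (V (g i - 1)) \<and> V' i = dehomog n (V (g i))"
    and mono: "\<forall>i\<in>{1..r'}. \<forall>j\<in>{1..r'}. i < j \<longrightarrow> g i < g j"
    unfolding compressed_def by simp_all
  have "cell_chain (n - 1) r' V' (\<lambda>i. cut n (m (g i))) (\<lambda>i. Z (g i) - {n})"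
    unfolding cell_chain_def
  proof (intro conjI allI ballI impI)
    fix j assume "j \<le> r'"
    then show "upset (n - 1) (V' j)"
    proof (cases "j = 0")
      case True
      then show ?thesis using V' upset_dehomog[OF cell_chainD(1)[OF chain] n] by simp
    next
      case False
      with \<open>j \<le> r'\<close> have "j \<in> {1..r'}" by auto
      then show ?thesis using g upset_dehomog[OF up(2) n] by metis
    qed
  next
    show "V' r' = exps {1..n - 1}"
      using V'(2) cell_chainD(2)[OF chain] dehomog_exps[OF n] by simp
  next
    fix i assume i: "i \<in> {1..r'}"
    then have gi: "g i \<in> {1..r}" "n \<in> Z (g i)"
      and Vi: "V' (i - 1) = dehomog n (V (g i - 1))" "V' i = dehomog n (V (g i))"
      using g by blast+
    note D = cell_chainD(3-6)[OF chain gi(1)]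
    show "V' (i - 1) \<subseteq> V' i" unfolding Vi by (rule dehomog_mono[OF D(1)])
    show "Z (g i) - {n} \<subseteq> {1..n - 1}" using D(2) by fastforce
    show "cut n (m (g i)) \<in> exps {1..n - 1}"
      using D(3) n by (simp add: cut_in_exps_iff insert_last)
    show "V' i - V' (i - 1) = (+) (cut n (m (g i))) ` exps (Z (g i) - {n})"
      unfolding Vi by (rule dehomog_step_free[OF n up[OF gi(1)] D(3,2) gi(2) D(4)])
  qed
  moreover have "\<forall>i\<in>{1..r'}. g i \<in> {1..r} \<and> n \<in> Z (g i)" using g by blast
  ultimately show ?thesis using V'(1) mono by blast
qed

text \<open>This is the contraction of a prime along the inclusion of T in S. As \<open>n\<close>
  lies in \<open>Z\<close>, the same variables generate both ideals.\<close>

lemma primeideal_coprime_ideal_contract: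
  assumes prime: "primeideal (coprime_ideal n Z :: 'a::field mpol set) (poly_ring n)" and n: "n \<in> Z"
  shows "primeideal (coprime_ideal (n - 1) (Z - {n}) :: 'a mpol set) (poly_ring (n - 1))"
proof -
  have "exps {1..n - 1} - exps (Z - {n}) = (exps {1..n} - exps Z) \<inter> exps {1..n - 1}"
  proof -
    have "{1..n - 1} \<subseteq> {1..n}" by auto
    moreover have "n \<notin> {1..n - 1}" by auto
    ultimately show ?thesis by (auto simp: exps_def)
  qed
  then have eq: "(coprime_ideal (n - 1) (Z - {n}) :: 'a mpol set) = coprime_ideal n Z \<inter> polys (n - 1)"
    by (auto simp: coprime_ideal_def supp_in_def)
  have "(supp_in (exps {1..n - 1}) :: 'a mpol set) \<subseteq> supp_in (exps {1..n})"
    by (intro supp_in_mono exps_mono) auto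
  then have sub: "(polys (n - 1) :: 'a mpol set) \<subseteq> polys n" by simp
  have "(1 :: 'a mpol) \<notin> coprime_ideal n Z" by (simp add: coprime_ideal_def)
  then show ?thesis
  proof (intro primeidealI cring_poly_ring)
    show "ideal (coprime_ideal (n - 1) (Z - {n}) :: 'a mpol set) (poly_ring (n - 1))"
      unfolding coprime_ideal_def by (rule ideal_supp_in[OF upset_Diff_exps])
    show "(carrier (poly_ring (n - 1)) :: 'a mpol set) \<noteq> coprime_ideal (n - 1) (Z - {n})"
    proof
      assume *: "(carrier (poly_ring (n - 1)) :: 'a mpol set) = coprime_ideal (n - 1) (Z - {n})"
      have "(1 :: 'a mpol) \<in> carrier (poly_ring (n - 1))" by simp
      then show False unfolding * by (simp add: coprime_ideal_def)
    qed
    fix a b :: "'a mpol"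
    assume "a \<in> carrier (poly_ring (n - 1))" "b \<in> carrier (poly_ring (n - 1))"
      "a \<otimes>\<^bsub>poly_ring (n - 1)\<^esub> b \<in> coprime_ideal (n - 1) (Z - {n})"
    then show "a \<in> coprime_ideal (n - 1) (Z - {n}) \<or> b \<in> coprime_ideal (n - 1) (Z - {n})"
      using primeideal.I_prime[OF prime, of a b] sub unfolding eq poly_ring_simps(2) by blast
  qed
qed

section \<open>The homomorphism on monomials and monomial ideals\<close>

lemma update_eq_add:
  assumes "k \<notin> Poly_Mapping.keys m"
  shows "Poly_Mapping.update k v m = m + Poly_Mapping.single k (v::nat)"
  using assms
  by (intro poly_mapping_eqI) (auto simp: lookup_update lookup_add lookup_single when_def in_keys_iff)

lemma mon_single: "mon (Poly_Mapping.single i k) = var i ^ k"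
proof (induction k)
  case (Suc k)
  have "Poly_Mapping.single i (Suc k) = Poly_Mapping.single i 1 + Poly_Mapping.single i k"
    by (simp add: Suc_eq_plus1_left flip: single_add)
  then show ?case using Suc by (simp add: mon_add var_def)
qed simp

context
  fixes n :: nat and \<phi> :: "'a::field mpol \<Rightarrow> 'a mpol"
  assumes n: "n \<ge> 1" and hom: "algebra_hom n (n - 1) \<phi>"
    and var_fixed: "\<And>i. i \<in> {1..n - 1} \<Longrightarrow> \<phi> (var i) = var i"
    and var_last: "\<phi> (var n) = 1"
begin

lemma hom_simps:
  assumes "p \<in> polys n" "q \<in> polys n"
  shows "\<phi> (p * q) = \<phi> p * \<phi> q" "\<phi> (p + q) = \<phi> p + \<phi> q"
  using hom ring_hom_mult[OF _ assms, of \<phi> "poly_ring (n - 1)"]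
    ring_hom_add[OF _ assms, of \<phi> "poly_ring (n - 1)"]
  by (simp_all add: algebra_hom_def)

lemma hom_const: "\<phi> (const c) = const c"
  using hom by (simp add: algebra_hom_def)

lemma hom_var_power:
  assumes "i \<in> {1..n}"
  shows "\<phi> (var i ^ k) = mon (cut n (Poly_Mapping.single i k))"
proof -
  have v: "(var i :: 'a mpol) \<in> polys n" using assms by (simp add: var_def)
  have "(var i :: 'a mpol) ^ k \<in> polys n \<and> \<phi> (var i ^ k) = \<phi> (var i) ^ k"
  proof (induction k)
    case 0
    then show ?case using hom_const[of 1] by simp
  next
    case (Suc k)
    then show ?case using hom_simps(1)[OF v, of "var i ^ k"] mult_in_polys[OF v, of "var i ^ k"] by simp
  qed
  moreover have "cut n (Poly_Mapping.single i k) = (if i = n then 0 else Poly_Mapping.single i k)"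
    by (rule poly_mapping_eqI) (simp add: lookup_single when_def)
  moreover have "i \<in> {1..n - 1}" if "i \<noteq> n" using that assms by auto
  ultimately show ?thesis using var_last var_fixed by (auto simp: mon_single)
qed

lemma hom_mon: "m \<in> exps {1..n} \<Longrightarrow> \<phi> (mon m) = mon (cut n m)"
proof (induction m rule: update_induct)
  case const
  then show ?case using hom_const[of 1] cut_idem[of n "{}" 0] by simp
next
  case (update m i k)
  have eq: "Poly_Mapping.update i k m = m + Poly_Mapping.single i k"
    by (rule update_eq_add[OF update(1)])
  have mi: "m \<in> exps {1..n}" "i \<in> {1..n}" using update(2,4) unfolding eq by auto
  have "\<phi> (mon m * var i ^ k) = \<phi> (mon m) * \<phi> (var i ^ k)"
    by (rule hom_simps) (use mi in \<open>simp_all flip: mon_single\<close>)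
  then show ?case
    unfolding eq using update(3)[OF mi(1)] hom_var_power[OF mi(2)]
    by (simp add: mon_add mon_single cut_add)
qed

lemma hom_sum:
  assumes "\<And>i. i \<in> A \<Longrightarrow> f i \<in> polys n"
  shows "\<phi> (\<Sum>i\<in>A. f i) = (\<Sum>i\<in>A. \<phi> (f i))"
  using assms
proof (induction A rule: infinite_finite_induct)
  case (insert x A)
  then have "(\<Sum>i\<in>A. f i) \<in> polys n" by (auto intro: sum_in_supp_in)
  then show ?case using insert by (simp add: hom_simps)
qed (use hom_const[of 0] in simp_all)

lemma hom_const_mon: "m \<in> exps {1..n} \<Longrightarrow> \<phi> (const c * mon m) = const c * mon (cut n m)"
  by (subst hom_simps(1)) (simp_all add: const_in_supp_in hom_const hom_mon)

text \<open>Terms lift one at a time, each with its own power of the last variable, so every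
  polynomial supported on the projected set is hit. In the other direction cancellation can only
  shrink the support.\<close>

lemma hom_image:
  assumes U: "upset n U"
  shows "\<phi> ` supp_in U = supp_in (dehomog n U)"
proof
  have Un: "U \<subseteq> exps {1..n}" using U by (simp add: upset_def)
  show "\<phi> ` supp_in U \<subseteq> supp_in (dehomog n U)"
  proof
    fix q assume "q \<in> \<phi> ` supp_in U"
    then obtain p where p: "q = \<phi> p" "p \<in> supp_in U" by blast
    then have k: "k \<in> exps {1..n}" "cut n k \<in> dehomog n U" if "k \<in> Poly_Mapping.keys p" for k
      using that Un n cut_add_single[of n k]
      by (auto simp: supp_in_def dehomog_def cut_in_exps_iff insert_last intro!: exI[of _ "Poly_Mapping.lookup k n"])
    have "q = \<phi> (\<Sum>k\<in>Poly_Mapping.keys p. const (Poly_Mapping.lookup p k) * mon k)"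
      unfolding p(1) by (subst mpol_eq_sum[of p]) (rule refl)
    also have "\<dots> = (\<Sum>k\<in>Poly_Mapping.keys p. const (Poly_Mapping.lookup p k) * mon (cut n k))"
      using k by (subst hom_sum) (auto simp: hom_const_mon)
    also have "\<dots> \<in> supp_in (dehomog n U)"
      using k by (intro sum_in_supp_in) auto
    finally show "q \<in> supp_in (dehomog n U)" .
  qed
  show "supp_in (dehomog n U) \<subseteq> \<phi> ` supp_in U"
  proof
    fix q :: "'a mpol" assume q: "q \<in> supp_in (dehomog n U)"
    have "\<forall>k\<in>Poly_Mapping.keys q. \<exists>l. k \<in> exps {1..n - 1} \<and> k + Poly_Mapping.single n l \<in> U"
      using q by (auto simp: supp_in_def dehomog_def)
    then obtain l where l: "\<And>k. k \<in> Poly_Mapping.keys q \<Longrightarrow> k \<in> exps {1..n - 1} \<and> k + Poly_Mapping.single n (l k) \<in> U"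
      by metis
    have lk: "k + Poly_Mapping.single n (l k) \<in> exps {1..n}" if "k \<in> Poly_Mapping.keys q" for k
      using l[OF that] Un by blast
    define p where "p = (\<Sum>k\<in>Poly_Mapping.keys q. const (Poly_Mapping.lookup q k) * mon (k + Poly_Mapping.single n (l k)))"
    have "p \<in> supp_in U" unfolding p_def using l by (intro sum_in_supp_in) auto
    moreover have "\<phi> p = (\<Sum>k\<in>Poly_Mapping.keys q. const (Poly_Mapping.lookup q k) * mon (cut n (k + Poly_Mapping.single n (l k))))"
      unfolding p_def
      by (subst hom_sum) (auto simp del: plus_in_exps_iff intro: lk hom_const_mon[OF lk] intro!: sum.cong const_mult_in_supp_in)
    moreover have "cut n (k + Poly_Mapping.single n (l k)) = k" if "k \<in> Poly_Mapping.keys q" for k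
      using l[OF that] n cut_idem[of n "{1..n - 1}" k] by (simp add: cut_add)
    ultimately show "q \<in> \<phi> ` supp_in U"
      using mpol_eq_sum[of q] by (intro image_eqI[of _ _ p]) auto
  qed
qed

text \<open>All kept sets \<open>Z (g i)\<close> contain \<open>n\<close>, so removing
  \<open>n\<close> creates no new inclusions among them and the antichain condition is
  inherited.\<close>

lemma clean_hom_image:
  assumes "clean n I"
  shows "clean (n - 1) (\<phi> ` I)"
proof -
  obtain r V m Z where chain: "cell_chain n r V m Z" and I: "I = supp_in (V 0)"
    and prime: "\<forall>j\<in>{1..r}. primeideal (coprime_ideal n (Z j) :: 'a mpol set) (poly_ring n)"
    and anti: "\<forall>i\<in>{1..r}. \<forall>j\<in>{1..r}. Z j \<subseteq> Z i \<longrightarrow> Z i = Z j"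
    using assms unfolding clean_iff by (elim exE conjE) (rule that)
  obtain r' g V' where chain': "cell_chain (n - 1) r' V' (\<lambda>i. cut n (m (g i))) (\<lambda>i. Z (g i) - {n})"
    and V': "V' 0 = dehomog n (V 0)" and g: "\<forall>i\<in>{1..r'}. g i \<in> {1..r} \<and> n \<in> Z (g i)"
    using cell_chain_dehomog[OF chain n] by blast
  have "\<phi> ` I = supp_in (V' 0)"
    unfolding I V' by (rule hom_image[OF cell_chainD(1)[OF chain]]) simp
  moreover have "\<forall>j\<in>{1..r'}. primeideal (coprime_ideal (n - 1) (Z (g j) - {n}) :: 'a mpol set) (poly_ring (n - 1))"
    using prime g by (blast intro: primeideal_coprime_ideal_contract)
  moreover have "\<forall>i\<in>{1..r'}. \<forall>j\<in>{1..r'}. Z (g j) - {n} \<subseteq> Z (g i) - {n} \<longrightarrow> Z (g i) - {n} = Z (g j) - {n}"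
    using anti g by blast
  ultimately show ?thesis
    unfolding clean_iff using chain' by blast
qed

text \<open>As in \<open>clean_hom_image\<close>, but for ordered pairs of steps; monotonicity of
  \<open>g\<close> keeps the earlier step earlier.\<close>

lemma pretty_clean_hom_image:
  assumes "pretty_clean n I"
  shows "pretty_clean (n - 1) (\<phi> ` I)"
proof -
  obtain r V m Z where chain: "cell_chain n r V m Z" and I: "I = supp_in (V 0)"
    and prime: "\<forall>j\<in>{1..r}. primeideal (coprime_ideal n (Z j) :: 'a mpol set) (poly_ring n)"
    and pc: "\<forall>i\<in>{1..r}. \<forall>j\<in>{1..r}. i < j \<longrightarrow> Z j \<subseteq> Z i \<longrightarrow> Z i = Z j"
    using assms unfolding pretty_clean_iff by (elim exE conjE) (rule that)
  obtain r' g V' where chain': "cell_chain (n - 1) r' V' (\<lambda>i. cut n (m (g i))) (\<lambda>i. Z (g i) - {n})"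
    and V': "V' 0 = dehomog n (V 0)" and g: "\<forall>i\<in>{1..r'}. g i \<in> {1..r} \<and> n \<in> Z (g i)"
    and mono: "\<forall>i\<in>{1..r'}. \<forall>j\<in>{1..r'}. i < j \<longrightarrow> g i < g j"
    using cell_chain_dehomog[OF chain n] by blast
  have "\<phi> ` I = supp_in (V' 0)"
    unfolding I V' by (rule hom_image[OF cell_chainD(1)[OF chain]]) simp
  moreover have "\<forall>j\<in>{1..r'}. primeideal (coprime_ideal (n - 1) (Z (g j) - {n}) :: 'a mpol set) (poly_ring (n - 1))"
    using prime g by (blast intro: primeideal_coprime_ideal_contract)
  moreover have "Z (g i) - {n} = Z (g j) - {n}"
    if ij: "i \<in> {1..r'}" "j \<in> {1..r'}" "i < j" "Z (g j) - {n} \<subseteq> Z (g i) - {n}" for i j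
  proof -
    have "g i \<in> {1..r}" "g j \<in> {1..r}" "g i < g j" "Z (g j) \<subseteq> Z (g i)"
      using g mono ij by blast+
    then show ?thesis using pc by metis
  qed
  ultimately show ?thesis
    unfolding pretty_clean_iff using chain' by blast
qed

end


subsection \<open>The Stanley decomposition of a prime filtration\<close>

lemma sum_in_exps: "(\<And>i. i \<in> A \<Longrightarrow> f i \<in> exps Z) \<Longrightarrow> sum f A \<in> exps Z"
  by (induction A rule: infinite_finite_induct) auto

lemma span_mon: "mpol.span {mon m |m. m \<in> X} = (supp_in X :: 'a::field mpol set)"
proof
  show "mpol.span {mon m |m. m \<in> X} \<subseteq> (supp_in X :: 'a mpol set)"
    by (rule mpol.span_minimal) (auto intro: mpol.subspaceI add_in_supp_in)
  show "(supp_in X :: 'a mpol set) \<subseteq> mpol.span {mon m |m. m \<in> X}"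
  proof
    fix p :: "'a mpol" assume p: "p \<in> supp_in X"
    show "p \<in> mpol.span {mon m |m. m \<in> X}"
      by (subst mpol_eq_sum, intro mpol.span_sum mpol.span_scale mpol.span_base)
        (use p in \<open>auto simp: supp_in_def\<close>)
  qed
qed

lemma stanley_space_eq: "stanley_space u Z = (supp_in ((+) u ` exps Z) :: 'a::field mpol set)"
proof -
  have "{mon u * mon v |v. v \<in> exps Z} = ({mon m |m. m \<in> (+) u ` exps Z} :: 'a mpol set)"
    unfolding mon_add[symmetric] by blast
  then show ?thesis by (simp add: stanley_space_def span_mon)
qed

lemma monomial_complement_eq: "monomial_complement n (supp_in U) = supp_in (exps {1..n} - U)"
  using span_mon[of "exps {1..n} - U"] by (simp add: monomial_complement_def)

text \<open>At an exponent in \<open>X d\<close> only the summand with index \<open>d\<close>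
  contributes, so the summands are recovered from the sum by \<open>restr\<close>.\<close>

lemma direct_sum_supp_in:
  assumes fin: "finite D" and disj: "\<And>d d'. d \<in> D \<Longrightarrow> d' \<in> D \<Longrightarrow> d \<noteq> d' \<Longrightarrow> X d \<inter> X d' = {}"
  shows "direct_sum_decomp D (\<lambda>d. supp_in (X d) :: 'a::field mpol set) (supp_in (\<Union>d\<in>D. X d))"
proof -
  let ?S = "\<lambda>f. \<Sum>d\<in>D. f d :: 'a mpol" and ?E = "\<Pi>\<^sub>E d\<in>D. supp_in (X d) :: 'a mpol set"
  have look: "Poly_Mapping.lookup (?S f) k = Poly_Mapping.lookup (f d) k"
    if f: "f \<in> ?E" and d: "d \<in> D" and k: "k \<in> X d" for f d k
  proof -
    have "Poly_Mapping.lookup (f d') k = 0" if d': "d' \<in> D - {d}" for d'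
    proof -
      have "f d' \<in> supp_in (X d')" using PiE_mem[OF f] d' by blast
      moreover have "k \<notin> X d'" using disj[of d d'] d d' k by auto
      ultimately show ?thesis by (auto simp: supp_in_def in_keys_iff)
    qed
    then have "(\<Sum>d'\<in>D. Poly_Mapping.lookup (f d') k) = (\<Sum>d'\<in>{d}. Poly_Mapping.lookup (f d') k)"
      using fin d by (intro sum.mono_neutral_right) auto
    then show ?thesis by (simp add: lookup_sum)
  qed
  have "inj_on ?S ?E"
  proof (rule inj_onI)
    fix f g assume f: "f \<in> ?E" and g: "g \<in> ?E" and eq: "?S f = ?S g"
    show "f = g"
    proof (rule PiE_ext[OF f g])
      fix d assume d: "d \<in> D"
      show "f d = g d"
      proof (rule poly_mapping_eqI)
        fix k
        show "Poly_Mapping.lookup (f d) k = Poly_Mapping.lookup (g d) k"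
        proof (cases "k \<in> X d")
          case True
          then show ?thesis using look[OF f d] look[OF g d] eq by metis
        next
          case False
          then have "k \<notin> Poly_Mapping.keys (f d)" "k \<notin> Poly_Mapping.keys (g d)"
            using PiE_mem[OF f d] PiE_mem[OF g d] by (auto simp: supp_in_def)
          then show ?thesis by (simp add: in_keys_iff)
        qed
      qed
    qed
  qed
  moreover have "?S ` ?E = supp_in (\<Union>d\<in>D. X d)"
  proof
    show "?S ` ?E \<subseteq> supp_in (\<Union>d\<in>D. X d)"
    proof
      fix p assume "p \<in> ?S ` ?E"
      then obtain f where f: "f \<in> ?E" "p = ?S f" by blast
      show "p \<in> supp_in (\<Union>d\<in>D. X d)"
        unfolding f(2)
      proof (rule sum_in_supp_in)
        fix d assume "d \<in> D"
        then show "f d \<in> supp_in (\<Union>d\<in>D. X d)"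
          using PiE_mem[OF f(1)] supp_in_mono[of "X d" "\<Union>d\<in>D. X d"] by blast
      qed
    qed
    show "supp_in (\<Union>d\<in>D. X d) \<subseteq> ?S ` ?E"
    proof
      fix p :: "'a mpol" assume p: "p \<in> supp_in (\<Union>d\<in>D. X d)"
      define f where "f = (\<lambda>d\<in>D. restr (X d) p)"
      have f: "f \<in> ?E" by (auto simp: f_def restr_in_supp_in)
      have "?S f = p"
      proof (rule poly_mapping_eqI)
        fix k
        show "Poly_Mapping.lookup (?S f) k = Poly_Mapping.lookup p k"
        proof (cases "k \<in> (\<Union>d\<in>D. X d)")
          case True
          then obtain d where d: "d \<in> D" "k \<in> X d" by blast
          show ?thesis unfolding look[OF f d] using d by (simp add: f_def)
        next
          case False
          then have "Poly_Mapping.lookup p k = 0"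
            using p by (auto simp: supp_in_def in_keys_iff subset_iff)
          moreover have "Poly_Mapping.lookup (f d) k = 0" if "d \<in> D" for d
            using that False by (auto simp: f_def)
          ultimately show ?thesis by (simp add: lookup_sum)
        qed
      qed
      with f show "p \<in> ?S ` ?E" by blast
    qed
  qed
  ultimately show ?thesis
    using fin by (simp add: direct_sum_decomp_def bij_betw_def)
qed

lemma cell_chain_union:
  assumes "cell_chain n r V m Z" "s \<le> r"
  shows "V s - V 0 = (\<Union>j\<in>{1..s}. V j - V (j - 1))"
  using assms(2)
proof (induction s)
  case (Suc s)
  have "V 0 \<subseteq> V s" "V s \<subseteq> V (Suc s)"
    using Suc.prems cell_chain_mono[OF assms(1)] by simp_all
  then have "V (Suc s) - V 0 = (V (Suc s) - V s) \<union> (V s - V 0)" by blast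
  also have "\<dots> = (\<Union>j\<in>insert (Suc s) {1..s}. V j - V (j - 1))"
    using Suc.IH Suc.prems by simp
  also have "insert (Suc s) {1..s} = {1..Suc s}" by auto
  finally show ?case .
qed simp

text \<open>An arbitrary lower bound \<open>c\<close> stands in for the minimum of the dimensions.
  This covers the chain of length 0, where the infimum over the empty decomposition is
  infinite.\<close>

lemma sdepth_cell_chain:
  assumes chain: "cell_chain n r V m Z" and c: "\<And>j. j \<in> {1..r} \<Longrightarrow> c \<le> enat (card (Z j))"
  shows "c \<le> sdepth n (supp_in (V 0) :: 'a::field mpol set)"
proof -
  define D where "D = (\<lambda>j. (m j, Z j)) ` {1..r}"
  define X :: "(nat \<Rightarrow>\<^sub>0 nat) \<times> nat set \<Rightarrow> (nat \<Rightarrow>\<^sub>0 nat) set"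
    where "X = (\<lambda>(u, Z). (+) u ` exps Z)"
  have X: "X (m j, Z j) = V j - V (j - 1)" if "j \<in> {1..r}" for j
    using cell_chainD(6)[OF chain that] by (simp add: X_def)
  have disj: "X (m i, Z i) \<inter> X (m j, Z j) = {}" if ij: "i \<in> {1..r}" "j \<in> {1..r}" "i < j" for i j
  proof -
    have "V i \<subseteq> V (j - 1)" using ij by (intro cell_chain_mono[OF chain]) auto
    then show ?thesis using X ij by auto
  qed
  have "direct_sum_decomp D (\<lambda>d. supp_in (X d) :: 'a mpol set) (supp_in (\<Union>d\<in>D. X d))"
  proof (rule direct_sum_supp_in)
    fix d d' assume "d \<in> D" "d' \<in> D" "d \<noteq> d'"
    then obtain i j where ij: "i \<in> {1..r}" "j \<in> {1..r}" "d = (m i, Z i)" "d' = (m j, Z j)"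
      unfolding D_def by blast
    then have "i \<noteq> j" using \<open>d \<noteq> d'\<close> by blast
    then consider "i < j" | "j < i" by linarith
    then show "X d \<inter> X d' = {}"
      using disj[of i j] disj[of j i] ij by cases auto
  qed (simp add: D_def)
  moreover have "(\<lambda>d. supp_in (X d) :: 'a mpol set) = (\<lambda>(u, Z). stanley_space u Z)"
    by (auto simp: X_def stanley_space_eq)
  moreover have "(\<Union>d\<in>D. X d) = exps {1..n} - V 0"
    using cell_chain_union[OF chain order_refl] cell_chainD(2)[OF chain] X by (simp add: D_def)
  ultimately have "stanley_decomp n (supp_in (V 0) :: 'a mpol set) D"
    unfolding stanley_decomp_def monomial_complement_eq
    using cell_chainD(4,5)[OF chain] by (auto simp: D_def)
  then have "sdepth_decomp D \<le> sdepth n (supp_in (V 0) :: 'a mpol set)"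
    unfolding sdepth_def by (intro SUP_upper) simp
  moreover have "c \<le> sdepth_decomp D"
    unfolding sdepth_decomp_def by (rule INF_greatest) (use c in \<open>auto simp: D_def\<close>)
  ultimately show ?thesis by (rule order_trans[rotated])
qed

text \<open>
  Only the first cell with a given \<open>Z\<close> is considered.  Moving far out in the directions of \<open>Z\<close>
  leaves every earlier cell, so that a further step in another direction ends up in the ideal.
\<close>

lemma pretty_clean_annihilator:
  assumes chain: "cell_chain n r V m Z"
    and pc: "\<And>i j. i \<in> {1..r} \<Longrightarrow> j \<in> {1..r} \<Longrightarrow> i < j \<Longrightarrow> Z j \<subseteq> Z i \<Longrightarrow> Z i = Z j"
    and l: "l \<in> {1..r}"
  shows "\<exists>w\<in>exps {1..n}. \<forall>e\<in>exps {1..n}. w + e \<in> V 0 \<longleftrightarrow> e \<notin> exps (Z l)"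
proof -
  define j where "j = (LEAST j. j \<in> {1..r} \<and> Z j = Z l)"
  have j: "j \<in> {1..r}" "Z j = Z l"
    using LeastI[of "\<lambda>j. j \<in> {1..r} \<and> Z j = Z l" l] l unfolding j_def by auto
  have least: "Z i \<noteq> Z j" if "i \<in> {1..r}" "i < j" for i
    using not_less_Least[of i "\<lambda>j. j \<in> {1..r} \<and> Z j = Z l"] that j(2) unfolding j_def by auto
  have Zfin: "finite (Z j)"
    using cell_chainD(4)[OF chain j(1)] finite_subset by blast
  \<comment> \<open>The \<open>Suc\<close> makes \<open>B\<close> exceed every entry of every
    \<open>m i\<close>. A point with an entry of at least \<open>B\<close> in direction
    \<open>k\<close> lies in no cell in which \<open>k\<close> is not free.\<close>
  define B where "B = Suc (\<Sum>i\<in>{1..r}. \<Sum>k\<in>{1..n}. Poly_Mapping.lookup (m i) k)"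
  have B: "Poly_Mapping.lookup (m i) k < B" if "i \<in> {1..r}" "k \<in> {1..n}" for i k
  proof -
    have "Poly_Mapping.lookup (m i) k \<le> (\<Sum>k\<in>{1..n}. Poly_Mapping.lookup (m i) k)"
      using that by (intro member_le_sum) auto
    also have "\<dots> \<le> (\<Sum>i\<in>{1..r}. \<Sum>k\<in>{1..n}. Poly_Mapping.lookup (m i) k)"
      using that by (intro member_le_sum[where f = "\<lambda>i. \<Sum>k\<in>{1..n}. Poly_Mapping.lookup (m i) k"]) auto
    finally show ?thesis by (simp add: B_def)
  qed
  define b where "b = (\<Sum>k\<in>Z j. Poly_Mapping.single k B)"
  have b: "b \<in> exps (Z j)"
    unfolding b_def by (rule sum_in_exps) simp
  have bk: "Poly_Mapping.lookup b k = B" if "k \<in> Z j" for k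
    using that Zfin by (simp add: b_def lookup_sum lookup_single when_def)
  define w where "w = m j + b"
  have w: "w \<in> exps {1..n}"
    using cell_chainD(5)[OF chain j(1)] exps_mono[OF cell_chainD(4)[OF chain j(1)]] b by (auto simp: w_def)
  have upj: "upset n (V j)" and up0: "upset n (V 0)" and upj1: "upset n (V (j - 1))"
    using j(1) by (auto intro: cell_chainD(1)[OF chain])
  have "w + e \<in> V 0 \<longleftrightarrow> e \<notin> exps (Z l)" if e: "e \<in> exps {1..n}" for e
  proof
    assume "w + e \<in> V 0"
    then have "w + e \<in> V (j - 1)"
      using cell_chain_mono[OF chain, of 0 "j - 1"] le_trans[OF diff_le_self, of j r 1] j(1) by auto
    then show "e \<notin> exps (Z l)"
      using cell_chain_cell(2)[OF chain j(1), of "b + e"] b j(2) by (auto simp: w_def add.assoc)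
  next
    assume ne: "e \<notin> exps (Z l)"
    have "m j + 0 \<in> V j" by (rule cell_chain_cell[OF chain j(1)]) simp
    moreover have "b + e \<in> exps {1..n}"
      using b e exps_mono[OF cell_chainD(4)[OF chain j(1)]] by auto
    ultimately have "w + e \<in> V j"
      using upj by (auto simp: upset_def w_def add.assoc)
    moreover have "w + e \<notin> V j - V (j - 1)"
    proof
      assume "w + e \<in> V j - V (j - 1)"
      then obtain v where "v \<in> exps (Z j)" "w + e = m j + v"
        unfolding cell_chainD(6)[OF chain j(1)] by blast
      then show False using ne j(2) by (auto simp: w_def add.assoc)
    qed
    ultimately have in1: "w + e \<in> V (j - 1)" by blast
    show "w + e \<in> V 0"
    proof (rule ccontr)
      assume "w + e \<notin> V 0"
      then have "w + e \<in> V (j - 1) - V 0" using in1 by blast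
      also have "\<dots> = (\<Union>i\<in>{1..j - 1}. V i - V (i - 1))"
        by (rule cell_chain_union[OF chain]) (use j(1) in auto)
      finally obtain i where i: "i \<in> {1..j - 1}" "w + e \<in> V i - V (i - 1)" by blast
      have ir: "i \<in> {1..r}" "i < j" using i(1) j(1) by auto
      obtain v where v: "v \<in> exps (Z i)" "w + e = m i + v"
        using i(2) unfolding cell_chainD(6)[OF chain ir(1)] by blast
      \<comment> \<open>By pretty cleanness this inclusion would force equality, against the choice
        of \<open>j\<close> as the first step with its \<open>Z\<close>.\<close>
      have "\<not> Z j \<subseteq> Z i" using pc[OF ir(1) j(1) ir(2)] least[OF ir] by blast
      then obtain k where k: "k \<in> Z j" "k \<notin> Z i" by blast
      have "Poly_Mapping.lookup v k = 0" using v(1) k(2) by (auto simp: exps_def in_keys_iff)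
      moreover have "B \<le> Poly_Mapping.lookup (w + e) k" using bk[OF k(1)] by (simp add: w_def lookup_add)
      moreover have "Poly_Mapping.lookup (m i) k < B"
        using B[OF ir(1)] cell_chainD(4)[OF chain j(1)] k(1) by blast
      ultimately show False unfolding v(2) by (simp add: lookup_add)
    qed
  qed
  with w show ?thesis by blast
qed


subsection \<open>Noetherianity of the polynomial ring\<close>

text \<open>A monotone subsequence exists, and a decreasing sequence of naturals is constant from
  its minimum on.\<close>

lemma nat_incseq_subseq:
  fixes s :: "nat \<Rightarrow> nat"
  shows "\<exists>f. strict_mono f \<and> incseq (\<lambda>i. s (f i))"
proof -
  obtain f where f: "strict_mono f" "monoseq (\<lambda>i. s (f i))"
    using seq_monosub by blast
  show ?thesis
  proof (cases "incseq (\<lambda>i. s (f i))")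
    case False
    then have dec: "decseq (\<lambda>i. s (f i))" using f(2) by (simp add: monoseq_iff)
    define N where "N = (ARG_MIN (\<lambda>i. s (f i)) i. True)"
    have N: "s (f N) \<le> s (f i)" for i
      unfolding N_def by (rule arg_min_nat_le) simp
    have "s (f (i + N)) = s (f N)" for i
      using N[of "i + N"] decseqD[OF dec, of N "i + N"] by simp
    then have "incseq (\<lambda>i. s ((f \<circ> (\<lambda>i. i + N)) i))" by (simp add: incseq_def)
    moreover have "strict_mono (f \<circ> (\<lambda>i. i + N))"
      using f(1) by (simp add: strict_mono_def)
    ultimately show ?thesis by blast
  qed (use f in blast)
qed

lemma exps_incseq_subseq:
  fixes s :: "nat \<Rightarrow> (nat \<Rightarrow>\<^sub>0 nat)"
  assumes "finite Z"
  shows "\<exists>f. strict_mono f \<and> (\<forall>k\<in>Z. incseq (\<lambda>i. Poly_Mapping.lookup (s (f i)) k))"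
  using assms
proof (induction Z)
  case empty
  show ?case by (auto intro: exI[of _ id] simp: strict_mono_def)
next
  case (insert x Z)
  then obtain f where f: "strict_mono f" "\<And>k. k \<in> Z \<Longrightarrow> incseq (\<lambda>i. Poly_Mapping.lookup (s (f i)) k)"
    by blast
  obtain g where g: "strict_mono g" "incseq (\<lambda>i. Poly_Mapping.lookup (s (f (g i))) x)"
    using nat_incseq_subseq[of "\<lambda>i. Poly_Mapping.lookup (s (f i)) x"] by blast
  have "incseq (\<lambda>i. Poly_Mapping.lookup (s (f (g i))) k)" if "k \<in> Z" for k
    using f(2)[OF that] strict_mono_mono[OF g(1)] by (auto simp: incseq_def mono_def)
  with g(2) have "\<forall>k\<in>insert x Z. incseq (\<lambda>i. Poly_Mapping.lookup (s ((f \<circ> g) i)) k)" by auto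
  moreover have "strict_mono (f \<circ> g)" using f(1) g(1) by (rule strict_mono_o)
  ultimately show ?case by blast
qed

text \<open>The first two terms of a subsequence that increases in every coordinate of
  \<open>Z\<close> suffice; outside \<open>Z\<close> all entries vanish.\<close>

lemma dickson:
  fixes s :: "nat \<Rightarrow> (nat \<Rightarrow>\<^sub>0 nat)"
  assumes "finite Z" "\<And>i. s i \<in> exps Z"
  shows "\<exists>i j v. i < j \<and> v \<in> exps Z \<and> s j = s i + v"
proof -
  obtain f where f: "strict_mono f" "\<And>k. k \<in> Z \<Longrightarrow> incseq (\<lambda>i. Poly_Mapping.lookup (s (f i)) k)"
    using exps_incseq_subseq[OF assms(1), of s] by blast
  have le: "Poly_Mapping.lookup (s (f 0)) k \<le> Poly_Mapping.lookup (s (f 1)) k" for k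
  proof (cases "k \<in> Z")
    case True
    then show ?thesis using incseqD[OF f(2), of k 0 1] by simp
  next
    case False
    then have "k \<notin> Poly_Mapping.keys (s (f 0))" using assms(2)[of "f 0"] by (auto simp: exps_def)
    then show ?thesis by (simp add: in_keys_iff)
  qed
  have eq: "s (f 1) = s (f 0) + (s (f 1) - s (f 0))"
    by (rule poly_mapping_eqI) (use le in \<open>simp add: lookup_add lookup_minus\<close>)
  moreover have "s (f 1) - s (f 0) \<in> exps Z"
    using assms(2)[of "f 1"] eq by (metis plus_in_exps_iff)
  moreover have "f 0 < f 1" using f(1) by (simp add: strict_mono_def)
  ultimately show ?thesis by blast
qed

text \<open>The linear order of \<open>Poly_Mapping\<close> on exponents is lexicographic and serves
  as monomial order: it is compatible with addition, and 0 is least.\<close>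

lemma exponent_nonneg: "0 \<le> (v :: nat \<Rightarrow>\<^sub>0 nat)"
proof (rule leI, rule notI)
  assume "v < 0"
  then show False by (transfer, auto simp: less_fun_def)
qed

text \<open>In a descending sequence, Dickson's lemma finds a term that divides a later one, which
  is then at least as large. Finiteness of \<open>Z\<close> matters: infinitely many variables, by
  increasing index, form a descending chain.\<close>

lemma wf_exps_less:
  assumes "finite Z"
  shows "wf {(a, b). a \<in> exps Z \<and> b \<in> exps Z \<and> a < b}"
  unfolding wf_iff_no_infinite_down_chain
proof
  assume "\<exists>f. \<forall>i. (f (Suc i), f i) \<in> {(a, b). a \<in> exps Z \<and> b \<in> exps Z \<and> a < b}"
  then obtain f where f: "\<And>i. f (Suc i) \<in> exps Z \<and> f i \<in> exps Z \<and> f (Suc i) < f i" by blast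
  then obtain i j v where ij: "i < j" "f j = f i + v"
    using dickson[OF assms, of f] by blast
  have "f j < f i"
    using ij(1)
  proof (induction j)
    case (Suc j)
    then show ?case using f[of j] by (metis less_SucE less_trans)
  qed simp
  moreover have "f i \<le> f j"
    using add_left_mono[OF exponent_nonneg, of "f i" v] by (simp add: ij)
  ultimately show False by simp
qed

text \<open>Hilbert's basis theorem by leading monomials. In each difference of consecutive ideals
  choose \<open>p t\<close> with minimal leading monomial. By Dickson's lemma one of these leading
  monomials divides a later one; cancelling the later leading term leaves a polynomial in the same
  difference with a smaller leading monomial.\<close>

lemma ascending_ideals_stabilize:
  fixes J :: "nat \<Rightarrow> 'a::field mpol set"
  assumes ideal: "\<And>t. ideal (J t) (poly_ring n)" and sub: "\<And>t. J t \<subseteq> J (Suc t)"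
  shows "\<exists>t. J (Suc t) = J t"
proof (rule ccontr)
  assume no: "\<not> ?thesis"
  define lm :: "'a mpol \<Rightarrow> _" where "lm p = Max (Poly_Mapping.keys p)" for p
  let ?r = "{(a, b). a \<in> exps {1..n} \<and> b \<in> exps {1..n} \<and> a < b}"
  have wf: "wf ?r" by (rule wf_exps_less) simp
  have nz: "p \<noteq> 0" if "p \<in> J (Suc t) - J t" for p t
    using that ideal_zero[OF ideal] by blast
  have lm_key: "lm p \<in> Poly_Mapping.keys p" if "p \<noteq> 0" for p
    unfolding lm_def by (rule Max_in) (use that in auto)
  have lm_exps: "lm p \<in> exps {1..n}" if "p \<in> J (Suc t) - J t" for p t
    using lm_key[OF nz[OF that]] ideal_subset[OF ideal[of "Suc t"]] that by (auto simp: supp_in_def)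
  have "\<exists>p. p \<in> J (Suc t) - J t \<and> (\<forall>q\<in>J (Suc t) - J t. \<not> lm q < lm p)" for t
  proof -
    have "J (Suc t) - J t \<noteq> {}" using no sub[of t] by blast
    then obtain a where "a \<in> lm ` (J (Suc t) - J t)" by blast
    from wfE_min[OF wf this] obtain b where b: "b \<in> lm ` (J (Suc t) - J t)"
      "\<And>c. (c, b) \<in> ?r \<Longrightarrow> c \<notin> lm ` (J (Suc t) - J t)" by blast
    then obtain p where p: "p \<in> J (Suc t) - J t" "b = lm p" by blast
    have "\<not> lm q < lm p" if q: "q \<in> J (Suc t) - J t" for q
      using b(2)[of "lm q"] lm_exps[OF q] lm_exps[OF p(1)] q p(2) by auto
    with p show ?thesis by blast
  qed
  then obtain p where p: "\<And>t. p t \<in> J (Suc t) - J t"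
    and min: "\<And>t q. q \<in> J (Suc t) - J t \<Longrightarrow> \<not> lm q < lm (p t)" by metis
  obtain i j v where ij: "i < j" "v \<in> exps {1..n}" "lm (p j) = lm (p i) + v"
    using dickson[of "{1..n}" "\<lambda>t. lm (p t)"] lm_exps[OF p] by auto
  define c where "c = Poly_Mapping.lookup (p j) (lm (p j)) / Poly_Mapping.lookup (p i) (lm (p i))"
  define q where "q = p j - const c * (mon v * p i)"
  have "J (Suc i) \<subseteq> J j" by (rule lift_Suc_mono_le[of J, OF sub]) (use ij in simp)
  then have pi: "const c * (mon v * p i) \<in> J j"
    using p[of i] ij(2) by (intro ideal_mult[OF ideal]) (auto intro: const_in_supp_in)
  have qJ: "q \<in> J (Suc j) - J j"
  proof
    show "q \<in> J (Suc j)" unfolding q_def using p[of j] pi sub[of j] by (intro ideal_diff[OF ideal]) auto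
    show "q \<notin> J j"
    proof
      assume "q \<in> J j"
      then have "q + const c * (mon v * p i) \<in> J j" using pi by (rule ideal_add[OF ideal])
      then show False using p[of j] by (simp add: q_def)
    qed
  qed
  have "Poly_Mapping.lookup (mon v * p i) (lm (p j)) = Poly_Mapping.lookup (p i) (lm (p i))"
    using lookup_mon_mult_add[of v "p i" "lm (p i)"] ij(3) by (simp add: add.commute)
  moreover have "Poly_Mapping.lookup (p i) (lm (p i)) \<noteq> 0"
    using lm_key[OF nz[OF p[of i]]] by (simp add: in_keys_iff)
  ultimately have "Poly_Mapping.lookup q (lm (p j)) = 0"
    by (simp add: q_def lookup_minus c_def)
  then have ne: "lm q \<noteq> lm (p j)"
    using lm_key[OF nz[OF qJ]] by (auto simp: in_keys_iff)
  have le_lm: "k \<le> lm p" if "k \<in> Poly_Mapping.keys p" for k p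
    unfolding lm_def using that by simp
  have "lm q \<in> Poly_Mapping.keys (p j) \<union> Poly_Mapping.keys (mon v * p i)"
    using lm_key[OF nz[OF qJ]] by (auto simp: in_keys_iff q_def lookup_minus)
  then have "lm q \<le> lm (p j)"
  proof
    assume "lm q \<in> Poly_Mapping.keys (mon v * p i)"
    then obtain k where "k \<in> Poly_Mapping.keys (p i)" "lm q = v + k" by (auto simp: keys_mon_mult)
    then show ?thesis using add_left_mono[OF le_lm, of k "p i" v] ij(3) by (simp add: add.commute)
  qed (rule le_lm)
  with ne min[OF qJ] show False by simp
qed


subsection \<open>Regular sequences and torsion\<close>

text \<open>Up to non-zero constant factors, the polynomials outside this ideal are the
  \<open>1 + y\<close> with \<open>y\<close> in it; hence the form of the denominators in
  \<open>loc\<close>.\<close>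

definition max_ideal :: "nat \<Rightarrow> 'a::field mpol set" where
  "max_ideal n = supp_in (exps {1..n} - {0})"

lemma exps_empty: "exps {} = {0}"
  by (auto simp: exps_def)

lemma max_ideal_eq: "max_ideal n = Idl\<^bsub>poly_ring n\<^esub> (var ` {1..n})"
  by (subst genideal_var) (simp_all add: max_ideal_def coprime_ideal_def exps_empty)

lemma ideal_max_ideal: "ideal (max_ideal n) (poly_ring n)"
  using ideal_supp_in[OF upset_Diff_exps[of n "{}"]] by (simp add: max_ideal_def exps_empty)

lemma max_ideal_in_polys: "y \<in> max_ideal n \<Longrightarrow> y \<in> supp_in (exps {1..n})"
  using ideal_subset[OF ideal_max_ideal] by auto

definition adjoin :: "nat \<Rightarrow> 'a::field mpol set \<Rightarrow> 'a mpol \<Rightarrow> 'a mpol set" where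
  "adjoin n J x = {p + x * s |p s. p \<in> J \<and> s \<in> polys n}"

lemma adjoin_subset: "J \<subseteq> adjoin n J x"
  unfolding adjoin_def by clarify (metis add.right_neutral mult_zero_right poly_ring_simps(1) zero_in_supp_in)

lemma adjoin_mult: "0 \<in> J \<Longrightarrow> s \<in> polys n \<Longrightarrow> x * s \<in> adjoin n J x"
  unfolding adjoin_def by (metis (mono_tags, lifting) CollectI add_0)

lemma ideal_adjoin:
  fixes J :: "'a::field mpol set"
  assumes J: "ideal J (poly_ring n)" and x: "x \<in> polys n"
  shows "ideal (adjoin n J x) (poly_ring n)"
  unfolding ideal_iff
proof (intro conjI ballI)
  show "adjoin n J x \<subseteq> polys n"
    using ideal_subset[OF J] mult_in_polys[OF x] by (auto simp: adjoin_def intro: add_in_supp_in)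
  show "0 \<in> adjoin n J x" using adjoin_subset[of J n x] ideal_zero[OF J] by blast
next
  fix a b assume "a \<in> adjoin n J x" "b \<in> adjoin n J x"
  then obtain p q s t where "p \<in> J" "q \<in> J" "s \<in> polys n" "t \<in> polys n" "a = p + x * s" "b = q + x * t"
    by (auto simp: adjoin_def)
  moreover from this have "a + b = (p + q) + x * (s + t)" by (simp add: algebra_simps)
  moreover have "p + q \<in> J" "s + t \<in> polys n"
    using calculation ideal_add[OF J] add_in_supp_in by auto
  ultimately show "a + b \<in> adjoin n J x" unfolding adjoin_def by blast
next
  fix r a :: "'a mpol" assume r: "r \<in> polys n" and "a \<in> adjoin n J x"
  then obtain p s where ps: "p \<in> J" "s \<in> polys n" "a = p + x * s"
    by (auto simp: adjoin_def)
  then have "r * a = r * p + x * (r * s)" by (simp add: algebra_simps)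
  then show "r * a \<in> adjoin n J x"
    using ideal_mult[OF J r ps(1)] mult_in_polys[OF r ps(2)] unfolding adjoin_def by blast
qed

lemma adjoin_subset_ideal:
  assumes K: "ideal K (poly_ring n)" and "J \<subseteq> K" "x \<in> K"
  shows "adjoin n J x \<subseteq> K"
proof
  fix a assume "a \<in> adjoin n J x"
  then obtain p s where "p \<in> J" "s \<in> polys n" "a = p + s * x"
    by (auto simp: adjoin_def mult.commute)
  with assms show "a \<in> K" by (auto intro: ideal_add[OF K] ideal_mult[OF K, of s x, simplified])
qed

text \<open>The preimage in the polynomial ring of the localization of \<open>J\<close> at the maximal ideal.\<close>

definition loc :: "nat \<Rightarrow> 'a::field mpol set \<Rightarrow> 'a mpol set" where
  "loc n J = {z \<in> polys n. \<exists>y\<in>max_ideal n. (1 + y) * z \<in> J}"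

lemma locI: "z \<in> polys n \<Longrightarrow> y \<in> max_ideal n \<Longrightarrow> (1 + y) * z \<in> J \<Longrightarrow> z \<in> loc n J"
  unfolding loc_def by blast

lemma one_plus_mult_max_ideal:
  assumes "y \<in> max_ideal n" "y' \<in> max_ideal n"
  shows "y + y' + y * y' \<in> max_ideal n" "(1 + y) * (1 + y') = 1 + (y + y' + y * y')"
  using assms max_ideal_in_polys[OF assms(1)]
  by (auto intro!: ideal_add[OF ideal_max_ideal] ideal_mult[OF ideal_max_ideal] simp: algebra_simps)

lemma one_plus_in_polys: "y \<in> max_ideal n \<Longrightarrow> 1 + y \<in> polys n"
  using add_in_supp_in[of 1 "exps {1..n}" y] max_ideal_in_polys[of y n] by simp

lemma subset_loc: "ideal J (poly_ring n) \<Longrightarrow> J \<subseteq> loc n J"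
  using ideal_subset[of J n] by (auto intro!: locI[of _ n 0] ideal_zero[OF ideal_max_ideal])

lemma loc_mono: "J \<subseteq> K \<Longrightarrow> loc n J \<subseteq> loc n K"
  by (auto simp: loc_def)

lemma ideal_loc:
  fixes J :: "'a::field mpol set"
  assumes J: "ideal J (poly_ring n)"
  shows "ideal (loc n J) (poly_ring n)"
  unfolding ideal_iff
proof (intro conjI ballI)
  show "0 \<in> loc n J" using subset_loc[OF J] ideal_zero[OF J] by blast
next
  fix a b assume "a \<in> loc n J" "b \<in> loc n J"
  then obtain y y' where y: "a \<in> polys n" "b \<in> polys n" "y \<in> max_ideal n" "y' \<in> max_ideal n"
      "(1 + y) * a \<in> J" "(1 + y') * b \<in> J" by (auto simp: loc_def)
  have "(1 + y') * ((1 + y) * a) + (1 + y) * ((1 + y') * b) \<in> J"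
    by (intro ideal_add[OF J] ideal_mult[OF J one_plus_in_polys] y)
  then have "((1 + y) * (1 + y')) * (a + b) \<in> J" by (simp only: algebra_simps)
  then show "a + b \<in> loc n J"
    using one_plus_mult_max_ideal[OF y(3,4)] y(1,2)
    by (intro locI[of _ n "y + y' + y * y'"]) (auto intro: add_in_supp_in)
next
  fix r a :: "'a mpol" assume r: "r \<in> polys n" and "a \<in> loc n J"
  then obtain y where y: "a \<in> polys n" "y \<in> max_ideal n" "(1 + y) * a \<in> J" by (auto simp: loc_def)
  have "(1 + y) * (r * a) \<in> J" using ideal_mult[OF J r y(3)] by (simp only: mult.left_commute)
  then show "r * a \<in> loc n J" using mult_in_polys[OF r y(1)] y(2) by (intro locI)
qed (simp add: loc_def)

lemma loc_loc:
  assumes "z \<in> loc n (loc n J)"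
  shows "z \<in> loc n J"
proof -
  obtain y y' where y: "z \<in> polys n" "y \<in> max_ideal n" "y' \<in> max_ideal n" "(1 + y') * ((1 + y) * z) \<in> J"
    using assms by (auto simp: loc_def)
  then have "(1 + (y' + y + y' * y)) * z \<in> J"
    using one_plus_mult_max_ideal(2)[OF y(3,2)] by (metis mult.assoc)
  with y(1) one_plus_mult_max_ideal(1)[OF y(3,2)] show ?thesis by (rule locI)
qed

lemma loc_regular:
  assumes reg: "\<And>z. z \<in> polys n \<Longrightarrow> x * z \<in> J \<Longrightarrow> z \<in> J" and z: "z \<in> polys n" "x * z \<in> loc n J"
  shows "z \<in> loc n J"
proof -
  obtain y where y: "y \<in> max_ideal n" "(1 + y) * (x * z) \<in> J" using z(2) by (auto simp: loc_def)
  have "(1 + y) * z \<in> J"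
    by (rule reg) (use y z(1) mult_in_polys[OF one_plus_in_polys[OF y(1)] z(1)] in \<open>simp_all add: mult.left_commute\<close>)
  with z(1) y(1) show ?thesis by (rule locI)
qed

text \<open>
  A form of Krull's intersection theorem: an element that can be divided by \<open>x\<close> indefinitely
  vanishes in the local ring.  The ideals generated by the successive quotients stabilize.
\<close>

lemma krull_intersection:
  fixes J :: "'a::field mpol set"
  assumes J: "ideal J (poly_ring n)" and x: "x \<in> max_ideal n"
    and div: "\<And>z. Q z \<Longrightarrow> \<exists>z'. Q z' \<and> (\<exists>y\<in>max_ideal n. (1 + y) * z - x * z' \<in> loc n J)"
    and Q: "\<And>z. Q z \<Longrightarrow> z \<in> polys n" and z: "Q z"
  shows "z \<in> loc n J"
proof -
  let ?L = "loc n J"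
  note L = ideal_loc[OF J]
  \<comment> \<open>Iterating \<open>div\<close> from \<open>z\<close> gives a sequence in which
    each term is \<open>x\<close> times the next, up to a denominator and modulo
    \<open>?L\<close>.\<close>
  have "\<exists>u. (u 0 = z \<and> (\<forall>t. Q (u t))) \<and> (\<forall>t. \<exists>y\<in>max_ideal n. (1 + y) * u t - x * u (Suc t) \<in> ?L)"
    using dependent_nat_choice[of "\<lambda>t v. Q v \<and> (t = 0 \<longrightarrow> v = z)"
        "\<lambda>t v w. \<exists>y\<in>max_ideal n. (1 + y) * v - x * w \<in> ?L"] z div by auto
  then obtain u where u: "u 0 = z" "\<And>t. Q (u t)"
    and "\<forall>t. \<exists>y\<in>max_ideal n. (1 + y) * u t - x * u (Suc t) \<in> ?L" by blast
  then obtain y where y: "\<And>t. y t \<in> max_ideal n" "\<And>t. (1 + y t) * u t - x * u (Suc t) \<in> ?L"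
    by metis
  have up: "u t \<in> polys n" for t using Q u(2) by blast
  have xp: "x \<in> polys n" using max_ideal_in_polys[OF x] by simp
  \<comment> \<open>The outer \<open>loc\<close> makes these ideals ascend: \<open>u t\<close> is a
    multiple of \<open>u (Suc t)\<close> only up to a denominator.\<close>
  define K where "K t = loc n (adjoin n ?L (u t))" for t
  have K: "ideal (K t) (poly_ring n)" for t
    unfolding K_def by (intro ideal_loc ideal_adjoin L up)
  have adK: "adjoin n ?L (u t) \<subseteq> K t" for t
    unfolding K_def by (intro subset_loc ideal_adjoin L up)
  have one: "(1 :: 'a mpol) \<in> polys n" by simp
  have uK: "u t \<in> K t" for t
    using adjoin_mult[OF ideal_zero[OF L] one, of "u t"] adK[of t] by auto
  have "u t \<in> K (Suc t)" for t
  proof -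
    have "((1 + y t) * u t - x * u (Suc t)) + u (Suc t) * x \<in> adjoin n ?L (u (Suc t))"
      unfolding adjoin_def using y(2)[of t] xp by blast
    then have "(1 + y t) * u t \<in> adjoin n ?L (u (Suc t))" by (simp add: mult.commute)
    then show ?thesis unfolding K_def by (rule locI[OF up y(1)])
  qed
  then have "adjoin n ?L (u t) \<subseteq> K (Suc t)" for t
    using adK[of "Suc t"] adjoin_subset[of ?L n "u (Suc t)"]
    by (intro adjoin_subset_ideal[OF K]) auto
  then have "K t \<subseteq> loc n (K (Suc t))" for t
    unfolding K_def[of t] by (rule loc_mono)
  moreover have "loc n (K t) \<subseteq> K t" for t
    unfolding K_def using loc_loc by blast
  ultimately have "K t \<subseteq> K (Suc t)" for t by blast
  then obtain t where "K (Suc t) = K t"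
    using ascending_ideals_stabilize[of K, OF K] by blast
  then have "u (Suc t) \<in> K t" using uK by blast
  then obtain w p s where w: "w \<in> max_ideal n" "p \<in> ?L" "s \<in> polys n" "(1 + w) * u (Suc t) = p + u t * s"
    unfolding K_def loc_def adjoin_def by blast
  \<comment> \<open>Nakayama by hand: up to denominators and modulo \<open>?L\<close>,
    \<open>u (Suc t)\<close> is a multiple of \<open>u t\<close>, and \<open>u t\<close> is
    \<open>x\<close> times \<open>u (Suc t)\<close>. Eliminating \<open>u t\<close> leaves the
    factor \<open>1 + v\<close>.\<close>
  define v where "v = y t + w + y t * w - s * x"
  have v: "v \<in> max_ideal n"
    unfolding v_def using one_plus_mult_max_ideal(1)[OF y(1) w(1)] w(3) x
    by (intro ideal_diff[OF ideal_max_ideal] ideal_mult[OF ideal_max_ideal]) auto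
  have "(1 + v) * u (Suc t) = (1 + y t) * ((1 + w) * u (Suc t)) - s * (x * u (Suc t))"
    by (simp add: v_def algebra_simps)
  also have "\<dots> = (1 + y t) * p + s * ((1 + y t) * u t - x * u (Suc t))"
    unfolding w(4) by (simp add: algebra_simps)
  also have "\<dots> \<in> ?L"
    using w(2,3) y one_plus_in_polys[OF y(1)] by (intro ideal_add[OF L] ideal_mult[OF L]) auto
  finally have "u (Suc t) \<in> loc n ?L" using locI[OF up v] by blast
  then have last: "u (Suc t) \<in> ?L" by (rule loc_loc)
  \<comment> \<open>Vanishing passes from a term to its predecessor, and so back to
    \<open>u 0\<close>, which is \<open>z\<close>.\<close>
  have descend: "u t \<in> ?L" if "u (Suc t) \<in> ?L" for t
  proof -
    have "((1 + y t) * u t - x * u (Suc t)) + x * u (Suc t) \<in> ?L"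
      using y(2)[of t] ideal_mult[OF L xp that] by (rule ideal_add[OF L])
    then have "(1 + y t) * u t \<in> ?L" by simp
    then show ?thesis by (rule loc_loc[OF locI[OF up y(1)]])
  qed
  have "u (Suc t - k) \<in> ?L" if "k \<le> Suc t" for k
    using that
  proof (induction k)
    case (Suc k)
    then have "u (Suc (t - k)) \<in> ?L" by (simp add: Suc_diff_le)
    then show ?case using descend by simp
  qed (use last in simp)
  from this[of "Suc t"] show ?thesis using u(1) by simp
qed

text \<open>Regularity in terms of ideals instead of submodules, and recursive from the front, as
  the induction that removes the first element requires. The quotient is allowed to vanish.\<close>

fun weakly_regular :: "nat \<Rightarrow> 'a::field mpol set \<Rightarrow> 'a mpol list \<Rightarrow> bool" where
  "weakly_regular n J [] = True"
| "weakly_regular n J (x # xs) \<longleftrightarrow>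
     (\<forall>z\<in>polys n. x * z \<in> J \<longrightarrow> z \<in> J) \<and> weakly_regular n (adjoin n J x) xs"

fun power_prod :: "'a::field mpol list \<Rightarrow> nat list \<Rightarrow> 'a mpol" where
  "power_prod (x # xs) (a # as) = x ^ a * power_prod xs as"
| "power_prod _ _ = 1"

lemma power_in_polys: "x \<in> polys n \<Longrightarrow> x ^ k \<in> polys n"
  by (induction k) (auto intro: mult_in_polys[simplified])

lemma power_prod_in_polys: "set xs \<subseteq> polys n \<Longrightarrow> power_prod xs as \<in> polys n"
proof (induction xs as rule: power_prod.induct)
  case (1 x xs a as)
  then show ?case using mult_in_polys[OF power_in_polys[of x n a], of "power_prod xs as"] by simp
qed simp_all

text \<open>
  The products of powers of a regular sequence act on the local ring without torsion.  The
  part of the relation of least order in the first element is a relation modulo that element, so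
  the induction hypothesis makes \<open>z\<close> divisible by it; the quotient satisfies the same relation.
\<close>

lemma weakly_regular_torsion_free:
  fixes c :: "nat list \<Rightarrow> 'a::field"
  assumes "ideal J (poly_ring n)" "set xs \<subseteq> max_ideal n" "weakly_regular n J xs"
    and "finite A" "A \<noteq> {}" "\<forall>as\<in>A. length as = length xs \<and> c as \<noteq> 0"
    and "z \<in> polys n" "(\<Sum>as\<in>A. const (c as) * power_prod xs as) * z \<in> loc n J"
  shows "z \<in> loc n J"
  using assms
proof (induction xs arbitrary: J A c z)
  case Nil
  note L = ideal_loc[OF Nil.prems(1)]
  \<comment> \<open>There is only one exponent list of length 0, so the relation is a non-zero
    constant and can be inverted.\<close>
  have A: "A = {[]}" using Nil.prems(5,6) by auto
  then have "c [] \<noteq> 0" using Nil.prems(6) by simp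
  have "const (inverse (c [])) * (const (c []) * z) \<in> loc n J"
    by (rule ideal_mult[OF L]) (use Nil.prems(8) A in \<open>simp_all add: const_in_supp_in\<close>)
  then show ?case using \<open>c [] \<noteq> 0\<close> by (simp flip: mult.assoc const_mult)
next
  case (Cons x xs)
  let ?L = "loc n J" and ?J' = "adjoin n J x"
  note J = Cons.prems(1)
  note L = ideal_loc[OF J]
  have x: "x \<in> max_ideal n" and xs: "set xs \<subseteq> max_ideal n" using Cons.prems(2) by auto
  have xp: "x \<in> polys n" and xsp: "set xs \<subseteq> polys n"
    using x xs max_ideal_in_polys by auto
  have reg: "v \<in> ?L" if "v \<in> polys n" "x * v \<in> ?L" for v
    by (rule loc_regular[OF _ that]) (use Cons.prems(3) in auto)
  have regp: "v \<in> ?L" if "v \<in> polys n" "x ^ k * v \<in> ?L" for v k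
    using that(2)
  proof (induction k)
    case (Suc k)
    have "x ^ k * v \<in> polys n" by (rule mult_in_polys[OF power_in_polys[OF xp] that(1)])
    then show ?case using reg[of "x ^ k * v"] Suc by (simp add: mult.assoc)
  qed simp
  note J' = ideal_adjoin[OF J xp]
  \<comment> \<open>The least exponent of \<open>x\<close> in the relation. \<open>G\<close>
    collects the terms where it is attained and \<open>x * H\<close> the others, both after division
    by \<open>x ^ e\<close>, which cancels by regularity.\<close>
  define e where "e = Min (hd ` A)"
  have e: "e \<in> hd ` A" "\<And>as. as \<in> A \<Longrightarrow> e \<le> hd as"
    unfolding e_def using Cons.prems(4,5) by (auto intro: Min_in)
  have A_Cons: "\<exists>b bs. as = b # bs \<and> length bs = length xs" if "as \<in> A" for as
    using Cons.prems(6) that by (cases as) auto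
  define A0 where "A0 = {as \<in> A. hd as = e}"
  define B where "B = tl ` A0"
  define c' where "c' bs = c (e # bs)" for bs
  define G where "G = (\<Sum>bs\<in>B. const (c' bs) * power_prod xs bs)"
  define H where "H = (\<Sum>as\<in>A - A0. const (c as) * (x ^ (hd as - Suc e) * power_prod xs (tl as)))"
  have A0: "A0 \<subseteq> A" "A0 \<noteq> {}" using e(1) by (auto simp: A0_def)
  have A0_Cons: "as = e # tl as" if "as \<in> A0" for as
    using A_Cons[of as] that by (auto simp: A0_def)
  have inj: "inj_on tl A0" using A0_Cons by (metis inj_onI)
  have Gp: "G \<in> polys n"
    unfolding G_def using power_prod_in_polys[OF xsp] by (auto intro!: sum_in_supp_in)
  have Hp: "H \<in> polys n"
    unfolding H_def using mult_in_polys[OF power_in_polys[OF xp] power_prod_in_polys[OF xsp]]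
    by (auto intro!: sum_in_supp_in)
  have "(\<Sum>as\<in>A0. const (c as) * power_prod (x # xs) as) = x ^ e * G"
    unfolding G_def B_def sum.reindex[OF inj] sum_distrib_left
  proof (rule sum.cong[OF refl])
    fix as assume "as \<in> A0"
    from A0_Cons[OF this] obtain bs where "as = e # bs" by blast
    then show "const (c as) * power_prod (x # xs) as
        = x ^ e * ((\<lambda>bs. const (c' bs) * power_prod xs bs) \<circ> tl) as"
      by (simp add: c'_def mult_ac)
  qed
  moreover have "(\<Sum>as\<in>A - A0. const (c as) * power_prod (x # xs) as) = x ^ e * (x * H)"
    unfolding H_def sum_distrib_left
  proof (rule sum.cong[OF refl])
    fix as assume as: "as \<in> A - A0"
    then obtain b bs where b: "as = b # bs" using A_Cons by blast
    have "e < b" using as e(2)[of as] b by (force simp: A0_def)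
    then have "x ^ b = x ^ e * (x * x ^ (b - Suc e))"
      by (metis Suc_leI le_add_diff_inverse power_Suc power_add power_commutes mult.assoc)
    then show "const (c as) * power_prod (x # xs) as
        = x ^ e * (x * (const (c as) * (x ^ (hd as - Suc e) * power_prod xs (tl as))))"
      by (simp add: b mult_ac)
  qed
  ultimately have split: "(\<Sum>as\<in>A. const (c as) * power_prod (x # xs) as) = x ^ e * (G + x * H)"
    using sum.subset_diff[OF A0(1) Cons.prems(4), of "\<lambda>as. const (c as) * power_prod (x # xs) as"]
    by (simp add: algebra_simps)
  define g where "g = G + x * H"
  have gp: "g \<in> polys n"
    unfolding g_def using Gp mult_in_polys[OF xp Hp] by (auto intro: add_in_supp_in)
  show ?case
  proof (rule krull_intersection[OF J x, where Q = "\<lambda>z. z \<in> polys n \<and> g * z \<in> ?L"])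
    fix w assume "w \<in> polys n \<and> g * w \<in> ?L"
    then have w: "w \<in> polys n" "g * w \<in> ?L" by auto
    have "J \<subseteq> ?J'" by (rule adjoin_subset)
    then have gw: "g * w \<in> loc n ?J'" using w(2) loc_mono by blast
    have "x * (H * w) \<in> loc n ?J'"
      using adjoin_mult[OF ideal_zero[OF J] mult_in_polys[OF Hp w(1)]] subset_loc[OF J'] by blast
    from ideal_diff[OF ideal_loc[OF J'] gw this] have "G * w \<in> loc n ?J'"
      by (simp add: g_def algebra_simps)
    then have "w \<in> loc n ?J'"
      unfolding G_def
    proof (rule Cons.IH[OF J' xs, rotated -1])
      show "weakly_regular n ?J' xs" using Cons.prems(3) by simp
      show "finite B" "B \<noteq> {}" using Cons.prems(4) A0 finite_subset by (auto simp: B_def)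
      show "\<forall>bs\<in>B. length bs = length xs \<and> c' bs \<noteq> 0"
      proof
        fix bs assume "bs \<in> B"
        then obtain as where as: "as \<in> A0" "bs = tl as" by (auto simp: B_def)
        then have "e # bs \<in> A" using A0_Cons A0(1) by auto
        then show "length bs = length xs \<and> c' bs \<noteq> 0"
          using Cons.prems(6) by (auto simp: c'_def)
      qed
    qed (rule w(1))
    then obtain y p s where y: "y \<in> max_ideal n" "p \<in> J" "s \<in> polys n" "(1 + y) * w = p + x * s"
      unfolding loc_def adjoin_def by blast
    have pL: "p \<in> ?L" using y(2) subset_loc[OF J] by blast
    have "x * (g * s) = (1 + y) * (g * w) - g * p"
      using arg_cong[OF y(4), of "(*) g"] by (simp add: algebra_simps)
    also have "\<dots> \<in> ?L"
      by (rule ideal_diff[OF L ideal_mult[OF L one_plus_in_polys[OF y(1)] w(2)] ideal_mult[OF L gp pL]])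
    finally have "g * s \<in> ?L" by (rule reg[OF mult_in_polys[OF gp y(3)]])
    moreover have "(1 + y) * w - x * s \<in> ?L" using pL by (simp add: y(4))
    ultimately show "\<exists>z'. (z' \<in> polys n \<and> g * z' \<in> ?L) \<and> (\<exists>y\<in>max_ideal n. (1 + y) * w - x * z' \<in> ?L)"
      using y(1,3) by blast
  next
    have "x ^ e * (g * z) \<in> ?L" using Cons.prems(8) unfolding split g_def by (simp add: mult.assoc)
    then have "g * z \<in> ?L" by (rule regp[OF mult_in_polys[OF gp Cons.prems(7)]])
    with Cons.prems(7) show "z \<in> polys n \<and> g * z \<in> ?L" by blast
  qed simp
qed


subsection \<open>Algebraic dependence modulo a monomial prime\<close>

lemma restr_const_mult: "restr X (const c * p) = const c * restr X p"
  by (rule poly_mapping_eqI) simp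

lemma restr_sum: "restr X (sum f A) = (\<Sum>i\<in>A. restr X (f i))"
  by (rule poly_mapping_eqI) (simp add: lookup_sum)

lemma restr_zero_iff:
  assumes "p \<in> polys n"
  shows "restr (exps Z) p = 0 \<longleftrightarrow> p \<in> coprime_ideal n Z"
proof -
  have "restr (exps Z) p = 0 \<longleftrightarrow> Poly_Mapping.keys p \<inter> exps Z = {}"
    by (metis keys_restr keys_eq_empty)
  then show ?thesis using assms by (auto simp: coprime_ideal_def supp_in_def)
qed

text \<open>Bounding each exponent separately, instead of the total degree, makes the count in
  \<open>card_exps_box\<close> a plain power.\<close>

definition box :: "nat \<Rightarrow> (nat \<Rightarrow>\<^sub>0 nat) set" where
  "box N = {m. \<forall>i. Poly_Mapping.lookup m i \<le> N}"

lemma mult_in_box: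
  assumes "p \<in> supp_in (box M)" "q \<in> supp_in (box N)"
  shows "p * q \<in> supp_in (box (M + N))"
  using assms by (rule mult_in_supp_in) (simp add: box_def lookup_add add_mono)

lemma zero_in_box [simp]: "0 \<in> box N"
  by (simp add: box_def)

lemma power_in_box: "p \<in> supp_in (box M) \<Longrightarrow> p ^ k \<in> supp_in (box (k * M))"
proof (induction k)
  case (Suc k)
  then show ?case using mult_in_box[of p M "p ^ k" "k * M"] by simp
qed simp

lemma box_mono: "M \<le> N \<Longrightarrow> box M \<subseteq> box N"
  by (auto simp: box_def intro: order_trans)

lemma power_prod_in_box:
  assumes "set xs \<subseteq> supp_in (box D)" "set as \<subseteq> {..L}"
  shows "power_prod xs as \<in> supp_in (box (length xs * (L * D)))"
  using assms
proof (induction xs as rule: power_prod.induct)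
  case (1 x xs a as)
  have "x ^ a \<in> supp_in (box (a * D))" using 1 by (intro power_in_box) auto
  moreover have "a * D \<le> L * D" using 1 by auto
  ultimately have "x ^ a \<in> supp_in (box (L * D))"
    using supp_in_mono[OF box_mono] by blast
  then show ?case
    using mult_in_box[of "x ^ a" "L * D" "power_prod xs as" "length xs * (L * D)"] 1 by simp
qed simp_all

lemma ex_box: "\<exists>D. set xs \<subseteq> supp_in (box D)"
proof -
  define K where "K = (\<Union>p\<in>set xs. \<Union>m\<in>Poly_Mapping.keys p. Poly_Mapping.range m)"
  have fin: "finite K" by (simp add: K_def)
  \<comment> \<open>The inserted 0 covers the indices outside the keys and makes the maximum defined
    when \<open>K\<close> is empty.\<close>
  have "Poly_Mapping.lookup m i \<le> Max (insert 0 K)"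
    if "p \<in> set xs" "m \<in> Poly_Mapping.keys p" for p m i
  proof (cases "i \<in> Poly_Mapping.keys m")
    case True
    then have "Poly_Mapping.lookup m i \<in> K"
      using that unfolding K_def by (blast intro: in_keys_lookup_in_range)
    then show ?thesis using fin by simp
  qed (simp add: in_keys_iff)
  then show ?thesis by (intro exI[of _ "Max (insert 0 K)"]) (auto simp: supp_in_def box_def)
qed

lemma card_exps_box:
  assumes "finite Z"
  shows "finite (exps Z \<inter> box N)" "card (exps Z \<inter> box N) \<le> (N + 1) ^ card Z"
proof -
  let ?f = "\<lambda>m. restrict (Poly_Mapping.lookup m) Z"
  have inj: "inj_on ?f (exps Z \<inter> box N)"
  proof (rule inj_onI, rule poly_mapping_eqI)
    fix a b :: "nat \<Rightarrow>\<^sub>0 nat" and k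
    assume ab: "a \<in> exps Z \<inter> box N" "b \<in> exps Z \<inter> box N" "?f a = ?f b"
    show "Poly_Mapping.lookup a k = Poly_Mapping.lookup b k"
    proof (cases "k \<in> Z")
      case True
      then show ?thesis using fun_cong[OF ab(3), of k] by simp
    next
      case False
      then have "k \<notin> Poly_Mapping.keys a" "k \<notin> Poly_Mapping.keys b"
        using ab by (auto simp: exps_def)
      then show ?thesis by (simp add: in_keys_iff)
    qed
  qed
  have sub: "?f ` (exps Z \<inter> box N) \<subseteq> (\<Pi>\<^sub>E k\<in>Z. {..N})"
    by (auto simp: box_def)
  have fin: "finite (\<Pi>\<^sub>E k\<in>Z. {..N})" using assms by (intro finite_PiE) auto
  show "finite (exps Z \<inter> box N)"
    using finite_subset[OF sub fin] inj by (rule finite_imageD)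
  have "card (exps Z \<inter> box N) \<le> card (\<Pi>\<^sub>E k\<in>Z. {..N})"
    by (rule card_inj_on_le[OF inj sub fin])
  also have "\<dots> = (N + 1) ^ card Z" using assms by (simp add: card_PiE Suc_eq_plus1)
  finally show "card (exps Z \<inter> box N) \<le> (N + 1) ^ card Z" .
qed

text \<open>
  There are \<open>(L + 1)^k\<close> products with exponents up to \<open>L\<close>, and modulo the prime they lie in a space
  of dimension \<open>O(L^|Z|)\<close>.
\<close>

lemma algebraically_dependent:
  fixes xs :: "'a::field mpol list"
  assumes Z: "Z \<subseteq> {1..n}" and xs: "set xs \<subseteq> polys n" and len: "card Z < length xs"
  shows "\<exists>A c. finite A \<and> A \<noteq> {} \<and> (\<forall>as\<in>A. length as = length xs \<and> c as \<noteq> (0::'a)) \<and>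
    (\<Sum>as\<in>A. const (c as) * power_prod xs as) \<in> coprime_ideal n Z"
proof -
  let ?k = "length xs" and ?\<rho> = "restr (exps Z) :: 'a mpol \<Rightarrow> 'a mpol"
  obtain D where D: "set xs \<subseteq> supp_in (box D)" using ex_box by blast
  \<comment> \<open>Chosen to close the estimate in \<open>small\<close>: as \<open>N + 1\<close> is
    at most \<open>(?k * D + 1) * (L + 1)\<close>, the dimension is at most
    \<open>L * (L + 1) ^ card Z\<close>, which is less than
    \<open>(L + 1) ^ Suc (card Z)\<close>.\<close>
  define L where "L = (?k * D + 1) ^ card Z"
  define N where "N = ?k * (L * D)"
  define B where "B = {as. set as \<subseteq> {..L} \<and> length as = ?k}"
  define h where "h as = ?\<rho> (power_prod xs as)" for as
  have finB: "finite B" and cardB: "card B = (L + 1) ^ ?k"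
    using finite_lists_length_eq[of "{..L}" ?k] card_lists_length_eq[of "{..L}" ?k] by (simp_all add: B_def Suc_eq_plus1)
  have finZ: "finite Z" using Z finite_subset by blast
  let ?T = "mon ` (exps Z \<inter> box N) :: 'a mpol set"
  have finT: "finite ?T" using card_exps_box(1)[OF finZ] by simp
  have hT: "h ` B \<subseteq> mpol.span ?T"
  proof
    fix p assume "p \<in> h ` B"
    then obtain as where as: "p = h as" "as \<in> B" by blast
    have "power_prod xs as \<in> supp_in (box N)"
      unfolding N_def by (rule power_prod_in_box[OF D]) (use as(2) in \<open>simp add: B_def\<close>)
    then have "p \<in> supp_in (exps Z \<inter> box N)"
      by (auto simp: as h_def supp_in_def keys_restr)
    moreover have "?T = {mon m |m. m \<in> exps Z \<inter> box N}" by blast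
    ultimately show "p \<in> mpol.span ?T" by (simp only: span_mon)
  qed
  have small: "card ?T < card B"
  proof -
    have "card ?T \<le> (N + 1) ^ card Z"
      using card_image_le[OF card_exps_box(1)[OF finZ, of N], of "mon :: _ \<Rightarrow> 'a mpol"] card_exps_box(2)[OF finZ, of N]
      by linarith
    also have "\<dots> \<le> ((?k * D + 1) * (L + 1)) ^ card Z"
      by (intro power_mono) (simp_all add: N_def algebra_simps)
    also have "\<dots> = L * (L + 1) ^ card Z" by (simp add: power_mult_distrib L_def)
    also have "\<dots> < (L + 1) ^ Suc (card Z)" by simp
    also have "\<dots> \<le> (L + 1) ^ ?k" using len by (intro power_increasing) auto
    finally show ?thesis by (simp add: cardB)
  qed
  have polys: "(\<Sum>as\<in>A. const (c as) * power_prod xs as) \<in> polys n" for A and c :: "_ \<Rightarrow> 'a"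
    using power_prod_in_polys[OF xs] by (auto intro!: sum_in_supp_in)
  have relation: "(\<Sum>as\<in>A. const (c as) * power_prod xs as) \<in> coprime_ideal n Z"
    if "(\<Sum>as\<in>A. const (c as) * h as) = 0" for A c
    using that restr_zero_iff[OF polys, of Z] by (simp add: restr_sum restr_const_mult h_def)
  show ?thesis
  proof (cases "inj_on h B")
    case False
    then obtain as bs where ab: "as \<in> B" "bs \<in> B" "as \<noteq> bs" "h as = h bs" by (auto simp: inj_on_def)
    define c :: "nat list \<Rightarrow> 'a" where "c v = (if v = as then 1 else - 1)" for v
    have "(\<Sum>v\<in>{as, bs}. const (c v) * h v) = 0"
      using ab by (simp add: c_def const_neg_one_mult)
    from relation[OF this] show ?thesis
      using ab by (intro exI[of _ "{as, bs}"] exI[of _ c]) (auto simp: c_def B_def)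
  next
    case True
    then have "card (h ` B) = card B" by (rule card_image)
    then have "mpol.dependent (h ` B)"
      using mpol.independent_span_bound[OF finT _ hT] small by force
    then obtain t u where t: "finite t" "t \<subseteq> h ` B" "(\<Sum>v\<in>t. const (u v) * v) = 0" "\<exists>v\<in>t. u v \<noteq> 0"
      unfolding mpol.dependent_explicit by blast
    \<comment> \<open>Only the terms with non-zero coefficient are kept, as the conclusion
      requires.\<close>
    define A where "A = {as \<in> B. h as \<in> t \<and> u (h as) \<noteq> 0}"
    have A: "A \<subseteq> B" "finite A" using finB by (auto simp: A_def)
    have "h ` A = {v \<in> t. u v \<noteq> 0}" using t(2) by (auto simp: A_def)
    have "(\<Sum>as\<in>A. const (u (h as)) * h as) = (\<Sum>v\<in>h ` A. const (u v) * v)"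
      using sum.reindex[OF inj_on_subset[OF True A(1)], of "\<lambda>v. const (u v) * v"] by simp
    also have "\<dots> = (\<Sum>v\<in>t. const (u v) * v)"
      unfolding \<open>h ` A = _\<close> by (rule sum.mono_neutral_left) (use t(1) in auto)
    finally have "(\<Sum>as\<in>A. const (u (h as)) * h as) = 0" using t(3) by simp
    moreover have "A \<noteq> {}" using t(4) \<open>h ` A = _\<close> by blast
    ultimately show ?thesis
      using A relation[of "\<lambda>as. u (h as)" A]
      by (intro exI[of _ A] exI[of _ "\<lambda>as. u (h as)"]) (auto simp: A_def B_def)
  qed
qed

text \<open>For a longer sequence, some combination of its power products would annihilate
  \<open>mon w\<close> modulo the ideal, and torsion-freeness would make \<open>mon w\<close> vanish
  locally. But \<open>1 + y\<close> has constant coefficient 1, so \<open>(1 + y) * mon w\<close>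
  still contains the exponent \<open>w\<close>, which is not in \<open>U\<close>.\<close>

lemma weakly_regular_length:
  assumes U: "upset n U" and Z: "Z \<subseteq> {1..n}" and w: "w \<in> exps {1..n}"
    and ann: "\<And>e. e \<in> exps {1..n} \<Longrightarrow> w + e \<in> U \<longleftrightarrow> e \<notin> exps Z"
    and xs: "set xs \<subseteq> max_ideal n" and reg: "weakly_regular n (supp_in U :: 'a::field mpol set) xs"
  shows "length xs \<le> card Z"
proof (rule ccontr)
  let ?I = "supp_in U :: 'a mpol set"
  note I = ideal_supp_in[OF U, where ?'a='a]
  assume "\<not> ?thesis"
  moreover have "set xs \<subseteq> polys n" using xs ideal_subset[OF ideal_max_ideal] by blast
  ultimately obtain A c where A: "finite A" "A \<noteq> {}" "\<forall>as\<in>A. length as = length xs \<and> c as \<noteq> (0::'a)"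
    and G: "(\<Sum>as\<in>A. const (c as) * power_prod xs as) \<in> coprime_ideal n Z"
    using algebraically_dependent[OF Z, of xs] by (meson linorder_not_le)
  have "mon w * (\<Sum>as\<in>A. const (c as) * power_prod xs as) \<in> ?I"
    unfolding mon_mult_in_supp_in_iff using G ann by (auto simp: coprime_ideal_def supp_in_def)
  then have "(\<Sum>as\<in>A. const (c as) * power_prod xs as) * mon w \<in> loc n ?I"
    using subset_loc[OF I] by (auto simp: mult.commute)
  from weakly_regular_torsion_free[OF I xs reg A _ this] w
  have "mon w \<in> loc n ?I" by simp
  then obtain y where y: "y \<in> max_ideal n" "(1 + y) * mon w \<in> ?I" by (auto simp: loc_def)
  have "Poly_Mapping.lookup (1 + y) 0 = 1"
    using y(1) by (auto simp: max_ideal_def supp_in_def lookup_add in_keys_iff)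
  then have "0 \<in> Poly_Mapping.keys (1 + y)" by (simp add: in_keys_iff)
  then have "w + 0 \<in> U"
    using y(2) unfolding mult.commute[of "1 + y"] mon_mult_in_supp_in_iff by blast
  then show False using ann[of 0] by simp
qed


subsection \<open>Depth\<close>

fun adjoin_list :: "nat \<Rightarrow> 'a::field mpol set \<Rightarrow> 'a mpol list \<Rightarrow> 'a mpol set" where
  "adjoin_list n J [] = J"
| "adjoin_list n J (x # xs) = adjoin_list n (adjoin n J x) xs"

lemma weakly_regular_adjoin_list:
  "(\<forall>i<length xs. \<forall>z\<in>polys n. xs ! i * z \<in> adjoin_list n J (take i xs) \<longrightarrow>
      z \<in> adjoin_list n J (take i xs)) \<Longrightarrow> weakly_regular n J xs"
proof (induction xs arbitrary: J)
  case (Cons x xs)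
  have "\<forall>i<length xs. \<forall>z\<in>polys n. xs ! i * z \<in> adjoin_list n (adjoin n J x) (take i xs) \<longrightarrow>
      z \<in> adjoin_list n (adjoin n J x) (take i xs)"
  proof (intro allI impI)
    fix i assume "i < length xs"
    then show "\<forall>z\<in>polys n. xs ! i * z \<in> adjoin_list n (adjoin n J x) (take i xs) \<longrightarrow>
      z \<in> adjoin_list n (adjoin n J x) (take i xs)"
      using Cons.prems[rule_format, of "Suc i"] by simp
  qed
  from Cons.IH[OF this] show ?case using Cons.prems[rule_format, of 0] by simp
qed simp

lemma ideal_adjoin_list:
  "ideal J (poly_ring n) \<Longrightarrow> set xs \<subseteq> polys n \<Longrightarrow> ideal (adjoin_list n J xs) (poly_ring n)"
proof (induction xs arbitrary: J)
  case (Cons x xs)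
  then have "ideal (adjoin n J x) (poly_ring n)" by (intro ideal_adjoin) simp_all
  then show ?case using Cons by simp
qed simp

lemma adjoin_list_subset:
  "ideal J (poly_ring n) \<Longrightarrow> set xs \<subseteq> polys n \<Longrightarrow> J \<union> set xs \<subseteq> adjoin_list n J xs"
proof (induction xs arbitrary: J)
  case (Cons x xs)
  have J': "ideal (adjoin n J x) (poly_ring n)" using Cons.prems by (intro ideal_adjoin) simp_all
  have "x * 1 \<in> adjoin n J x"
    by (rule adjoin_mult) (use ideal_zero[OF Cons.prems(1)] in simp_all)
  moreover have "adjoin n J x \<union> set xs \<subseteq> adjoin_list n (adjoin n J x) xs"
    using Cons.IH[OF J'] Cons.prems(2) by simp
  ultimately show ?case using adjoin_subset[of J n x] by auto
qed simp

lemma adjoin_list_subset_ideal: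
  assumes K: "ideal K (poly_ring n)"
  shows "J \<subseteq> K \<Longrightarrow> set xs \<subseteq> K \<Longrightarrow> adjoin_list n J xs \<subseteq> K"
  by (induction xs arbitrary: J) (simp_all add: adjoin_subset_ideal[OF K])

lemma group_quot_module:
  assumes I: "ideal I (poly_ring n)"
  shows "Group.group (add_monoid (quot_module (poly_ring n) (polys n) I))" (is "Group.group ?G")
proof (rule groupI)
  fix X Y W assume "X \<in> carrier ?G" "Y \<in> carrier ?G" "W \<in> carrier ?G"
  then show "X \<otimes>\<^bsub>?G\<^esub> Y \<otimes>\<^bsub>?G\<^esub> W = X \<otimes>\<^bsub>?G\<^esub> (Y \<otimes>\<^bsub>?G\<^esub> W)"
    by (auto simp: coset_add[OF I] add.assoc)
next
  fix X Y assume "X \<in> carrier ?G" "Y \<in> carrier ?G"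
  then show "X \<otimes>\<^bsub>?G\<^esub> Y \<in> carrier ?G"
    by (auto simp: coset_add[OF I] intro!: imageI add_in_supp_in)
next
  show "\<one>\<^bsub>?G\<^esub> \<in> carrier ?G"
    by (auto intro!: image_eqI[of _ _ 0] simp: coset_zero)
next
  fix X assume "X \<in> carrier ?G"
  then obtain x where x: "x \<in> polys n" "X = I +>\<^bsub>poly_ring n\<^esub> x" by auto
  show "\<one>\<^bsub>?G\<^esub> \<otimes>\<^bsub>?G\<^esub> X = X"
    using coset_add[OF I, of 0 x] x by (simp add: coset_zero)
  show "\<exists>Y\<in>carrier ?G. Y \<otimes>\<^bsub>?G\<^esub> X = \<one>\<^bsub>?G\<^esub>"
    by (rule bexI[of _ "I +>\<^bsub>poly_ring n\<^esub> (- x)"])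
      (use x coset_add[OF I, of "- x" x] in \<open>simp_all add: coset_zero\<close>)
qed

text \<open>Submodules of S/I correspond to ideals over I. One direction tests the intersection
  against the image of \<open>adjoin_list n I ys\<close>; the other pulls an arbitrary submodule
  back to the ideal \<open>K\<close>.\<close>

lemma times_module_quot_module:
  assumes I: "ideal I (poly_ring n)" and ys: "set ys \<subseteq> polys n" and z: "z \<in> polys n"
  shows "I +>\<^bsub>poly_ring n\<^esub> z \<in> times_module (poly_ring n) (quot_module (poly_ring n) (polys n) I) (set ys)
    \<longleftrightarrow> z \<in> adjoin_list n I ys" (is "?X z \<in> times_module ?R ?M _ \<longleftrightarrow> _")
proof
  let ?J = "adjoin_list n I ys"
  note J = ideal_adjoin_list[OF I ys] and sub = adjoin_list_subset[OF I ys]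
  assume zt: "?X z \<in> times_module ?R ?M (set ys)"
  have "subgroup (?X ` ?J) (add_monoid ?M)"
  proof (rule group.subgroupI[OF group_quot_module[OF I]])
    show "?X ` ?J \<subseteq> carrier (add_monoid ?M)" using ideal_subset[OF J] by auto
    show "?X ` ?J \<noteq> {}" using ideal_zero[OF J] by blast
  next
    fix X assume "X \<in> ?X ` ?J"
    then obtain x where x: "x \<in> ?J" "X = ?X x" by blast
    have xp: "x \<in> polys n" using x(1) ideal_subset[OF J] by blast
    have "inv\<^bsub>add_monoid ?M\<^esub> X = ?X (- x)"
      by (rule group.inv_equality[OF group_quot_module[OF I]])
        (use x xp coset_add[OF I, of "- x" x] in \<open>simp_all add: coset_zero\<close>)
    then show "inv\<^bsub>add_monoid ?M\<^esub> X \<in> ?X ` ?J"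
      using ideal_uminus[OF J x(1)] by blast
  next
    fix X Y assume "X \<in> ?X ` ?J" "Y \<in> ?X ` ?J"
    then show "X \<otimes>\<^bsub>add_monoid ?M\<^esub> Y \<in> ?X ` ?J"
      by (auto simp: coset_add[OF I] intro!: imageI ideal_add[OF J])
  qed
  moreover have "r \<odot>\<^bsub>?M\<^esub> X \<in> ?X ` ?J" if r: "r \<in> polys n" and X: "X \<in> ?X ` ?J" for r X
  proof -
    obtain x where x: "x \<in> ?J" "X = ?X x" using X by blast
    then have "r \<odot>\<^bsub>?M\<^esub> X = ?X (r * x)" using coset_smult[OF I r] by simp
    then show ?thesis using ideal_mult[OF J r x(1)] by blast
  qed
  ultimately have "submodule (?X ` ?J) ?R ?M"
    by (simp add: submodule_def submodule_axioms_def)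
  moreover have "{a \<odot>\<^bsub>?M\<^esub> v |a v. a \<in> set ys \<and> v \<in> carrier ?M} \<subseteq> ?X ` ?J"
  proof clarify
    fix a v assume a: "a \<in> set ys" and "v \<in> carrier ?M"
    then obtain x where x: "x \<in> polys n" "v = ?X x" by auto
    have "a * x \<in> ?J" using ideal_mult[OF J x(1), of a] a sub by (auto simp: mult.commute)
    moreover have "a \<odot>\<^bsub>?M\<^esub> v = ?X (a * x)" using coset_smult[OF I, of a x] a ys x by auto
    ultimately show "a \<odot>\<^bsub>?M\<^esub> v \<in> ?X ` ?J" by blast
  qed
  ultimately have "?X z \<in> ?X ` ?J" using zt unfolding times_module_def by blast
  then obtain x where x: "x \<in> ?J" "?X z = ?X x" by blast
  then have "z - x \<in> ?J" using coset_eq_iff[OF I] sub by blast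
  from ideal_add[OF J this x(1)] show "z \<in> ?J" by simp
next
  assume zJ: "z \<in> adjoin_list n I ys"
  show "?X z \<in> times_module ?R ?M (set ys)"
    unfolding times_module_def
  proof clarify
    fix N assume N: "submodule N ?R ?M" and gen: "{a \<odot>\<^bsub>?M\<^esub> v |a v. a \<in> set ys \<and> v \<in> carrier ?M} \<subseteq> N"
    note sg = submodule.axioms(1)[OF N]
    define K where "K = {x \<in> polys n. ?X x \<in> N}"
    have "0 \<in> K" using subgroup.one_closed[OF sg] by (simp add: K_def coset_zero)
    moreover have "x + y \<in> K" if "x \<in> K" "y \<in> K" for x y
      using subgroup.m_closed[OF sg, of "?X x" "?X y"] that
      by (simp add: K_def coset_add[OF I] add_in_supp_in)
    moreover have "r * x \<in> K" if r: "r \<in> polys n" and x: "x \<in> K" for r x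
      using submodule.smult_closed[OF N, of r "?X x"] x r mult_in_polys[OF r, of x] coset_smult[OF I r, of x]
      by (simp add: K_def)
    moreover have "K \<subseteq> polys n" by (auto simp: K_def)
    ultimately have K: "ideal K ?R" unfolding ideal_iff by blast
    have "x \<in> K" if x: "x \<in> I" for x
    proof -
      have "?X x = ?X 0" using coset_eq_iff[OF I, of x 0] x by simp
      then show ?thesis using \<open>0 \<in> K\<close> x ideal_subset[OF I] by (auto simp: K_def)
    qed
    moreover have "y \<in> K" if y: "y \<in> set ys" for y
    proof -
      have "?X 1 \<in> carrier ?M" by simp
      then have "y \<odot>\<^bsub>?M\<^esub> ?X 1 \<in> N" using gen y by blast
      then show ?thesis using coset_smult[OF I, of y 1] y ys by (auto simp: K_def)
    qed
    ultimately have "adjoin_list n I ys \<subseteq> K" by (intro adjoin_list_subset_ideal[OF K]) auto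
    then show "?X z \<in> N" using zJ by (auto simp: K_def)
  qed
qed

lemma quot_depth_le:
  assumes U: "upset n U" and Z: "Z \<subseteq> {1..n}" and w: "w \<in> exps {1..n}"
    and ann: "\<And>e. e \<in> exps {1..n} \<Longrightarrow> w + e \<in> U \<longleftrightarrow> e \<notin> exps Z"
  shows "quot_depth n (supp_in U :: 'a::field mpol set) \<le> enat (card Z)"
proof -
  let ?R = "poly_ring n :: 'a mpol ring" and ?I = "supp_in U :: 'a mpol set"
  let ?M = "quot_module ?R (polys n) ?I"
  note I = ideal_supp_in[OF U, where ?'a='a]
  \<comment> \<open>The coset of \<open>mon w\<close> is non-zero, so the depth is the supremum and
    not the value for the zero module.\<close>
  have "w \<notin> U" using ann[of 0] by simp
  then have "?I +>\<^bsub>?R\<^esub> mon w \<noteq> ?I"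
    using coset_eq_iff[OF I, of "mon w" 0] by (simp add: coset_zero)
  then have ne: "carrier ?M \<noteq> {\<zero>\<^bsub>?M\<^esub>}" using w by auto
  have "length xs \<le> card Z"
    if xs: "set xs \<subseteq> max_ideal n" and reg: "regular_sequence ?R ?M xs" for xs
  proof (rule weakly_regular_length[OF U Z w ann xs])
    have xsp: "set xs \<subseteq> polys n" using xs ideal_subset[OF ideal_max_ideal] by blast
    show "weakly_regular n ?I xs"
    proof (rule weakly_regular_adjoin_list, intro allI impI ballI)
      fix i z assume i: "i < length xs" and z: "z \<in> polys n" "xs ! i * z \<in> adjoin_list n ?I (take i xs)"
      have ys: "set (take i xs) \<subseteq> polys n" using xsp set_take_subset[of i xs] by blast
      have x: "xs ! i \<in> polys n" using i xsp by (meson nth_mem subsetD)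
      have "?I +>\<^bsub>?R\<^esub> (xs ! i * z) \<in> times_module ?R ?M (set (take i xs))"
        using times_module_quot_module[OF I ys mult_in_polys[OF x z(1)]] z(2) by blast
      then have "xs ! i \<odot>\<^bsub>?M\<^esub> (?I +>\<^bsub>?R\<^esub> z) \<in> times_module ?R ?M (set (take i xs))"
        using coset_smult[OF I x, of z] by simp
      then have "?I +>\<^bsub>?R\<^esub> z \<in> times_module ?R ?M (set (take i xs))"
        using reg i z(1) unfolding regular_sequence_def quot_module_simps(1) by blast
      then show "z \<in> adjoin_list n ?I (take i xs)"
        using times_module_quot_module[OF I ys z(1)] by blast
    qed
  qed
  then show ?thesis
    unfolding quot_depth_def module_depth_def max_ideal_eq[symmetric] using ne
    by (auto intro!: SUP_least)
qed

text \<open>Part (3) is this result for the image ideal, whose pretty cleanness is part (2).\<close>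

lemma pretty_clean_imp_stanley_ideal:
  fixes I :: "'a::field mpol set"
  assumes "pretty_clean n I"
  shows "stanley_ideal n I"
proof -
  obtain r V m Z where chain: "cell_chain n r V m Z" and I: "I = supp_in (V 0)"
    and pc: "\<forall>i\<in>{1..r}. \<forall>j\<in>{1..r}. i < j \<longrightarrow> Z j \<subseteq> Z i \<longrightarrow> Z i = Z j"
    using assms unfolding pretty_clean_iff by (elim exE conjE) (rule that)
  have U: "upset n (V 0)" by (rule cell_chainD(1)[OF chain]) simp
  have "quot_depth n I \<le> enat (card (Z j))" if j: "j \<in> {1..r}" for j
  proof -
    obtain w where w: "w \<in> exps {1..n}" "\<forall>e\<in>exps {1..n}. w + e \<in> V 0 \<longleftrightarrow> e \<notin> exps (Z j)"
      using pretty_clean_annihilator[OF chain _ j] pc by metis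
    show ?thesis
      unfolding I by (rule quot_depth_le[OF U cell_chainD(4)[OF chain j] w(1)]) (use w(2) in blast)
  qed
  then have "quot_depth n I \<le> sdepth n I"
    using sdepth_cell_chain[OF chain, of "quot_depth n I", where ?'a='a] I by blast
  moreover have "monomial_ideal n I" using U I by (auto simp: monomial_ideal_iff)
  ultimately show ?thesis by (simp add: stanley_ideal_def)
qed

theorem corollary2p2:
  fixes n :: nat
    and \<phi> :: "'a::field mpol \<Rightarrow> 'a mpol"
    and I :: "'a mpol set"
  assumes "n \<ge> 1"
    and "algebra_hom n (n - 1) \<phi>"
    and "\<And>i. i \<in> {1..n - 1} \<Longrightarrow> \<phi> (var i) = var i"
    and "\<phi> (var n) = 1"
    and "monomial_ideal n I"
  shows "(clean n I \<longrightarrow> clean (n - 1) (\<phi> ` I)) \<and>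
         (pretty_clean n I \<longrightarrow> pretty_clean (n - 1) (\<phi> ` I)) \<and>
         (pretty_clean n I \<longrightarrow> stanley_ideal (n - 1) (\<phi> ` I))"
  using clean_hom_image[OF assms(1-4)] pretty_clean_hom_image[OF assms(1-4)]
    pretty_clean_imp_stanley_ideal by blast

end
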